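(* Let $c>0$ be a constant, $p=c\log n/n$ and $t=\Phi^{-1}(1-p)$. For each $n$ (large enough that $p<1$) let $d=d(n)\ge 1$ be an integer, let $\mathbf X_n=(X_{i,j})_{1\le i<j\le n}$ be independent standard normal vectors in $\mathbb R^d$, and for $s\in S^{d-1}$ let $\Gamma(\mathbf X_n,s,t)$ be the random graph on vertex set $[n]$ whose edges are the pairs $\{i,j\}$ with $\langle X_{i,j},s\rangle\ge t$. Then with high probability the following hold. (i) If $c<1$, then for any $\epsilon\in(0,c)$, if $d=O(n^{1-c-\epsilon})$, then for all $s\in S^{d-1}$, $\Gamma(\mathbf X_n,s,t)$ is disconnected. (ii) There exists an absolute constant $C$ such that if $d\ge Cn\sqrt{\log n}$, then there exists $s\in S^{d-1}$ such that $\Gamma(\mathbf X_n,s,t)$ is connected. (iii) If $c>1$, then for any $\epsilon>0$, if $d\le(1-\epsilon)(c-1)\log n/\log\log n$, then for all $s\in S^{d-1}$, $\Gamma(\mathbf X_n,s,t)$ is connected. (iv) If $c>1$, then for any $\epsilon>0$, if $d\ge(2+\epsilon)(c-1)\log n/\log\log n$, then for some $s\in S^{d-1}$, $\Gamma(\mathbf X_n,s,t)$ is disconnected.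
   Context: $[n]=\{1,\dots,n\}$; $S^{d-1}$ is the Euclidean unit sphere in $\mathbb R^d$; $\langle\cdot,\cdot\rangle$ is the usual inner product; $\Phi$ is the distribution function of a standard normal random variable. $\log$ is the natural logarithm. A sequence of events $A_n$ holds with high probability if $\lim_{n\to\infty}\mathbb P\{A_n\}=1$. The dimension $d=d(n)$ may depend on $n$, all asymptotics are as $n\to\infty$ with $c,\epsilon$ fixed, and each of (i)–(iv) is a separate statement asserting that, under its hypotheses, its conclusion holds with high probability. *)

theory Defs
  imports "HOL-Probability.Probability" "Graph_Theory.Digraph_Component"
begin

text \<open>As d varies with n inside the statement, a vector of dimension d is an extensional function on the index set \<open>{..<d}\<close>, that is, a point of the
  product measurable space below.\<close>

definition Rd :: "nat \<Rightarrow> (nat \<Rightarrow> real) measure" where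
  "Rd d = (\<Pi>\<^sub>M k\<in>{..<d}. borel)"

definition inner_prod :: "nat \<Rightarrow> (nat \<Rightarrow> real) \<Rightarrow> (nat \<Rightarrow> real) \<Rightarrow> real" where
  "inner_prod d x y = (\<Sum>k<d. x k * y k)"

definition unit_sphere :: "nat \<Rightarrow> (nat \<Rightarrow> real) set" where
  "unit_sphere d = {s \<in> space (Rd d). L2_set s {..<d} = 1}"

definition std_normal_vector :: "'w measure \<Rightarrow> nat \<Rightarrow> ('w \<Rightarrow> nat \<Rightarrow> real) \<Rightarrow> bool" where
  "std_normal_vector M d Y \<longleftrightarrow>
     Y \<in> M \<rightarrow>\<^sub>M Rd d \<and>
     distr M (Rd d) Y = (\<Pi>\<^sub>M k\<in>{..<d}. std_normal_distribution)"

definition pairs :: "nat \<Rightarrow> (nat \<times> nat) set" where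
  "pairs n = {(i, j). 1 \<le> i \<and> i < j \<and> j \<le> n}"

text \<open>An undirected graph is encoded as the digraph that has both arcs \<open>(i, j)\<close> and \<open>(j, i)\<close>
  for every edge \<open>{i, j}\<close>.\<close>

definition Gam ::
  "nat \<Rightarrow> nat \<Rightarrow> (nat \<times> nat \<Rightarrow> nat \<Rightarrow> real) \<Rightarrow> (nat \<Rightarrow> real) \<Rightarrow> real \<Rightarrow> nat pair_pre_digraph" where
  "Gam n d x s t =
     (let E = {e \<in> pairs n. inner_prod d (x e) s \<ge> t}
      in \<lparr> pverts = {1..n}, parcs = E \<union> E\<inverse> \<rparr>)"

definition graph_connected :: "nat pair_pre_digraph \<Rightarrow> bool" where
  "graph_connected G \<longleftrightarrow> Digraph_Component.connected (with_proj G)"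

definition edge_prob :: "real \<Rightarrow> nat \<Rightarrow> real" where
  "edge_prob c n = c * ln (real n) / real n"

text \<open>The standard normal distribution function is a bijection from the reals onto the open unit
  interval, so this is the genuine quantile as soon as \<open>0 < edge_prob c n < 1\<close>.\<close>

definition threshold :: "real \<Rightarrow> nat \<Rightarrow> real" where
  "threshold c n = inv (cdf std_normal_distribution) (1 - edge_prob c n)"

text \<open>The probability spaces of different \<open>n\<close> need not be related; the case of a single space
  is that of a constant \<open>M\<close>.\<close>

definition gaussian_model ::
  "real \<Rightarrow> (nat \<Rightarrow> nat) \<Rightarrow> (nat \<Rightarrow> 'w measure) \<Rightarrow> (nat \<Rightarrow> nat \<times> nat \<Rightarrow> 'w \<Rightarrow> nat \<Rightarrow> real) \<Rightarrow> bool" where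
  "gaussian_model c d M X \<longleftrightarrow>
     (\<forall>n\<ge>1. edge_prob c n < 1 \<longrightarrow>
        d n \<ge> 1 \<and> prob_space (M n) \<and>
        prob_space.indep_vars (M n) (\<lambda>_. Rd (d n)) (X n) (pairs n) \<and>
        (\<forall>e\<in>pairs n. std_normal_vector (M n) (d n) (X n e)))"

definition rand_graph ::
  "real \<Rightarrow> (nat \<Rightarrow> nat) \<Rightarrow> (nat \<Rightarrow> nat \<times> nat \<Rightarrow> 'w \<Rightarrow> nat \<Rightarrow> real) \<Rightarrow>
   nat \<Rightarrow> 'w \<Rightarrow> (nat \<Rightarrow> real) \<Rightarrow> nat pair_pre_digraph" where
  "rand_graph c d X n \<omega> s = Gam n (d n) (\<lambda>e. X n e \<omega>) s (threshold c n)"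

text \<open>A non-measurable set has \<open>measure\<close> 0, so \<open>whp M A\<close> also
  implies that the events are eventually measurable; no outer measure is involved.\<close>

definition whp :: "(nat \<Rightarrow> 'w measure) \<Rightarrow> (nat \<Rightarrow> 'w \<Rightarrow> bool) \<Rightarrow> bool" where
  "whp M A \<longleftrightarrow> (\<lambda>n. measure (M n) {\<omega> \<in> space (M n). A n \<omega>}) \<longlonglongrightarrow> 1"

end

theory Submission
  imports Defs "HOL-Real_Asymp.Real_Asymp"
begin

text \<open>
  For a fixed direction the graph is a binomial random graph, and for all directions at once one controls it on
  a net of the sphere, the perturbation being absorbed by a small change of the threshold.

  (i) The probability that the binomial graph with average degree about \<open>c ln n\<close> has no isolated vertex is at most
  \<open>exp (- n powr (1 - c - o(1)))\<close>, which beats the size \<open>exp (O(d ln n))\<close> of a fine net.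
  (iii) That graph is disconnected with probability about \<open>n powr (1 - c)\<close>, and a net of mesh slightly below
  \<open>1 / ln n\<close> suffices.

  (ii) The first coordinate alone gives a graph in which, with high probability, no cut with at least
  \<open>h = n powr (1 - \<gamma>)\<close> vertices on both sides is empty. A star with at most \<open>2 h\<close> edges makes it connected. Tilting
  the first axis slightly towards the sum of the remaining coordinates of the star's vectors puts all of the star above
  the threshold, since this sum is nearly aligned with each of so few summands in dimension about \<open>n\<close>, while it is
  noise of bounded size for the other edges.

  (iv) Second moment method for the number of pairs of a vertex and a point of a large code on the sphere such that the
  vertex is isolated in the direction of the point.
\<close>

section \<open>Cuts and measurability\<close>

text \<open>The constants 1 in (iii) and 2 in (iv) come from two length scales. In these dimensions
  \<open>t\<close> and the largest norms of the edge vectors are of order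
  \<open>sqrt (ln n)\<close>, so moving the direction by \<open>r\<close> changes the edge
  probability by a factor \<open>1 + O(r ln n)\<close>. A net thus needs a mesh below
  \<open>1 / ln n\<close>, and its roughly \<open>(ln n) powr d\<close> points have to be paid for
  by the failure probability \<open>n powr (1 - c)\<close>. In the second moment, two directions at
  squared distance \<open>D\<close> share a given edge with probability at most about
  \<open>p * exp (- t\<^sup>2 * D / 8)\<close>. This is small compared with \<open>1 / n\<close>
  once \<open>D\<close> is a large multiple of \<open>ln (ln n) / ln n\<close>, and a code with this
  separation has only about \<open>(ln n) powr (d / 2)\<close> points.

  In (ii) the star to be repaired is random, but it is a function of the first coordinates, while
  the tilt uses only the other ones. Their independence allows all estimates to be made for a fixed
  star and averaged over the graph, so no union bound over the possible stars is paid.\<close>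

definition cut_set :: "nat \<Rightarrow> nat set \<Rightarrow> (nat \<times> nat) set" where
  "cut_set n S = {(i, j) \<in> pairs n. (i \<in> S) \<noteq> (j \<in> S)}"

text \<open>Connectivity without paths: its failure is a finite union, over vertex sets, of events
  that all edges of a fixed cut are absent. This is the form that independence and union bounds can
  use.\<close>

definition cut_connected :: "nat \<Rightarrow> (nat \<times> nat) set \<Rightarrow> bool" where
  "cut_connected n E \<longleftrightarrow>
     (\<forall>S\<subseteq>{1..n}. S \<noteq> {} \<longrightarrow> S \<noteq> {1..n} \<longrightarrow> E \<inter> cut_set n S \<noteq> {})"

lemma finite_pairs [simp]: "finite (pairs n)"
proof -
  have "pairs n \<subseteq> {1..n} \<times> {1..n}" by (auto simp: pairs_def)
  thus ?thesis by (rule finite_subset) auto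
qed

lemma card_pairs_le: "real (card (pairs n)) \<le> (real n)\<^sup>2"
proof -
  have "card (pairs n) \<le> card ({1..n} \<times> {1..n})" by (intro card_mono) (auto simp: pairs_def)
  hence "real (card (pairs n)) \<le> real (n * n)" unfolding of_nat_le_iff by (simp add: card_cartesian_product)
  thus ?thesis by (simp add: power2_eq_square)
qed

lemma cut_set_subset: "cut_set n S \<subseteq> pairs n"
  by (auto simp: cut_set_def)

lemma finite_cut_set [simp]: "finite (cut_set n S)"
  by (rule finite_subset[OF cut_set_subset]) auto

lemma cut_connected_mono: "cut_connected n E \<Longrightarrow> E \<subseteq> E' \<Longrightarrow> cut_connected n E'"
  unfolding cut_connected_def by blast

text \<open>A path that leaves \<open>S\<close> crosses the cut of \<open>S\<close>; conversely the
  set of vertices reachable from \<open>u\<close> has an empty cut. \<open>n \<ge> 1\<close> enters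
  because strong connectivity asks for a nonempty vertex set.\<close>

lemma connected_iff_cut_connected:
  assumes E: "E \<subseteq> pairs n" and n: "n \<ge> 1"
  shows "graph_connected \<lparr>pverts = {1..n}, parcs = E \<union> E\<inverse>\<rparr> \<longleftrightarrow> cut_connected n E"
proof -
  let ?V = "{1..n}" and ?R = "E \<union> E\<inverse>"
  let ?G = "\<lparr>pverts = {1..n}, parcs = E \<union> E\<inverse>\<rparr>"
  have ms: "parcs (mk_symmetric (with_proj ?G)) = ?R"
    by (auto simp: parcs_mk_symmetric)
  have "arcs_ends (with_proj (mk_symmetric (with_proj ?G))) = ?R"
    using ms by (simp add: arcs_ends_def arc_to_ends_def)
  hence A: "graph_connected ?G \<longleftrightarrow> (\<forall>u\<in>?V. \<forall>v\<in>?V. (u, v) \<in> rtrancl_on ?V ?R)"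
    using n unfolding graph_connected_def Digraph_Component.connected_def strongly_connected_def
    by (simp add: reachable_def)
  have EV: "i \<in> ?V" "j \<in> ?V" if "(i, j) \<in> ?R" for i j
    using that E by (auto simp: pairs_def)
  have "cut_connected n E" if R: "\<forall>u\<in>?V. \<forall>v\<in>?V. (u, v) \<in> rtrancl_on ?V ?R"
    unfolding cut_connected_def
  proof (intro allI impI notI)
    fix S assume S: "S \<subseteq> ?V" "S \<noteq> {}" "S \<noteq> ?V" and no: "E \<inter> cut_set n S = {}"
    obtain a b where ab: "a \<in> S" "b \<in> ?V" "b \<notin> S" using S by blast
    have "(a, b) \<in> rtrancl_on ?V ?R" using R ab S by blast
    hence "b \<in> S"
    proof (induct rule: rtrancl_on_induct)
      case base show ?case by (rule ab)
    next
      case (step y z)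
      from step(2) no E step(5) show ?case by (auto simp: cut_set_def pairs_def)
    qed
    thus False using ab by blast
  qed
  moreover have "(u, v) \<in> rtrancl_on ?V ?R" if C: "cut_connected n E" and u: "u \<in> ?V" and v: "v \<in> ?V" for u v
  proof (rule ccontr)
    assume nv: "(u, v) \<notin> rtrancl_on ?V ?R"
    let ?S = "{w\<in>?V. (u, w) \<in> rtrancl_on ?V ?R}"
    have "u \<in> ?S" using u by auto
    hence "E \<inter> cut_set n ?S \<noteq> {}" using C nv v unfolding cut_connected_def by (metis (no_types, lifting) empty_iff mem_Collect_eq subsetI)
    then obtain i j where ij: "(i, j) \<in> E" "(i \<in> ?S) \<noteq> (j \<in> ?S)" by (auto simp: cut_set_def)
    have "(i, j) \<in> ?R" "(j, i) \<in> ?R" "i \<in> ?V" "j \<in> ?V" using ij EV[of i j] by auto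
    thus False using ij(2) rtrancl_on_into_rtrancl_on[of u i ?V ?R j] rtrancl_on_into_rtrancl_on[of u j ?V ?R i]
      by blast
  qed
  ultimately show ?thesis using A by blast
qed

definition edge_set :: "nat \<Rightarrow> nat \<Rightarrow> (nat \<times> nat \<Rightarrow> nat \<Rightarrow> real) \<Rightarrow> (nat \<Rightarrow> real) \<Rightarrow> real \<Rightarrow> (nat \<times> nat) set" where
  "edge_set n d x s t = {e \<in> pairs n. inner_prod d (x e) s \<ge> t}"

lemma graph_connected_Gam:
  "n \<ge> 1 \<Longrightarrow> graph_connected (Gam n d x s t) \<longleftrightarrow> cut_connected n (edge_set n d x s t)"
  unfolding Gam_def edge_set_def Let_def by (rule connected_iff_cut_connected) auto

section \<open>Countable descriptions of the events over the sphere, and their measurability\<close>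

lemma unit_sphere_iff:
  "s \<in> unit_sphere d \<longleftrightarrow> s \<in> extensional {..<d} \<and> (\<Sum>k<d. (s k)\<^sup>2) = 1"
  by (auto simp: unit_sphere_def Rd_def space_PiM PiE_UNIV_domain L2_set_def PiE_def)

text \<open>The quantifiers over the sphere are replaced by countable ones over integer vectors, whose directions
  are dense. Strict inequalities need density only; non-strict ones also need the compactness of the sphere.\<close>

definition int_vecs :: "nat \<Rightarrow> (nat \<Rightarrow> int) set" where
  "int_vecs d = {z \<in> PiE {..<d} (\<lambda>_. UNIV). \<exists>k<d. z k \<noteq> 0}"

lemma countable_int_vecs: "countable (int_vecs d)"
  unfolding int_vecs_def
  by (rule countable_subset[OF _ countable_PiE[of "{..<d}" "\<lambda>_. UNIV :: int set"]]) auto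

lemma inner_prod_scale: "inner_prod d x (\<lambda>k. a * s k) = a * inner_prod d x s"
  by (simp add: inner_prod_def sum_distrib_left mult_ac)

lemma inner_prod_cong: "(\<And>k. k < d \<Longrightarrow> s k = s' k) \<Longrightarrow> inner_prod d x s = inner_prod d x s'"
  by (simp add: inner_prod_def)

lemma sphere_of_vec:
  assumes z: "0 < (\<Sum>k<d. (z k)\<^sup>2)" and s_def: "s = (\<lambda>k\<in>{..<d}. z k / sqrt (\<Sum>k<d. (z k)\<^sup>2))"
  shows "s \<in> unit_sphere d" "inner_prod d x s = inner_prod d x z / sqrt (\<Sum>k<d. (z k)\<^sup>2)"
proof -
  let ?N = "\<Sum>k<d. (z k)\<^sup>2"
  have "(\<Sum>k<d. (s k)\<^sup>2) = (\<Sum>k<d. (z k)\<^sup>2 / ?N)"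
    using z by (intro sum.cong) (auto simp: s_def power_divide)
  also have "\<dots> = 1" using z by (simp add: sum_divide_distrib[symmetric])
  finally show "s \<in> unit_sphere d" by (auto simp: unit_sphere_iff s_def)
  have "inner_prod d x s = inner_prod d x (\<lambda>k. (1 / sqrt ?N) * z k)"
    by (rule inner_prod_cong) (simp add: s_def)
  thus "inner_prod d x s = inner_prod d x z / sqrt ?N" unfolding inner_prod_scale by simp
qed

lemma floor_scaled_tendsto: "(\<lambda>m::nat. real_of_int \<lfloor>real (Suc m) * a\<rfloor> / real (Suc m)) \<longlonglongrightarrow> a"
proof (rule tendsto_sandwich)
  show "\<forall>\<^sub>F m in sequentially. a - 1 / real (Suc m) \<le> real_of_int \<lfloor>real (Suc m) * a\<rfloor> / real (Suc m)"
  proof (rule always_eventually, rule allI)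
    fix m
    have "real (Suc m) * a - 1 \<le> real_of_int \<lfloor>real (Suc m) * a\<rfloor>" by linarith
    hence "(real (Suc m) * a - 1) / real (Suc m) \<le> real_of_int \<lfloor>real (Suc m) * a\<rfloor> / real (Suc m)"
      by (rule divide_right_mono) simp
    thus "a - 1 / real (Suc m) \<le> real_of_int \<lfloor>real (Suc m) * a\<rfloor> / real (Suc m)"
      by (simp add: diff_divide_distrib del: of_nat_Suc)
  qed
  show "\<forall>\<^sub>F m in sequentially. real_of_int \<lfloor>real (Suc m) * a\<rfloor> / real (Suc m) \<le> a"
  proof (rule always_eventually, rule allI)
    fix m
    have "real_of_int \<lfloor>real (Suc m) * a\<rfloor> \<le> real (Suc m) * a" by linarith
    thus "real_of_int \<lfloor>real (Suc m) * a\<rfloor> / real (Suc m) \<le> a"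
      by (simp add: field_simps del: of_nat_Suc)
  qed
  show "(\<lambda>m. a - 1 / real (Suc m)) \<longlonglongrightarrow> a"
    using tendsto_diff[OF tendsto_const LIMSEQ_inverse_real_of_nat, of a] by (simp add: inverse_eq_divide)
qed simp

text \<open>Finitely many strict inequalities survive a small change of \<open>s\<close>, for
  instance rounding it down to multiples of \<open>1 / Suc m\<close>. Multiplying the right-hand
  side by the norm makes the inequality homogeneous, so the denominator can be cleared.\<close>

lemma int_vecs_approx:
  assumes s: "s \<in> unit_sphere d" and J: "finite J"
    and o: "\<And>e. e \<in> J \<Longrightarrow> inner_prod d (x e) s < a e"
  shows "\<exists>z\<in>int_vecs d. \<forall>e\<in>J. inner_prod d (x e) (\<lambda>k. real_of_int (z k)) < a e * sqrt (\<Sum>k<d. (real_of_int (z k))\<^sup>2)"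
proof -
  define w where "w m k = real_of_int \<lfloor>real (Suc m) * s k\<rfloor> / real (Suc m)" for m k
  have w: "(\<lambda>m. w m k) \<longlonglongrightarrow> s k" for k unfolding w_def by (rule floor_scaled_tendsto)
  have ss: "(\<Sum>k<d. (s k)\<^sup>2) = 1" using s by (simp add: unit_sphere_iff)
  have N: "(\<lambda>m. \<Sum>k<d. (w m k)\<^sup>2) \<longlonglongrightarrow> 1"
    unfolding ss[symmetric] by (intro tendsto_intros w)
  have S: "(\<lambda>m. sqrt (\<Sum>k<d. (w m k)\<^sup>2)) \<longlonglongrightarrow> 1" using tendsto_real_sqrt[OF N] by simp
  have "\<forall>\<^sub>F m in sequentially. inner_prod d (x e) (w m) < a e * sqrt (\<Sum>k<d. (w m k)\<^sup>2)" if e: "e \<in> J" for e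
  proof -
    have "(\<lambda>m. a e * sqrt (\<Sum>k<d. (w m k)\<^sup>2) - inner_prod d (x e) (w m)) \<longlonglongrightarrow> a e * 1 - inner_prod d (x e) s"
      unfolding inner_prod_def by (intro tendsto_intros w S)
    hence "\<forall>\<^sub>F m in sequentially. 0 < a e * sqrt (\<Sum>k<d. (w m k)\<^sup>2) - inner_prod d (x e) (w m)"
      by (rule order_tendstoD) (use o[OF e] in simp)
    thus ?thesis by eventually_elim simp
  qed
  hence "\<forall>\<^sub>F m in sequentially. \<forall>e\<in>J. inner_prod d (x e) (w m) < a e * sqrt (\<Sum>k<d. (w m k)\<^sup>2)"
    using J by (simp add: eventually_ball_finite)
  moreover have "\<forall>\<^sub>F m in sequentially. (\<Sum>k<d. (w m k)\<^sup>2) > 0"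
    using N by (rule order_tendstoD) simp
  ultimately have "\<forall>\<^sub>F m in sequentially. (\<forall>e\<in>J. inner_prod d (x e) (w m) < a e * sqrt (\<Sum>k<d. (w m k)\<^sup>2)) \<and> (\<Sum>k<d. (w m k)\<^sup>2) > 0"
    by (rule eventually_conj)
  then obtain m where m: "\<forall>e\<in>J. inner_prod d (x e) (w m) < a e * sqrt (\<Sum>k<d. (w m k)\<^sup>2)" "(\<Sum>k<d. (w m k)\<^sup>2) > 0"
    by (metis (no_types, lifting) eventually_happens' sequentially_bot)
  define z where "z = (\<lambda>k\<in>{..<d}. \<lfloor>real (Suc m) * s k\<rfloor>)"
  have wz: "real_of_int (z k) = real (Suc m) * w m k" if "k < d" for k using that by (simp add: z_def w_def)
  have sq: "(\<Sum>k<d. (real_of_int (z k))\<^sup>2) = (real (Suc m))\<^sup>2 * (\<Sum>k<d. (w m k)\<^sup>2)"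
    unfolding sum_distrib_left by (intro sum.cong) (auto simp: wz power_mult_distrib simp del: of_nat_Suc)
  have rs: "sqrt (\<Sum>k<d. (real_of_int (z k))\<^sup>2) = real (Suc m) * sqrt (\<Sum>k<d. (w m k)\<^sup>2)"
    unfolding sq by (simp add: real_sqrt_mult del: of_nat_Suc)
  have "\<exists>k<d. z k \<noteq> 0"
  proof (rule ccontr)
    assume "\<not> (\<exists>k<d. z k \<noteq> 0)"
    hence "(\<Sum>k<d. (real_of_int (z k))\<^sup>2) = 0" by simp
    thus False using m(2) sq by simp
  qed
  hence zi: "z \<in> int_vecs d" by (auto simp: int_vecs_def z_def)
  have "inner_prod d (x e) (\<lambda>k. real_of_int (z k)) < a e * sqrt (\<Sum>k<d. (real_of_int (z k))\<^sup>2)" if "e \<in> J" for e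
  proof -
    have "inner_prod d (x e) (\<lambda>k. real_of_int (z k)) = inner_prod d (x e) (\<lambda>k. real (Suc m) * w m k)"
      by (rule inner_prod_cong) (rule wz)
    also have "\<dots> = real (Suc m) * inner_prod d (x e) (w m)" by (rule inner_prod_scale)
    also have "\<dots> < real (Suc m) * (a e * sqrt (\<Sum>k<d. (w m k)\<^sup>2))"
      using m(1) that by (intro mult_strict_left_mono) auto
    finally show ?thesis unfolding rs by (simp add: mult_ac)
  qed
  with zi show ?thesis by blast
qed

lemma int_vecs_norm_pos: "z \<in> int_vecs d \<Longrightarrow> 0 < (\<Sum>k<d. (real_of_int (z k))\<^sup>2)"
proof -
  assume "z \<in> int_vecs d"
  then obtain k where "k < d" "z k \<noteq> 0" unfolding int_vecs_def by blast
  thus ?thesis by (intro sum_pos2[of "{..<d}" k]) auto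
qed

lemma exists_sphere_less_iff:
  assumes J: "finite J"
  shows "(\<exists>s\<in>unit_sphere d. \<forall>e\<in>J. inner_prod d (x e) s < t) \<longleftrightarrow>
    (\<exists>z\<in>int_vecs d. \<forall>e\<in>J. inner_prod d (x e) (\<lambda>k. real_of_int (z k)) < t * sqrt (\<Sum>k<d. (real_of_int (z k))\<^sup>2))"
    (is "?L \<longleftrightarrow> ?R")
proof
  assume ?L thus ?R using int_vecs_approx[OF _ J, of _ d x "\<lambda>_. t"] by blast
next
  assume ?R
  then obtain z where z: "z \<in> int_vecs d" "\<And>e. e\<in>J \<Longrightarrow> inner_prod d (x e) (\<lambda>k. real_of_int (z k)) < t * sqrt (\<Sum>k<d. (real_of_int (z k))\<^sup>2)"
    by blast
  let ?z = "\<lambda>k. real_of_int (z k)"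
  note p = int_vecs_norm_pos[OF z(1)]
  note sp = sphere_of_vec[OF p refl]
  have "\<forall>e\<in>J. inner_prod d (x e) (\<lambda>k\<in>{..<d}. ?z k / sqrt (\<Sum>k<d. (?z k)\<^sup>2)) < t"
    unfolding sp(2) using z(2) p by (simp add: divide_less_eq)
  thus ?L using sp(1) by blast
qed

text \<open>Bolzano-Weierstrass, one coordinate after the other by successive subsequences, because
  the dimension is a variable. The limit stays on the sphere since the squared norm passes to the
  limit.\<close>

lemma sphere_seq_compact:
  assumes S: "\<And>m. S m \<in> unit_sphere d"
  shows "\<exists>s\<in>unit_sphere d. \<exists>r. strict_mono (r :: nat \<Rightarrow> nat) \<and> (\<forall>k<d. (\<lambda>m. S (r m) k) \<longlonglongrightarrow> s k)"
proof -
  have b: "\<bar>S m k\<bar> \<le> 1" if "k < d" for m k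
  proof -
    have "(S m k)\<^sup>2 \<le> (\<Sum>k<d. (S m k)\<^sup>2)" using that by (intro member_le_sum) auto
    also have "\<dots> = 1" using S by (simp add: unit_sphere_iff)
    finally show ?thesis by (simp add: abs_square_le_1)
  qed
  have "\<exists>r l. strict_mono (r :: nat \<Rightarrow> nat) \<and> (\<forall>k<j. (\<lambda>m. S (r m) k) \<longlonglongrightarrow> l k)" if "j \<le> d" for j
    using that
  proof (induction j)
    case 0 show ?case by (auto intro!: exI[of _ id] strict_mono_id)
  next
    case (Suc j)
    then obtain r l where r: "strict_mono (r :: nat \<Rightarrow> nat)" "\<And>k. k<j \<Longrightarrow> (\<lambda>m. S (r m) k) \<longlonglongrightarrow> l k" by auto
    have "bounded (range (\<lambda>m. S (r m) j))"
      using b[of j] Suc.prems by (intro boundedI[of _ 1]) auto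
    from bounded_imp_convergent_subsequence[OF this] obtain a q where q: "strict_mono (q :: nat \<Rightarrow> nat)"
      "((\<lambda>m. S (r m) j) \<circ> q) \<longlonglongrightarrow> a" by blast
    have "strict_mono (r \<circ> q)" using r(1) q(1) by (rule strict_mono_o)
    moreover have "(\<lambda>m. S ((r \<circ> q) m) k) \<longlonglongrightarrow> (l(j := a)) k" if "k < Suc j" for k
    proof (cases "k = j")
      case True thus ?thesis using q(2) by (simp add: o_def)
    next
      case False
      hence "k < j" using that by simp
      from LIMSEQ_subseq_LIMSEQ[OF r(2)[OF this] q(1)] show ?thesis using False by (simp add: o_def)
    qed
    ultimately show ?case by blast
  qed
  from this[of d] obtain r l where r: "strict_mono (r :: nat \<Rightarrow> nat)" "\<And>k. k<d \<Longrightarrow> (\<lambda>m. S (r m) k) \<longlonglongrightarrow> l k" by auto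
  define s where "s = restrict l {..<d}"
  have s: "(\<lambda>m. S (r m) k) \<longlonglongrightarrow> s k" if "k < d" for k using r(2)[OF that] that by (simp add: s_def)
  have "(\<lambda>m. \<Sum>k<d. (S (r m) k)\<^sup>2) \<longlonglongrightarrow> (\<Sum>k<d. (s k)\<^sup>2)"
    by (intro tendsto_sum tendsto_power s) auto
  moreover have "(\<lambda>m. \<Sum>k<d. (S (r m) k)\<^sup>2) = (\<lambda>_. 1)" using S by (auto simp: unit_sphere_iff)
  ultimately have "(\<Sum>k<d. (s k)\<^sup>2) = 1" by (simp add: LIMSEQ_const_iff)
  hence "s \<in> unit_sphere d" by (simp add: unit_sphere_iff s_def)
  with r(1) s show ?thesis by blast
qed

text \<open>The non-strict system is solvable iff it is strictly solvable for every slack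
  \<open>1 / Suc m\<close>: a limit point of the solutions with slack solves it exactly.\<close>

lemma exists_sphere_ge_iff:
  assumes J: "finite J"
  shows "(\<exists>s\<in>unit_sphere d. \<forall>e\<in>J. inner_prod d (x e) s \<ge> t) \<longleftrightarrow>
    (\<forall>m. \<exists>z\<in>int_vecs d. \<forall>e\<in>J. inner_prod d (x e) (\<lambda>k. real_of_int (z k)) > (t - 1 / real (Suc m)) * sqrt (\<Sum>k<d. (real_of_int (z k))\<^sup>2))"
    (is "?L \<longleftrightarrow> ?R")
proof
  assume ?L
  then obtain s where s: "s \<in> unit_sphere d" "\<And>e. e \<in> J \<Longrightarrow> inner_prod d (x e) s \<ge> t" by blast
  have neg: "inner_prod d (\<lambda>k. - x e k) y = - inner_prod d (x e) y" for e y
    by (simp add: inner_prod_def sum_negf)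
  show ?R
  proof
    fix m
    have "\<exists>z\<in>int_vecs d. \<forall>e\<in>J. inner_prod d (\<lambda>k. - x e k) (\<lambda>k. real_of_int (z k)) < - (t - 1 / real (Suc m)) * sqrt (\<Sum>k<d. (real_of_int (z k))\<^sup>2)"
    proof (rule int_vecs_approx[OF s(1) J])
      fix e assume "e \<in> J"
      thus "inner_prod d (\<lambda>k. - x e k) s < - (t - 1 / real (Suc m))"
        unfolding neg using s(2)[of e] by (smt (verit) divide_pos_pos of_nat_0_less_iff zero_less_Suc)
    qed
    thus "\<exists>z\<in>int_vecs d. \<forall>e\<in>J. inner_prod d (x e) (\<lambda>k. real_of_int (z k)) > (t - 1 / real (Suc m)) * sqrt (\<Sum>k<d. (real_of_int (z k))\<^sup>2)"
      unfolding neg minus_mult_left[symmetric] neg_less_iff_less .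
  qed
next
  assume R: ?R
  have "\<exists>s\<in>unit_sphere d. \<forall>e\<in>J. inner_prod d (x e) s > t - 1 / real (Suc m)" for m
  proof -
    from R obtain z where z: "z \<in> int_vecs d" "\<And>e. e\<in>J \<Longrightarrow> inner_prod d (x e) (\<lambda>k. real_of_int (z k)) > (t - 1 / real (Suc m)) * sqrt (\<Sum>k<d. (real_of_int (z k))\<^sup>2)"
      by blast
    let ?z = "\<lambda>k. real_of_int (z k)"
    note p = int_vecs_norm_pos[OF z(1)]
    note sp = sphere_of_vec[OF p refl]
    have "\<forall>e\<in>J. inner_prod d (x e) (\<lambda>k\<in>{..<d}. ?z k / sqrt (\<Sum>k<d. (?z k)\<^sup>2)) > t - 1 / real (Suc m)"
      unfolding sp(2) using z(2) p by (simp add: less_divide_eq)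
    thus ?thesis using sp(1) by blast
  qed
  then obtain S where S: "\<And>m. S m \<in> unit_sphere d" "\<And>m e. e \<in> J \<Longrightarrow> inner_prod d (x e) (S m) > t - 1 / real (Suc m)"
    by metis
  from sphere_seq_compact[of S d, OF S(1)] obtain s r where s: "s \<in> unit_sphere d" "strict_mono (r :: nat \<Rightarrow> nat)"
    "\<And>k. k < d \<Longrightarrow> (\<lambda>m. S (r m) k) \<longlonglongrightarrow> s k" by blast
  have "inner_prod d (x e) s \<ge> t" if e: "e \<in> J" for e
  proof (rule LIMSEQ_le)
    show "(\<lambda>m. inner_prod d (x e) (S (r m))) \<longlonglongrightarrow> inner_prod d (x e) s"
      unfolding inner_prod_def by (intro tendsto_intros s) auto
    have "(\<lambda>m. t - 1 / real (Suc m)) \<longlonglongrightarrow> t - 0"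
      using tendsto_diff[OF tendsto_const LIMSEQ_inverse_real_of_nat, of t] by (simp add: inverse_eq_divide)
    from LIMSEQ_subseq_LIMSEQ[OF this s(2)] show "(\<lambda>m. t - 1 / real (Suc (r m))) \<longlonglongrightarrow> t" by (simp add: o_def)
    show "\<exists>N. \<forall>m\<ge>N. t - 1 / real (Suc (r m)) \<le> inner_prod d (x e) (S (r m))"
      using S(2)[OF e] by (auto intro: less_imp_le)
  qed
  thus ?L using s(1) by blast
qed

text \<open>Prescribing the exact edge set would mix strict and non-strict inequalities. Since
  connectivity is monotone, it is enough to prescribe a connected subset of it, which leaves only
  non-strict ones.\<close>

lemma exists_connected_iff:
  assumes n: "n \<ge> 1"
  shows "(\<exists>s\<in>unit_sphere d. graph_connected (Gam n d x s t)) \<longleftrightarrow>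
    (\<exists>E\<in>{E \<in> Pow (pairs n). cut_connected n E}. \<exists>s\<in>unit_sphere d. \<forall>e\<in>E. inner_prod d (x e) s \<ge> t)"
proof -
  have "cut_connected n (edge_set n d x s t)" if "E \<subseteq> pairs n" "cut_connected n E" "\<forall>e\<in>E. inner_prod d (x e) s \<ge> t" for s E
    using that by (intro cut_connected_mono[OF that(2)]) (auto simp: edge_set_def)
  moreover have "edge_set n d x s t \<subseteq> pairs n" "\<forall>e\<in>edge_set n d x s t. inner_prod d (x e) s \<ge> t" for s
    by (auto simp: edge_set_def)
  ultimately show ?thesis unfolding graph_connected_Gam[OF n] by (smt (verit) Pow_iff mem_Collect_eq)
qed

text \<open>Dually, a disconnected superset of the edge set is prescribed, which leaves only strict
  inequalities.\<close>

lemma exists_disconnected_iff: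
  assumes n: "n \<ge> 1"
  shows "(\<exists>s\<in>unit_sphere d. \<not> graph_connected (Gam n d x s t)) \<longleftrightarrow>
    (\<exists>E\<in>{E \<in> Pow (pairs n). \<not> cut_connected n E}. \<exists>s\<in>unit_sphere d. \<forall>e\<in>pairs n - E. inner_prod d (x e) s < t)"
proof -
  have "\<not> cut_connected n (edge_set n d x s t)" if "E \<subseteq> pairs n" "\<not> cut_connected n E" "\<forall>e\<in>pairs n - E. inner_prod d (x e) s < t" for s E
  proof
    assume c: "cut_connected n (edge_set n d x s t)"
    have "edge_set n d x s t \<subseteq> E" using that(3) by (auto simp: edge_set_def not_less[symmetric])
    thus False using cut_connected_mono[OF c] that(2) by blast
  qed
  moreover have "edge_set n d x s t \<subseteq> pairs n" "\<forall>e\<in>pairs n - edge_set n d x s t. inner_prod d (x e) s < t" for s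
    by (auto simp: edge_set_def)
  ultimately show ?thesis unfolding graph_connected_Gam[OF n] by (smt (verit) Pow_iff mem_Collect_eq)
qed

lemma measurable_exists_connected:
  assumes n: "n \<ge> 1" and X: "\<And>e k. e \<in> pairs n \<Longrightarrow> k < d \<Longrightarrow> (\<lambda>\<omega>. X e \<omega> k) \<in> borel_measurable M"
  shows "{\<omega>\<in>space M. \<exists>s\<in>unit_sphere d. graph_connected (Gam n d (\<lambda>e. X e \<omega>) s t)} \<in> sets M"
proof -
  have ip: "(\<lambda>\<omega>. inner_prod d (X e \<omega>) y) \<in> borel_measurable M" if "e \<in> pairs n" for e y
    unfolding inner_prod_def using X[OF that] by (intro borel_measurable_sum borel_measurable_times) auto
  have fin: "finite {E \<in> Pow (pairs n). cut_connected n E}" by simp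
  have "Measurable.pred M (\<lambda>\<omega>. \<exists>E\<in>{E \<in> Pow (pairs n). cut_connected n E}. \<exists>s\<in>unit_sphere d. \<forall>e\<in>E. inner_prod d (X e \<omega>) s \<ge> t)"
  proof (rule pred_intros_finite(4)[OF fin])
    fix E assume "E \<in> {E \<in> Pow (pairs n). cut_connected n E}"
    hence E: "E \<subseteq> pairs n" by simp
    hence fE: "finite E" by (rule finite_subset) simp
    show "Measurable.pred M (\<lambda>\<omega>. \<exists>s\<in>unit_sphere d. \<forall>e\<in>E. inner_prod d (X e \<omega>) s \<ge> t)"
      unfolding exists_sphere_ge_iff[OF fE]
      by (intro pred_intros_countable(1) measurable_pred_countable(2) countable_int_vecs pred_intros_finite(3) fE
          borel_measurable_pred_less borel_measurable_const ip) (use E in auto)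
  qed
  thus ?thesis unfolding exists_connected_iff[OF n] by (simp add: pred_def)
qed

lemma measurable_exists_disconnected:
  assumes n: "n \<ge> 1" and X: "\<And>e k. e \<in> pairs n \<Longrightarrow> k < d \<Longrightarrow> (\<lambda>\<omega>. X e \<omega> k) \<in> borel_measurable M"
  shows "{\<omega>\<in>space M. \<exists>s\<in>unit_sphere d. \<not> graph_connected (Gam n d (\<lambda>e. X e \<omega>) s t)} \<in> sets M"
proof -
  have ip: "(\<lambda>\<omega>. inner_prod d (X e \<omega>) y) \<in> borel_measurable M" if "e \<in> pairs n" for e y
    unfolding inner_prod_def using X[OF that] by (intro borel_measurable_sum borel_measurable_times) auto
  have fin: "finite {E \<in> Pow (pairs n). \<not> cut_connected n E}" by simp
  have "Measurable.pred M (\<lambda>\<omega>. \<exists>E\<in>{E \<in> Pow (pairs n). \<not> cut_connected n E}. \<exists>s\<in>unit_sphere d. \<forall>e\<in>pairs n - E. inner_prod d (X e \<omega>) s < t)"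
  proof (rule pred_intros_finite(4)[OF fin])
    fix E assume "E \<in> {E \<in> Pow (pairs n). \<not> cut_connected n E}"
    have fE: "finite (pairs n - E)" by simp
    show "Measurable.pred M (\<lambda>\<omega>. \<exists>s\<in>unit_sphere d. \<forall>e\<in>pairs n - E. inner_prod d (X e \<omega>) s < t)"
      unfolding exists_sphere_less_iff[OF fE]
      by (intro measurable_pred_countable(2) countable_int_vecs pred_intros_finite(3) fE
          borel_measurable_pred_less borel_measurable_const ip) auto
  qed
  thus ?thesis unfolding exists_disconnected_iff[OF n] by (simp add: pred_def)
qed

section \<open>Gaussian vectors\<close>

definition gtail :: "real \<Rightarrow> real" where
  "gtail \<tau> = measure std_normal_distribution {\<tau>..}"

lemma gtail_nonneg [simp]: "0 \<le> gtail \<tau>"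
  by (simp add: gtail_def)

lemma gtail_le_1 [simp]: "gtail \<tau> \<le> 1"
proof -
  interpret real_distribution std_normal_distribution by (rule real_dist_normal_dist)
  show ?thesis unfolding gtail_def by (rule prob_le_1)
qed

lemma gtail_antimono: "a \<le> b \<Longrightarrow> gtail b \<le> gtail a"
proof -
  interpret real_distribution std_normal_distribution by (rule real_dist_normal_dist)
  show "a \<le> b \<Longrightarrow> gtail b \<le> gtail a" unfolding gtail_def by (intro finite_measure_mono) auto
qed

lemma std_normal_measure:
  assumes "A \<in> sets borel"
  shows "integrable lborel (\<lambda>x. std_normal_density x * indicator A x)"
    and "measure std_normal_distribution A = (\<integral>x. std_normal_density x * indicator A x \<partial>lborel)"
proof -
  show i: "integrable lborel (\<lambda>x. std_normal_density x * indicator A x)"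
    using integrable_mult_indicator[OF _ integrable_normal_density[of 1 0], of A] assms
    by (simp add: mult.commute)
  have "emeasure std_normal_distribution A = (\<integral>\<^sup>+x. ennreal (std_normal_density x) * indicator A x \<partial>lborel)"
    using assms by (intro emeasure_density) auto
  also have "\<dots> = (\<integral>\<^sup>+x. ennreal (std_normal_density x * indicator A x) \<partial>lborel)"
    by (intro nn_integral_cong) (auto split: split_indicator)
  also have "\<dots> = ennreal (\<integral>x. std_normal_density x * indicator A x \<partial>lborel)"
    by (rule nn_integral_eq_integral[OF i]) auto
  finally show "measure std_normal_distribution A = (\<integral>x. std_normal_density x * indicator A x \<partial>lborel)"
    by (simp add: measure_def)
qed

lemma std_normal_null: "measure std_normal_distribution {x} = 0"
proof -
  have "emeasure std_normal_distribution {x} = (\<integral>\<^sup>+y. ennreal (std_normal_density y) * indicator {x} y \<partial>lborel)"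
    by (intro emeasure_density) auto
  also have "\<dots> = 0" by (subst nn_integral_indicator_singleton) auto
  finally show ?thesis by (simp add: measure_def)
qed

lemma gtail_cdf: "gtail \<tau> = 1 - cdf std_normal_distribution \<tau>"
proof -
  interpret real_distribution std_normal_distribution by (rule real_dist_normal_dist)
  have "gtail \<tau> = measure std_normal_distribution ({\<tau>} \<union> {\<tau><..})"
    unfolding gtail_def by (rule arg_cong[where f="measure _"]) auto
  also have "\<dots> = measure std_normal_distribution {\<tau>} + measure std_normal_distribution {\<tau><..}"
    by (rule finite_measure_Union) auto
  also have "\<dots> = measure std_normal_distribution {\<tau><..}" by (simp add: std_normal_null)
  also have "{\<tau><..} = space std_normal_distribution - {..\<tau>}" by auto
  also have "measure std_normal_distribution \<dots> = 1 - cdf std_normal_distribution \<tau>"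
    unfolding cdf_def by (rule prob_compl) simp
  finally show ?thesis .
qed

text \<open>\<open>inv\<close> is merely a choice of a preimage; the value is right because the
  continuous distribution function attains \<open>1 - edge_prob c n\<close> by the intermediate
  value theorem.\<close>

lemma gtail_threshold:
  assumes "0 < edge_prob c n" "edge_prob c n < 1"
  shows "gtail (threshold c n) = edge_prob c n"
proof -
  interpret real_distribution std_normal_distribution by (rule real_dist_normal_dist)
  let ?F = "cdf std_normal_distribution" and ?y = "1 - edge_prob c n"
  have "\<forall>\<^sub>F x in at_bot. ?F x < ?y" using assms by (intro order_tendstoD(2)[OF cdf_lim_at_bot]) auto
  then obtain a where a: "?F a < ?y" by (metis eventually_happens' trivial_limit_at_bot_linorder)
  have "\<forall>\<^sub>F x in at_top. ?F x > ?y" using assms by (intro order_tendstoD(1)[OF cdf_lim_at_top_prob]) auto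
  then obtain b where b: "?F b > ?y" by (metis eventually_happens' trivial_limit_at_top_linorder)
  have ab: "a \<le> b" using a b cdf_nondecreasing[of b a] by (metis dual_order.strict_trans leI less_le_not_le)
  have "\<exists>x. a \<le> x \<and> x \<le> b \<and> ?F x = ?y"
    using a b ab by (intro IVT') (auto intro!: continuous_at_imp_continuous_on simp: isCont_cdf std_normal_null)
  hence "?y \<in> range ?F" by (metis rangeI)
  hence "?F (threshold c n) = ?y" unfolding threshold_def by (rule f_inv_into_f)
  thus ?thesis by (simp add: gtail_cdf)
qed

text \<open>For \<open>x \<ge> \<tau> \<ge> 0\<close> one has
  \<open>x\<^sup>2 \<ge> \<tau>\<^sup>2 + (x - \<tau>)\<^sup>2\<close>, so the density is below
  \<open>exp (- \<tau>\<^sup>2 / 2)\<close> times the normal density centred at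
  \<open>\<tau>\<close>.\<close>

lemma gtail_le_exp:
  assumes "0 \<le> \<tau>" shows "gtail \<tau> \<le> exp (- \<tau>\<^sup>2 / 2)"
proof -
  have "gtail \<tau> = (\<integral>x. std_normal_density x * indicator {\<tau>..} x \<partial>lborel)"
    unfolding gtail_def by (rule std_normal_measure) simp
  also have "\<dots> \<le> (\<integral>x. exp (- \<tau>\<^sup>2 / 2) * normal_density \<tau> 1 x \<partial>lborel)"
  proof (rule integral_mono)
    show "integrable lborel (\<lambda>x. std_normal_density x * indicator {\<tau>..} x)" by (rule std_normal_measure) simp
    show "integrable lborel (\<lambda>x. exp (- \<tau>\<^sup>2 / 2) * normal_density \<tau> 1 x)" by simp
    fix x
    have "exp (- x\<^sup>2 / 2) \<le> exp (- \<tau>\<^sup>2 / 2) * exp (- (x - \<tau>)\<^sup>2 / 2)" if "x \<ge> \<tau>"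
    proof -
      have "0 \<le> \<tau> * (x - \<tau>)" using that assms by simp
      hence "- x\<^sup>2 / 2 \<le> - \<tau>\<^sup>2 / 2 + - (x - \<tau>)\<^sup>2 / 2" by (simp add: power2_eq_square algebra_simps)
      thus ?thesis by (simp add: exp_add[symmetric])
    qed
    thus "std_normal_density x * indicator {\<tau>..} x \<le> exp (- \<tau>\<^sup>2 / 2) * normal_density \<tau> 1 x"
      by (auto simp: normal_density_def divide_right_mono split: split_indicator)
  qed
  also have "\<dots> = exp (- \<tau>\<^sup>2 / 2)" by simp
  finally show ?thesis .
qed

lemma std_normal_density_antimono: "0 \<le> a \<Longrightarrow> a \<le> b \<Longrightarrow> std_normal_density b \<le> std_normal_density a"
  by (simp add: std_normal_density_def divide_right_mono power_mono)

lemma integrable_indicator_Ico: "integrable lborel (indicator {a..<b::real} :: real \<Rightarrow> real)"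
  by (cases "a \<le> b") (auto simp: integrable_real_indicator)

lemma gtail_diff:
  assumes "a \<le> b"
  shows "gtail a - gtail b = (\<integral>x. std_normal_density x * indicator {a..<b} x \<partial>lborel)"
proof -
  interpret real_distribution std_normal_distribution by (rule real_dist_normal_dist)
  have "{a..} = {a..<b} \<union> {b..}" "{a..<b} \<inter> {b..} = {}" using assms by auto
  hence "gtail a = measure std_normal_distribution {a..<b} + gtail b"
    unfolding gtail_def by (metis finite_measure_Union atLeastLessThan_borel atLeast_borel sets_density sets_lborel)
  thus ?thesis using std_normal_measure(2)[of "{a..<b}"] by simp
qed

lemma gtail_diff_le_density:
  assumes "0 \<le> a" "a \<le> b"
  shows "gtail a - gtail b \<le> (b - a) * std_normal_density a"
proof -
  have "gtail a - gtail b \<le> (\<integral>x. std_normal_density a * indicator {a..<b} x \<partial>lborel)"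
    unfolding gtail_diff[OF assms(2)]
    by (intro integral_mono std_normal_measure integrable_mult_right integrable_indicator_Ico)
       (use assms std_normal_density_antimono[of a] in \<open>auto split: split_indicator\<close>)
  also have "\<dots> = (b - a) * std_normal_density a" using assms by simp
  finally show ?thesis .
qed

lemma std_normal_density_le_1: "std_normal_density x \<le> 1"
proof -
  have "1 \<le> sqrt (2 * pi)" using pi_gt3 by (simp add: real_le_rsqrt)
  have "exp (- x\<^sup>2 / 2) \<le> 1" by simp
  also have "1 \<le> sqrt (2 * pi)" by fact
  finally show ?thesis by (simp add: std_normal_density_def divide_le_eq_1)
qed

lemma gtail_diff_le:
  assumes "a \<le> b"
  shows "gtail a - gtail b \<le> b - a"
proof -
  have "gtail a - gtail b \<le> (\<integral>x. 1 * indicator {a..<b} x \<partial>lborel)"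
    unfolding gtail_diff[OF assms]
    by (intro integral_mono std_normal_measure integrable_mult_right integrable_indicator_Ico)
       (use std_normal_density_le_1 in \<open>auto split: split_indicator\<close>)
  also have "\<dots> = b - a" using assms by simp
  finally show ?thesis .
qed

text \<open>A Mills-type lower bound, obtained from the interval \<open>[t, t + 1/t]\<close> alone.\<close>

lemma std_normal_density_le_gtail:
  assumes "1 \<le> t"
  shows "std_normal_density t \<le> exp (3/2) * t * gtail t"
proof -
  let ?b = "t + 1 / t"
  have tb: "t \<le> ?b" using assms by simp
  have "(\<integral>x. std_normal_density ?b * indicator {t..<?b} x \<partial>lborel) \<le> gtail t - gtail ?b"
    unfolding gtail_diff[OF tb]
    by (intro integral_mono std_normal_measure integrable_mult_right integrable_indicator_Ico)
       (use assms std_normal_density_antimono in \<open>auto split: split_indicator\<close>)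
  hence "std_normal_density ?b * (1 / t) \<le> gtail t - gtail ?b" using assms by simp
  hence "std_normal_density ?b * (1 / t) \<le> gtail t" using gtail_nonneg[of ?b] by linarith
  hence 1: "std_normal_density ?b \<le> t * gtail t" using assms by (simp add: field_simps)
  \<comment> \<open>Over the interval the square grows by at most 3, which is the origin of the
    factor \<open>exp (3/2)\<close>.\<close>
  have "?b\<^sup>2 = t\<^sup>2 + 2 + 1 / t\<^sup>2" using assms by (simp add: power2_eq_square field_simps)
  also have "\<dots> \<le> t\<^sup>2 + 3" using assms by simp
  finally have "- t\<^sup>2 / 2 \<le> 3 / 2 + - ?b\<^sup>2 / 2" by simp
  hence "exp (- t\<^sup>2 / 2) \<le> exp (3/2) * exp (- ?b\<^sup>2 / 2)" by (simp add: exp_add[symmetric])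
  hence "std_normal_density t \<le> exp (3/2) * std_normal_density ?b"
    by (simp add: std_normal_density_def divide_right_mono)
  also have "\<dots> \<le> exp (3/2) * (t * gtail t)" using 1 by simp
  finally show ?thesis by (simp add: mult.assoc)
qed

lemma (in prob_space) prob_std_normal_ge:
  assumes "distributed M lborel Y std_normal_density"
  shows "prob {\<omega>\<in>space M. Y \<omega> \<ge> \<tau>} = gtail \<tau>"
proof -
  have m: "Y \<in> borel_measurable M" using distributed_measurable[OF assms] by simp
  have "gtail \<tau> = measure (distr M lborel Y) {\<tau>..}"
    unfolding gtail_def using distributed_distr_eq_density[OF assms] by simp
  also have "\<dots> = prob (Y -` {\<tau>..} \<inter> space M)" using m by (intro measure_distr) auto
  also have "Y -` {\<tau>..} \<inter> space M = {\<omega>\<in>space M. Y \<omega> \<ge> \<tau>}" by auto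
  finally show ?thesis ..
qed

lemma (in prob_space) prob_std_normal_less:
  assumes "distributed M lborel Y std_normal_density"
  shows "prob {\<omega>\<in>space M. Y \<omega> < \<tau>} = 1 - gtail \<tau>"
proof -
  have m: "Y \<in> borel_measurable M" using distributed_measurable[OF assms] by simp
  have "{\<omega>\<in>space M. Y \<omega> < \<tau>} = space M - {\<omega>\<in>space M. Y \<omega> \<ge> \<tau>}" by auto
  thus ?thesis using prob_std_normal_ge[OF assms, of \<tau>] m by (simp add: prob_compl)
qed

lemma (in prob_space) prob_std_normal_abs_ge:
  assumes "distributed M lborel Y std_normal_density" "0 \<le> \<tau>"
  shows "prob {\<omega>\<in>space M. \<bar>Y \<omega>\<bar> \<ge> \<tau>} \<le> 2 * exp (- \<tau>\<^sup>2 / 2)"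
proof -
  have [measurable]: "Y \<in> borel_measurable M" using distributed_measurable[OF assms(1)] by simp
  have D: "distributed M lborel (\<lambda>x. 0 + (-1) * Y x) (normal_density (0 + (-1) * 0) (\<bar>-1\<bar> * 1))"
    by (rule normal_density_affine[OF assms(1)]) auto
  have "{\<omega>\<in>space M. \<bar>Y \<omega>\<bar> \<ge> \<tau>} = {\<omega>\<in>space M. Y \<omega> \<ge> \<tau>} \<union> {\<omega>\<in>space M. - Y \<omega> \<ge> \<tau>}" by auto
  hence "prob {\<omega>\<in>space M. \<bar>Y \<omega>\<bar> \<ge> \<tau>} \<le> prob {\<omega>\<in>space M. Y \<omega> \<ge> \<tau>} + prob {\<omega>\<in>space M. - Y \<omega> \<ge> \<tau>}"
    by (simp add: measure_Un_le)
  also have "\<dots> = 2 * gtail \<tau>"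
    using prob_std_normal_ge[OF assms(1)] prob_std_normal_ge[of "\<lambda>x. - Y x"] D by simp
  finally show ?thesis using gtail_le_exp[OF assms(2)] by simp
qed

text \<open>The integrand is a multiple of the centred normal density with variance
  \<open>1 / (1 - 2 * a)\<close>, and the multiple is its standard deviation.\<close>

lemma nn_integral_exp_square_normal:
  fixes a :: real assumes a: "a < 1 / 2"
  shows "(\<integral>\<^sup>+x. ennreal (exp (a * x\<^sup>2)) * ennreal (std_normal_density x) \<partial>lborel) = ennreal (1 / sqrt (1 - 2 * a))"
proof -
  let ?\<sigma> = "1 / sqrt (1 - 2 * a)"
  have s2: "?\<sigma>\<^sup>2 = 1 / (1 - 2 * a)" using a by (simp add: power_divide)
  have "exp (a * x\<^sup>2) * std_normal_density x = ?\<sigma> * normal_density 0 ?\<sigma> x" for x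
  proof -
    have "a * x\<^sup>2 + - x\<^sup>2 / 2 = - (x - 0)\<^sup>2 / (2 * ?\<sigma>\<^sup>2)" unfolding s2 using a by (simp add: field_simps)
    hence "exp (a * x\<^sup>2) * exp (- x\<^sup>2 / 2) = exp (- (x - 0)\<^sup>2 / (2 * ?\<sigma>\<^sup>2))" by (simp only: exp_add[symmetric])
    moreover have "sqrt (2 * pi * ?\<sigma>\<^sup>2) = sqrt (2 * pi) * ?\<sigma>" unfolding s2 using a by (simp add: real_sqrt_divide real_sqrt_mult)
    ultimately show ?thesis using a unfolding normal_density_def std_normal_density_def
      by (simp add: field_simps)
  qed
  hence "(\<integral>\<^sup>+x. ennreal (exp (a * x\<^sup>2)) * ennreal (std_normal_density x) \<partial>lborel)
    = (\<integral>\<^sup>+x. ennreal ?\<sigma> * ennreal (normal_density 0 ?\<sigma> x) \<partial>lborel)"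
    using a by (intro nn_integral_cong) (simp add: ennreal_mult'[symmetric])
  also have "\<dots> = ennreal ?\<sigma> * (\<integral>\<^sup>+x. ennreal (normal_density 0 ?\<sigma> x) \<partial>lborel)"
    by (rule nn_integral_cmult) simp
  also have "(\<integral>\<^sup>+x. ennreal (normal_density 0 ?\<sigma> x) \<partial>lborel) = 1"
    using a by (subst nn_integral_eq_integral) auto
  finally show ?thesis by simp
qed

lemma (in prob_space) nn_expectation_exp_square:
  assumes D: "distributed M lborel Y std_normal_density" and a: "a < 1 / 2"
  shows "(\<integral>\<^sup>+\<omega>. ennreal (exp (a * (Y \<omega>)\<^sup>2)) \<partial>M) = ennreal (1 / sqrt (1 - 2 * a))"
proof -
  have "(\<integral>\<^sup>+\<omega>. ennreal (exp (a * (Y \<omega>)\<^sup>2)) \<partial>M)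
    = (\<integral>\<^sup>+x. ennreal (std_normal_density x) * ennreal (exp (a * x\<^sup>2)) \<partial>lborel)"
    by (subst distributed_nn_integral[OF D, symmetric]) auto
  also have "\<dots> = ennreal (1 / sqrt (1 - 2 * a))"
    using nn_integral_exp_square_normal[OF a] by (simp add: mult.commute)
  finally show ?thesis .
qed

text \<open>The model supplies independent vectors with product laws. The computations below
  separate single coordinates, so independence is recorded for all scalars jointly;
  \<open>gauss_arrayI\<close> makes the link.\<close>

locale gauss_array = prob_space M for M :: "'w measure" +
  fixes n d :: nat and X :: "nat \<times> nat \<Rightarrow> 'w \<Rightarrow> nat \<Rightarrow> real"
  assumes indep: "indep_vars (\<lambda>_. borel) (\<lambda>i \<omega>. X (fst i) \<omega> (snd i)) (pairs n \<times> {..<d})"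
    and normal: "\<And>e k. e \<in> pairs n \<Longrightarrow> k < d \<Longrightarrow> distributed M lborel (\<lambda>\<omega>. X e \<omega> k) std_normal_density"
begin

lemma measurable_X [measurable]: "e \<in> pairs n \<Longrightarrow> k < d \<Longrightarrow> (\<lambda>\<omega>. X e \<omega> k) \<in> borel_measurable M"
  using distributed_measurable[OF normal] by simp

lemma measurable_inner: "e \<in> pairs n \<Longrightarrow> (\<lambda>\<omega>. inner_prod d (X e \<omega>) u) \<in> borel_measurable M"
  unfolding inner_prod_def by (intro borel_measurable_sum borel_measurable_times measurable_X) auto

lemma indep_coords: "e \<in> pairs n \<Longrightarrow> indep_vars (\<lambda>_. borel) (\<lambda>k \<omega>. X e \<omega> k) {..<d}"
proof -
  assume e: "e \<in> pairs n"
  have "indep_vars (\<lambda>k. PiM {(e, k)} (\<lambda>_. borel)) (\<lambda>k \<omega>. \<lambda>i\<in>{(e, k)}. X (fst i) \<omega> (snd i)) {..<d}"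
    using e by (intro indep_vars_restrict[OF indep]) (auto simp: disjoint_family_on_def)
  from indep_vars_compose2[OF this, of "\<lambda>k x. x (e, k)" "\<lambda>_. borel"] show ?thesis by simp
qed

lemma inner_normal:
  assumes e: "e \<in> pairs n" and u: "(\<Sum>k<d. (u k)\<^sup>2) > 0"
  shows "distributed M lborel (\<lambda>\<omega>. inner_prod d (X e \<omega>) u) (normal_density 0 (sqrt (\<Sum>k<d. (u k)\<^sup>2)))"
proof -
  \<comment> \<open>Zero weights are dropped first, because the rule for sums of independent normals
    wants positive standard deviations.\<close>
  let ?K = "{k\<in>{..<d}. u k \<noteq> 0}"
  have ne: "?K \<noteq> {}"
  proof
    assume "?K = {}"
    hence "(\<Sum>k<d. (u k)\<^sup>2) = 0" by (intro sum.neutral) auto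
    thus False using u by simp
  qed
  have "distributed M lborel (\<lambda>\<omega>. \<Sum>k\<in>?K. u k * X e \<omega> k) (normal_density (\<Sum>k\<in>?K. 0) (sqrt (\<Sum>k\<in>?K. \<bar>u k\<bar>\<^sup>2)))"
  proof (rule sum_indep_normal)
    have "indep_vars (\<lambda>_. borel) (\<lambda>k \<omega>. X e \<omega> k) ?K" by (rule indep_vars_subset[OF indep_coords[OF e]]) auto
    thus "indep_vars (\<lambda>_. borel) (\<lambda>k \<omega>. u k * X e \<omega> k) ?K"
      by (rule indep_vars_compose2) auto
    fix k assume k: "k \<in> ?K"
    show "0 < \<bar>u k\<bar>" using k by simp
    have "distributed M lborel (\<lambda>\<omega>. 0 + u k * X e \<omega> k) (normal_density (0 + u k * 0) (\<bar>u k\<bar> * 1))"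
      using k e by (intro normal_density_affine normal) auto
    thus "distributed M lborel (\<lambda>\<omega>. u k * X e \<omega> k) (normal_density 0 \<bar>u k\<bar>)" by simp
  qed (use ne in auto)
  moreover have "(\<Sum>k\<in>?K. u k * X e \<omega> k) = inner_prod d (X e \<omega>) u" for \<omega>
    unfolding inner_prod_def by (rule sum.mono_neutral_cong_left) auto
  moreover have "(\<Sum>k\<in>?K. \<bar>u k\<bar>\<^sup>2) = (\<Sum>k<d. (u k)\<^sup>2)"
    by (rule sum.mono_neutral_cong_left) auto
  ultimately show ?thesis by simp
qed

lemma inner_std_normal:
  assumes e: "e \<in> pairs n" and u: "(\<Sum>k<d. (u k)\<^sup>2) = 1"
  shows "distributed M lborel (\<lambda>\<omega>. inner_prod d (X e \<omega>) u) std_normal_density"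
  using inner_normal[OF e, of u] u by simp

lemma indep_rows: "indep_vars (\<lambda>e. PiM ({e} \<times> {..<d}) (\<lambda>_. borel)) (\<lambda>e \<omega>. \<lambda>i\<in>{e} \<times> {..<d}. X (fst i) \<omega> (snd i)) (pairs n)"
  by (rule indep_vars_restrict[OF indep]) (auto simp: disjoint_family_on_def)

text \<open>The second moment compares two directions at once, and at two different vertices it uses
  a direction that varies with the edge. A single fixed direction is the projection of this
  case.\<close>

lemma indep_inner2:
  "indep_vars (\<lambda>_. borel \<Otimes>\<^sub>M borel) (\<lambda>e \<omega>. (inner_prod d (X e \<omega>) (u e), inner_prod d (X e \<omega>) (v e))) (pairs n)"
proof -
  have "indep_vars (\<lambda>_. borel \<Otimes>\<^sub>M borel) (\<lambda>e \<omega>. (\<lambda>x. (inner_prod d (\<lambda>k. x (e, k)) (u e), inner_prod d (\<lambda>k. x (e, k)) (v e)))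
      (\<lambda>i\<in>{e} \<times> {..<d}. X (fst i) \<omega> (snd i))) (pairs n)"
  proof (rule indep_vars_compose2[OF indep_rows])
    fix e :: "nat \<times> nat"
    have "(\<lambda>x. inner_prod d (\<lambda>k. x (e, k)) w) \<in> borel_measurable (PiM ({e} \<times> {..<d}) (\<lambda>_. borel))" for w
      unfolding inner_prod_def
      by (intro borel_measurable_sum borel_measurable_times borel_measurable_const measurable_component_singleton) auto
    thus "(\<lambda>x. (inner_prod d (\<lambda>k. x (e, k)) (u e), inner_prod d (\<lambda>k. x (e, k)) (v e))) \<in> PiM ({e} \<times> {..<d}) (\<lambda>_. borel) \<rightarrow>\<^sub>M borel \<Otimes>\<^sub>M borel"
      by (intro measurable_Pair)
  qed
  also have "(\<lambda>e \<omega>. (\<lambda>x. (inner_prod d (\<lambda>k. x (e, k)) (u e), inner_prod d (\<lambda>k. x (e, k)) (v e)))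
      (\<lambda>i\<in>{e} \<times> {..<d}. X (fst i) \<omega> (snd i))) = (\<lambda>e \<omega>. (inner_prod d (X e \<omega>) (u e), inner_prod d (X e \<omega>) (v e)))"
    by (auto simp: fun_eq_iff inner_prod_def)
  finally show ?thesis .
qed

lemma indep_inner:
  "indep_vars (\<lambda>_. borel) (\<lambda>e \<omega>. inner_prod d (X e \<omega>) u) (pairs n)"
  using indep_vars_compose2[OF indep_inner2[of "\<lambda>_. u" "\<lambda>_. u"], of "\<lambda>_. fst" "\<lambda>_. borel"] by simp

lemma norm_square_mgf:
  assumes e: "e \<in> pairs n" and a: "a < 1 / 2" and K: "K \<subseteq> {..<d}"
  shows "(\<integral>\<^sup>+\<omega>. ennreal (exp (a * (\<Sum>k\<in>K. (X e \<omega> k)\<^sup>2))) \<partial>M) = ennreal ((1 / sqrt (1 - 2 * a)) ^ card K)"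
proof -
  have fK: "finite K" using K finite_subset by blast
  have "(\<integral>\<^sup>+\<omega>. ennreal (exp (a * (\<Sum>k\<in>K. (X e \<omega> k)\<^sup>2))) \<partial>M) = (\<integral>\<^sup>+\<omega>. (\<Prod>k\<in>K. ennreal (exp (a * (X e \<omega> k)\<^sup>2))) \<partial>M)"
    by (intro nn_integral_cong) (simp add: sum_distrib_left exp_sum fK prod_ennreal)
  also have "\<dots> = (\<Prod>k\<in>K. \<integral>\<^sup>+\<omega>. ennreal (exp (a * (X e \<omega> k)\<^sup>2)) \<partial>M)"
  proof (rule indep_vars_nn_integral)
    show "indep_vars (\<lambda>_. borel) (\<lambda>k \<omega>. ennreal (exp (a * (X e \<omega> k)\<^sup>2))) K"
      by (rule indep_vars_compose2[OF indep_vars_subset[OF indep_coords[OF e] K], of "\<lambda>_ x. ennreal (exp (a * x\<^sup>2))"]) measurable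
  qed (auto simp: fK)
  also have "\<dots> = (\<Prod>k\<in>K. ennreal (1 / sqrt (1 - 2 * a)))"
    using K e a by (intro prod.cong nn_expectation_exp_square normal) auto
  also have "\<dots> = ennreal ((1 / sqrt (1 - 2 * a)) ^ card K)"
    using a by (simp add: ennreal_power)
  finally show ?thesis .
qed

text \<open>Chernoff's bound for a chi-square variable with \<open>card K\<close> degrees of
  freedom. A positive \<open>a\<close> bounds the upper tail, a negative \<open>a\<close> the lower
  one.\<close>

lemma norm_square_tail:
  assumes e: "e \<in> pairs n" and a: "a < 1 / 2" and K: "K \<subseteq> {..<d}"
  shows "prob {\<omega>\<in>space M. a * (\<Sum>k\<in>K. (X e \<omega> k)\<^sup>2) \<ge> b} \<le> exp (- b) * (1 / sqrt (1 - 2 * a)) ^ card K"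
proof -
  let ?f = "\<lambda>\<omega>. a * (\<Sum>k\<in>K. (X e \<omega> k)\<^sup>2)"
  have [measurable]: "?f \<in> borel_measurable M"
    using e K by (intro borel_measurable_times borel_measurable_const borel_measurable_sum borel_measurable_power measurable_X) auto
  have "emeasure M {\<omega>\<in>space M. ?f \<omega> \<ge> b} = (\<integral>\<^sup>+\<omega>. indicator {\<omega>\<in>space M. ?f \<omega> \<ge> b} \<omega> \<partial>M)"
    by (rule nn_integral_indicator[symmetric]) measurable
  also have "\<dots> \<le> (\<integral>\<^sup>+\<omega>. ennreal (exp (- b)) * ennreal (exp (?f \<omega>)) \<partial>M)"
  proof (rule nn_integral_mono)
    fix \<omega>
    have "1 \<le> exp (- b) * exp (?f \<omega>)" if "?f \<omega> \<ge> b" using that by (simp add: exp_add[symmetric])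
    hence "ennreal 1 \<le> ennreal (exp (- b) * exp (?f \<omega>))" if "?f \<omega> \<ge> b" using that by (intro ennreal_leI)
    thus "indicator {\<omega>\<in>space M. ?f \<omega> \<ge> b} \<omega> \<le> ennreal (exp (- b)) * ennreal (exp (?f \<omega>))"
      by (auto split: split_indicator simp: ennreal_mult')
  qed
  also have "\<dots> = ennreal (exp (- b)) * ennreal ((1 / sqrt (1 - 2 * a)) ^ card K)"
    by (subst nn_integral_cmult) (use norm_square_mgf[OF assms] in auto)
  also have "\<dots> = ennreal (exp (- b) * (1 / sqrt (1 - 2 * a)) ^ card K)"
    using a by (simp add: ennreal_mult')
  finally show ?thesis using a by (simp add: emeasure_eq_measure)
qed

end

text \<open>The probability of a product event factors first over the edges, by independence of the
  vectors, and then over the coordinates, because the law of each vector is a product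
  measure.\<close>

lemma gauss_arrayI:
  assumes M: "prob_space M"
    and ind: "prob_space.indep_vars M (\<lambda>_. Rd d) X (pairs n)"
    and nrm: "\<And>e. e \<in> pairs n \<Longrightarrow> std_normal_vector M d (X e)"
  shows "gauss_array M n d X"
proof -
  interpret prob_space M by fact
  interpret SN: prob_space std_normal_distribution
    using real_dist_normal_dist by (simp add: real_distribution_def)
  have rv: "X e \<in> M \<rightarrow>\<^sub>M PiM {..<d} (\<lambda>_. borel)" if "e \<in> pairs n" for e
    using nrm[OF that] by (simp add: std_normal_vector_def Rd_def)
  have di: "distr M (PiM {..<d} (\<lambda>_. borel)) (X e) = PiM {..<d} (\<lambda>_. std_normal_distribution)" if "e \<in> pairs n" for e
    using nrm[OF that] by (simp add: std_normal_vector_def Rd_def)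
  have rvk: "(\<lambda>\<omega>. X e \<omega> k) \<in> borel_measurable M" if "e \<in> pairs n" "k < d" for e k
    using measurable_compose[OF rv[OF that(1)] measurable_component_singleton[of k "{..<d}" "\<lambda>_. borel"]] that by simp
  have coord: "distributed M lborel (\<lambda>\<omega>. X e \<omega> k) std_normal_density" if e: "e \<in> pairs n" and k: "k < d" for e k
  proof -
    have "distr M lborel (\<lambda>\<omega>. X e \<omega> k) = distr M borel (\<lambda>\<omega>. X e \<omega> k)"
      by (rule distr_cong) auto
    also have "\<dots> = distr (distr M (PiM {..<d} (\<lambda>_. borel)) (X e)) borel (\<lambda>x. x k)"
      using rv[OF e] k by (subst distr_distr) (auto simp: o_def)
    also have "\<dots> = distr (PiM {..<d} (\<lambda>_. std_normal_distribution)) std_normal_distribution (\<lambda>x. x k)"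
      unfolding di[OF e] by (rule distr_cong) auto
    also have "\<dots> = std_normal_distribution"
      by (rule distr_PiM_component) (use k in \<open>auto intro: SN.prob_space_axioms\<close>)
    finally show ?thesis using rvk[OF e k] by (simp add: distributed_def)
  qed
  interpret P: product_prob_space "\<lambda>_::nat. std_normal_distribution" "{..<d}"
    by unfold_locales
  have box: "prob (X e -` PiE {..<d} A \<inter> space M) = (\<Prod>k<d. measure std_normal_distribution (A k))"
    if e: "e \<in> pairs n" and A: "\<And>k. k < d \<Longrightarrow> A k \<in> sets borel" for e A
  proof -
    have AA: "PiE {..<d} A \<in> sets (PiM {..<d} (\<lambda>_. borel))" using A by (intro sets_PiM_I_finite) auto
    have "prob (X e -` PiE {..<d} A \<inter> space M) = measure (distr M (PiM {..<d} (\<lambda>_. borel)) (X e)) (PiE {..<d} A)"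
      using rv[OF e] AA by (rule measure_distr[symmetric])
    also have "\<dots> = (\<Prod>k<d. measure std_normal_distribution (A k))"
      unfolding di[OF e] using A by (subst P.measure_PiM_emb[of "{..<d}" A, symmetric])
        (auto simp: prod_emb_PiE_same_index)
    finally show ?thesis .
  qed
  have pk: "prob ((\<lambda>\<omega>. X e \<omega> k) -` A \<inter> space M) = measure std_normal_distribution A"
    if "e \<in> pairs n" "k < d" "A \<in> sets borel" for e k A
  proof -
    have "measure std_normal_distribution A = measure (distr M lborel (\<lambda>\<omega>. X e \<omega> k)) A"
      using distributed_distr_eq_density[OF coord[OF that(1,2)]] by simp
    also have "\<dots> = prob ((\<lambda>\<omega>. X e \<omega> k) -` A \<inter> space M)"
      using rvk that by (intro measure_distr) auto
    finally show ?thesis ..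
  qed
  let ?I = "pairs n \<times> {..<d}"
  have "indep_vars (\<lambda>_. borel) (\<lambda>i \<omega>. X (fst i) \<omega> (snd i)) ?I"
  proof (cases "?I = {}")
    case True
    thus ?thesis by (simp only: indep_vars_def indep_sets_def) auto
  next
    case False
    hence pn: "pairs n \<noteq> {}" and d: "d > 0" by auto
    show ?thesis
    proof (subst indep_vars_finite[where E = "\<lambda>_. sets borel"])
      show "\<forall>A\<in>(\<Pi> i\<in>?I. sets borel). prob (\<Inter>i\<in>?I. (\<lambda>\<omega>. X (fst i) \<omega> (snd i)) -` A i \<inter> space M)
        = (\<Prod>i\<in>?I. prob ((\<lambda>\<omega>. X (fst i) \<omega> (snd i)) -` A i \<inter> space M))"
      proof
        fix A assume A: "A \<in> (\<Pi> i\<in>?I. sets (borel :: real measure))"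
        have "(\<Inter>i\<in>?I. (\<lambda>\<omega>. X (fst i) \<omega> (snd i)) -` A i \<inter> space M)
          = (\<Inter>e\<in>pairs n. X e -` PiE {..<d} (\<lambda>k. A (e, k)) \<inter> space M)"
        proof -
          have "X e \<omega> \<in> extensional {..<d}" if "e \<in> pairs n" "\<omega> \<in> space M" for e \<omega>
            using measurable_space[OF rv[OF that(1)] that(2)] by (auto simp: space_PiM PiE_iff)
          hence eq: "(\<forall>k<d. X e \<omega> k \<in> A (e, k)) \<longleftrightarrow> X e \<omega> \<in> PiE {..<d} (\<lambda>k. A (e, k))"
            if "e \<in> pairs n" "\<omega> \<in> space M" for e \<omega> using that by (simp add: PiE_iff Ball_def)
          hence "(\<Inter>k<d. (\<lambda>\<omega>. X e \<omega> k) -` A (e, k) \<inter> space M) = X e -` PiE {..<d} (\<lambda>k. A (e, k)) \<inter> space M"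
            if e: "e \<in> pairs n" for e
          proof (intro set_eqI iffI)
            fix \<omega> assume "\<omega> \<in> (\<Inter>k<d. (\<lambda>\<omega>. X e \<omega> k) -` A (e, k) \<inter> space M)"
            hence "\<forall>k\<in>{..<d}. X e \<omega> k \<in> A (e, k) \<and> \<omega> \<in> space M" by blast
            hence "\<forall>k<d. X e \<omega> k \<in> A (e, k)" "\<omega> \<in> space M" using d by auto
            thus "\<omega> \<in> X e -` PiE {..<d} (\<lambda>k. A (e, k)) \<inter> space M" using eq[OF e] by blast
          next
            fix \<omega> assume "\<omega> \<in> X e -` PiE {..<d} (\<lambda>k. A (e, k)) \<inter> space M"
            thus "\<omega> \<in> (\<Inter>k<d. (\<lambda>\<omega>. X e \<omega> k) -` A (e, k) \<inter> space M)" by (auto dest: PiE_mem)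
          qed
          hence "(\<Inter>e\<in>pairs n. X e -` PiE {..<d} (\<lambda>k. A (e, k)) \<inter> space M)
            = (\<Inter>e\<in>pairs n. \<Inter>k<d. (\<lambda>\<omega>. X e \<omega> k) -` A (e, k) \<inter> space M)" by simp
          also have "\<dots> = (\<Inter>i\<in>?I. (\<lambda>\<omega>. X (fst i) \<omega> (snd i)) -` A i \<inter> space M)" by auto
          finally show ?thesis ..
        qed
        also have "prob \<dots> = (\<Prod>e\<in>pairs n. prob (X e -` PiE {..<d} (\<lambda>k. A (e, k)) \<inter> space M))"
          using A by (intro indep_varsD_finite[OF ind pn]) (auto simp: Rd_def intro!: sets_PiM_I_finite)
        also have "\<dots> = (\<Prod>e\<in>pairs n. \<Prod>k<d. measure std_normal_distribution (A (e, k)))"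
          using A by (intro prod.cong box) auto
        also have "\<dots> = (\<Prod>i\<in>?I. measure std_normal_distribution (A i))"
          by (simp add: prod.cartesian_product)
        also have "\<dots> = (\<Prod>i\<in>?I. prob ((\<lambda>\<omega>. X (fst i) \<omega> (snd i)) -` A i \<inter> space M))"
          using A by (intro prod.cong refl pk[symmetric]) auto
        finally show "prob (\<Inter>i\<in>?I. (\<lambda>\<omega>. X (fst i) \<omega> (snd i)) -` A i \<inter> space M)
          = (\<Prod>i\<in>?I. prob ((\<lambda>\<omega>. X (fst i) \<omega> (snd i)) -` A i \<inter> space M))" .
      qed
    next
      fix i assume "i \<in> ?I"
      show "sets (borel :: real measure) = sigma_sets (space borel) (sets borel)"
        by (rule sets.sigma_sets_eq[symmetric])
      show "Int_stable (sets (borel :: real measure))" by (auto simp: Int_stable_def)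
    qed (use False rvk in auto)
  qed
  thus ?thesis using coord by unfold_locales auto
qed

section \<open>Nets and random graphs\<close>

lemma inner_prod_add: "inner_prod d x (\<lambda>k. s k + s' k) = inner_prod d x s + inner_prod d x s'"
  by (simp add: inner_prod_def distrib_left sum.distrib)

lemma inner_prod_diff: "inner_prod d x (\<lambda>k. s k - s' k) = inner_prod d x s - inner_prod d x s'"
  by (simp add: inner_prod_def right_diff_distrib sum_subtractf)

lemma inner_prod_le: "\<bar>inner_prod d x y\<bar> \<le> L2_set x {..<d} * L2_set y {..<d}"
proof -
  have "\<bar>inner_prod d x y\<bar> \<le> (\<Sum>k<d. \<bar>x k\<bar> * \<bar>y k\<bar>)"
    unfolding inner_prod_def by (rule order_trans[OF sum_abs]) (simp add: abs_mult)
  thus ?thesis using L2_set_mult_ineq[of x y "{..<d}"] by linarith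
qed

text \<open>Scaled by \<open>r / sqrt d\<close>, these are the lattice points in the unit ball. The
  lattice has mesh \<open>r / sqrt d\<close>, so rounding all coordinates of a vector moves it by at
  most \<open>r\<close>.\<close>

definition net :: "nat \<Rightarrow> real \<Rightarrow> (nat \<Rightarrow> int) set" where
  "net d r = {z \<in> PiE {..<d} (\<lambda>_. UNIV). (\<Sum>k<d. (real_of_int (z k))\<^sup>2) \<le> real d / r\<^sup>2}"

lemma sum_int_interval_le:
  fixes f :: "nat \<Rightarrow> real"
  assumes "\<And>j. 0 \<le> f j"
  shows "(\<Sum>z\<in>{- int b..int b}. f (nat \<bar>z\<bar>)) \<le> 2 * (\<Sum>j\<le>b. f j)"
proof -
  let ?A = "int ` {..b}" and ?B = "(\<lambda>j. - int j) ` {..b}"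
  have sub: "{- int b..int b} \<subseteq> ?A \<union> ?B"
  proof
    fix z assume z: "z \<in> {- int b..int b}"
    show "z \<in> ?A \<union> ?B"
    proof (cases "0 \<le> z")
      case True
      hence "z = int (nat z)" "nat z \<in> {..b}" using z by auto
      thus ?thesis by blast
    next
      case False
      hence "z = - int (nat (- z))" "nat (- z) \<in> {..b}" using z by auto
      thus ?thesis by blast
    qed
  qed
  have "(\<Sum>z\<in>{- int b..int b}. f (nat \<bar>z\<bar>)) \<le> (\<Sum>z\<in>?A \<union> ?B. f (nat \<bar>z\<bar>))"
    using assms by (intro sum_mono2 sub) auto
  also have "\<dots> \<le> (\<Sum>z\<in>?A. f (nat \<bar>z\<bar>)) + (\<Sum>z\<in>?B. f (nat \<bar>z\<bar>))"
  proof -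
    have "(\<Sum>z\<in>?A \<union> ?B. f (nat \<bar>z\<bar>)) + (\<Sum>z\<in>?A \<inter> ?B. f (nat \<bar>z\<bar>)) = (\<Sum>z\<in>?A. f (nat \<bar>z\<bar>)) + (\<Sum>z\<in>?B. f (nat \<bar>z\<bar>))"
      by (rule sum.union_inter) auto
    moreover have "(\<Sum>z\<in>?A \<inter> ?B. f (nat \<bar>z\<bar>)) \<ge> 0" by (intro sum_nonneg assms)
    ultimately show ?thesis by linarith
  qed
  also have "\<dots> = 2 * (\<Sum>j\<le>b. f j)"
    by (simp add: sum.reindex inj_on_def)
  finally show ?thesis .
qed

text \<open>Completing the square gives
  \<open>a * z\<^sup>2 \<ge> sqrt a * \<bar>z\<bar> - 1/4\<close>, which compares the Gaussian
  weights with a geometric series. The bound is uniform in \<open>b\<close>.\<close>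

lemma theta_sum_le:
  assumes lam: "0 < a"
  shows "(\<Sum>z\<in>{- int b..int b}. exp (- a * (real_of_int z)\<^sup>2)) \<le> 2 * exp (1/4) * (1 + 1 / sqrt a)"
proof -
  define x where "x = sqrt a"
  have x: "0 < x" "x\<^sup>2 = a" using lam by (auto simp: x_def)
  let ?q = "exp (- x)"
  have q: "0 < ?q" "?q < 1" using x by auto
  have t: "exp (- a * (real_of_int z)\<^sup>2) \<le> exp (1/4) * ?q ^ nat \<bar>z\<bar>" for z
  proof -
    have "0 \<le> (x * \<bar>real_of_int z\<bar> - 1/2)\<^sup>2" by simp
    hence "- a * (real_of_int z)\<^sup>2 \<le> 1/4 + real (nat \<bar>z\<bar>) * (- x)"
      using x by (simp add: power2_eq_square algebra_simps abs_mult_self_eq flip: x(2))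
    hence "exp (- a * (real_of_int z)\<^sup>2) \<le> exp (1/4 + real (nat \<bar>z\<bar>) * (- x))" by simp
    also have "\<dots> = exp (1/4) * ?q ^ nat \<bar>z\<bar>" by (simp only: exp_add exp_of_nat_mult)
    finally show ?thesis .
  qed
  have "(\<Sum>z\<in>{- int b..int b}. exp (- a * (real_of_int z)\<^sup>2)) \<le> (\<Sum>z\<in>{- int b..int b}. exp (1/4) * ?q ^ nat \<bar>z\<bar>)"
    by (intro sum_mono t)
  also have "\<dots> \<le> 2 * (\<Sum>j\<le>b. exp (1/4) * ?q ^ j)"
    by (rule sum_int_interval_le[of "\<lambda>j. exp (1/4) * ?q ^ j"]) auto
  also have "\<dots> = 2 * exp (1/4) * (\<Sum>j<Suc b. ?q ^ j)" by (simp add: sum_distrib_left lessThan_Suc_atMost mult.assoc)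
  also have "\<dots> = 2 * exp (1/4) * ((1 - ?q ^ Suc b) / (1 - ?q))"
    using q by (subst sum_gp_strict) auto
  also have "\<dots> \<le> 2 * exp (1/4) * (1 / (1 - ?q))"
    using q by (intro mult_left_mono divide_right_mono) auto
  also have "1 / (1 - ?q) \<le> 1 + 1 / x"
  proof -
    have "1 + x \<le> exp x" by (rule exp_ge_add_one_self)
    hence "?q \<le> 1 / (1 + x)" using x by (simp add: exp_minus field_simps)
    hence "1 - ?q \<ge> x / (1 + x)" using x by (simp add: field_simps)
    hence "1 / (1 - ?q) \<le> 1 / (x / (1 + x))" using x by (intro divide_left_mono) auto
    also have "\<dots> = 1 + 1 / x" using x by (simp add: field_simps)
    finally show ?thesis .
  qed
  finally show ?thesis unfolding x_def by simp
qed

text \<open>Counting with the weights \<open>exp (- r\<^sup>2 z\<^sup>2 / 2)\<close> gives \<open>(C / r)\<^sup>d\<close>; a cube containing the ball would cost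
  an additional factor of about \<open>d powr (d / 2)\<close>, which is too much in the thresholds of order \<open>ln n / ln (ln n)\<close>.\<close>

lemma card_net:
  assumes d: "d \<ge> 1" and r: "0 < r" "r \<le> 1"
  shows "finite (net d r)" "real (card (net d r)) \<le> (11 / r) ^ d"
proof -
  define D where "D = real d / r\<^sup>2"
  \<comment> \<open>Any box that contains the net will do: it makes the sum finite, and the bound
    for the sum does not depend on its size.\<close>
  define b where "b = nat \<lceil>D\<rceil>"
  let ?P = "PiE {..<d} (\<lambda>_. {- int b..int b})"
  have fP: "finite ?P" by (intro finite_PiE) auto
  have sub: "net d r \<subseteq> ?P"
  proof
    fix z assume z: "z \<in> net d r"
    have "\<bar>z k\<bar> \<le> int b" if k: "k < d" for k
    proof -
      have "\<bar>z k\<bar> \<le> (z k)\<^sup>2"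
      proof (cases "z k = 0")
        case False
        hence "\<bar>z k\<bar> * 1 \<le> \<bar>z k\<bar> * \<bar>z k\<bar>" by (intro mult_left_mono) auto
        thus ?thesis by (simp add: power2_eq_square)
      qed simp
      hence "real_of_int \<bar>z k\<bar> \<le> (real_of_int (z k))\<^sup>2" by (metis of_int_le_iff of_int_power)
      also have "\<dots> \<le> (\<Sum>k<d. (real_of_int (z k))\<^sup>2)" using k by (intro member_le_sum) auto
      also have "\<dots> \<le> D" using z by (simp add: net_def D_def)
      finally show ?thesis unfolding b_def by linarith
    qed
    hence "z k \<in> {- int b..int b}" if "k < d" for k using that by (auto simp: abs_le_iff minus_le_iff)
    thus "z \<in> ?P" using z by (auto simp: net_def PiE_iff)
  qed
  show fin: "finite (net d r)" by (rule finite_subset[OF sub fP])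
  define l where "l = r\<^sup>2 / 2"
  \<comment> \<open>As \<open>l * D = d / 2\<close>, every net point has weight at least
    \<open>exp (- d / 2)\<close>, a loss of \<open>exp (1/2)\<close> per coordinate.\<close>
  have l: "0 < l" "l * D = real d / 2" using r by (auto simp: l_def D_def)
  have "real (card (net d r)) = (\<Sum>z\<in>net d r. 1)" by simp
  also have "\<dots> \<le> (\<Sum>z\<in>net d r. exp (l * D) * (\<Prod>k<d. exp (- l * (real_of_int (z k))\<^sup>2)))"
  proof (rule sum_mono)
    fix z assume "z \<in> net d r"
    hence "(\<Sum>k<d. (real_of_int (z k))\<^sup>2) \<le> D" by (simp add: net_def D_def)
    hence "0 \<le> l * (D - (\<Sum>k<d. (real_of_int (z k))\<^sup>2))" using l by simp
    hence "1 \<le> exp (l * D + (\<Sum>k<d. - l * (real_of_int (z k))\<^sup>2))"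
      by (simp add: algebra_simps sum_negf flip: sum_distrib_left)
    thus "1 \<le> exp (l * D) * (\<Prod>k<d. exp (- l * (real_of_int (z k))\<^sup>2))" by (simp add: exp_add exp_sum)
  qed
  also have "\<dots> \<le> (\<Sum>z\<in>?P. exp (l * D) * (\<Prod>k<d. exp (- l * (real_of_int (z k))\<^sup>2)))"
    by (intro sum_mono2 fP sub) (simp add: prod_nonneg)
  also have "\<dots> = exp (l * D) * (\<Prod>k<d. \<Sum>z\<in>{- int b..int b}. exp (- l * (real_of_int z)\<^sup>2))"
    unfolding sum_distrib_left[symmetric] by (subst prod_sum_PiE) auto
  also have "\<dots> \<le> exp (l * D) * (\<Prod>k<d. 2 * exp (1/4) * (1 + 1 / sqrt l))"
    by (intro mult_left_mono prod_mono conjI theta_sum_le l sum_nonneg) auto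
  also have "\<dots> = (exp (1/2) * (2 * exp (1/4) * (1 + 1 / sqrt l))) ^ d"
    unfolding l(2) by (simp add: power_mult_distrib exp_of_nat_mult[symmetric])
  also have "\<dots> \<le> (11 / r) ^ d"
  proof (rule power_mono)
    have s: "sqrt l = r / sqrt 2" using r by (simp add: l_def real_sqrt_divide)
    have s2: "sqrt 2 \<le> (1.42::real)" by (rule real_le_lsqrt) (auto simp: power2_eq_square)
    have "1 + 1 / sqrt l = 1 + sqrt 2 / r" using r by (simp add: s)
    also have "\<dots> \<le> 1 / r + 1.42 / r" using r s2 by (intro add_mono divide_right_mono) auto
    also have "\<dots> = 2.42 / r" by (simp add: add_divide_distrib[symmetric])
    finally have a: "1 + 1 / sqrt l \<le> 2.42 / r" .
    have "exp (3/4) ^ 4 = (exp 1 :: real) ^ 3" by (simp add: exp_of_nat_mult[symmetric])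
    also have "\<dots> \<le> 2.72 ^ 3" using e_less_272 by (intro power_mono) auto
    also have "\<dots> \<le> (2.2::real) ^ 4" by (simp add: power_divide)
    finally have e: "exp (3/4) \<le> (2.2::real)" by (rule power_le_imp_le_base[of _ 3, simplified]) auto
    have "exp (1/2) * (2 * exp (1/4) * (1 + 1 / sqrt l)) = 2 * exp (3/4) * (1 + 1 / sqrt l)"
      by (simp add: exp_add[symmetric] mult_ac)
    also have "\<dots> \<le> 2 * 2.2 * (2.42 / r)" using a e l by (intro mult_mono) auto
    also have "\<dots> = (2 * 2.2 * 2.42) / r" by simp
    also have "\<dots> \<le> 11 / r" using r by (intro divide_right_mono) auto
    finally show "exp (1/2) * (2 * exp (1/4) * (1 + 1 / sqrt l)) \<le> 11 / r" .
    show "0 \<le> exp (1/2) * (2 * exp (1/4) * (1 + 1 / sqrt l))" using l by simp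
  qed
  finally show "real (card (net d r)) \<le> (11 / r) ^ d" .
qed

text \<open>These functions need not be extensional, so they are unit vectors without having to lie
  in \<open>unit_sphere d\<close>; they are only paired with other vectors through
  \<open>inner_prod\<close>.\<close>

definition net_dirs :: "nat \<Rightarrow> real \<Rightarrow> (nat \<Rightarrow> real) set" where
  "net_dirs d r = (\<lambda>z k. real_of_int (z k) / L2_set (\<lambda>k. real_of_int (z k)) {..<d}) ` {z \<in> net d r. L2_set (\<lambda>k. real_of_int (z k)) {..<d} > 0}"

lemma card_net_dirs:
  assumes d: "d \<ge> 1" and r: "0 < r" "r \<le> 1"
  shows "finite (net_dirs d r)" "real (card (net_dirs d r)) \<le> (11 / r) ^ d"
proof -
  note c = card_net[OF assms]
  show "finite (net_dirs d r)" unfolding net_dirs_def using c(1) by simp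
  have "card (net_dirs d r) \<le> card {z \<in> net d r. L2_set (\<lambda>k. real_of_int (z k)) {..<d} > 0}"
    unfolding net_dirs_def by (rule card_image_le) (use c(1) in simp)
  also have "\<dots> \<le> card (net d r)" using c(1) by (intro card_mono) auto
  finally show "real (card (net_dirs d r)) \<le> (11 / r) ^ d" using c(2) by simp
qed

lemma net_dirs_unit:
  assumes "u \<in> net_dirs d r" shows "(\<Sum>k<d. (u k)\<^sup>2) = 1"
proof -
  from assms obtain z where z: "L2_set (\<lambda>k. real_of_int (z k)) {..<d} > 0"
    "u = (\<lambda>k. real_of_int (z k) / L2_set (\<lambda>k. real_of_int (z k)) {..<d})" by (auto simp: net_dirs_def)
  let ?N = "L2_set (\<lambda>k. real_of_int (z k)) {..<d}"
  have "?N\<^sup>2 = (\<Sum>k<d. (real_of_int (z k))\<^sup>2)" by (simp add: L2_set_def sum_nonneg)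
  moreover have "?N\<^sup>2 \<noteq> 0" using z(1) by simp
  ultimately show ?thesis by (simp add: z(2) power_divide flip: sum_divide_distrib)
qed

text \<open>Rounding towards zero keeps the rounded vector inside the unit ball; this puts it in the
  net and gives \<open>a \<le> 1\<close> for its norm \<open>a\<close>. Comparing \<open>s\<close>
  with \<open>a * u\<close>, the rounded vector itself, avoids an additional error from normalising
  it.\<close>

lemma net_dirs_approx:
  assumes d: "d \<ge> 1" and r: "0 < r" "r < 1" and s: "s \<in> unit_sphere d"
  shows "\<exists>u\<in>net_dirs d r. \<exists>a. 1 - r \<le> a \<and> a \<le> 1 \<and>
           (\<forall>x. \<bar>inner_prod d x s - a * inner_prod d x u\<bar> \<le> L2_set x {..<d} * r)"
proof -
  define h where "h = r / sqrt (real d)"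
  have h: "h > 0" using r d by (simp add: h_def)
  have h2: "h\<^sup>2 = r\<^sup>2 / real d" by (simp add: h_def power_divide)
  define z where "z = (\<lambda>k\<in>{..<d}. if s k \<ge> 0 then \<lfloor>s k / h\<rfloor> else \<lceil>s k / h\<rceil>)"
  define w where "w k = h * real_of_int (z k)" for k
  have wk: "\<bar>w k\<bar> \<le> \<bar>s k\<bar> \<and> \<bar>s k - w k\<bar> \<le> h" if k: "k < d" for k
  proof -
    have "\<bar>real_of_int (z k)\<bar> \<le> \<bar>s k / h\<bar> \<and> \<bar>s k / h - real_of_int (z k)\<bar> \<le> 1"
    proof (cases "s k \<ge> 0")
      case True
      hence "s k / h \<ge> 0" using h by simp
      moreover have "z k = \<lfloor>s k / h\<rfloor>" using k True by (simp add: z_def)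
      moreover have "0 \<le> real_of_int \<lfloor>s k / h\<rfloor>" "real_of_int \<lfloor>s k / h\<rfloor> \<le> s k / h" "s k / h \<le> real_of_int \<lfloor>s k / h\<rfloor> + 1"
        using \<open>s k / h \<ge> 0\<close> by (simp, linarith+)
      ultimately show ?thesis by (intro conjI; linarith)
    next
      case False
      hence "s k / h \<le> 0" using h by (simp add: divide_nonpos_pos)
      moreover have "z k = \<lceil>s k / h\<rceil>" using k False by (simp add: z_def)
      moreover have "real_of_int \<lceil>s k / h\<rceil> \<le> 0" "s k / h \<le> real_of_int \<lceil>s k / h\<rceil>" "real_of_int \<lceil>s k / h\<rceil> \<le> s k / h + 1"
        using \<open>s k / h \<le> 0\<close> by (simp, linarith+)
      ultimately show ?thesis by (intro conjI; linarith)
    qed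
    hence "h * \<bar>real_of_int (z k)\<bar> \<le> h * \<bar>s k / h\<bar> \<and> h * \<bar>s k / h - real_of_int (z k)\<bar> \<le> h * 1"
      using h by (intro conjI mult_left_mono) auto
    moreover have "h * \<bar>real_of_int (z k)\<bar> = \<bar>w k\<bar>" using h by (simp add: w_def abs_mult)
    moreover have "h * \<bar>s k / h\<bar> = \<bar>s k\<bar>" using h by (simp add: abs_divide)
    moreover have "h * \<bar>s k / h - real_of_int (z k)\<bar> = \<bar>s k - w k\<bar>"
    proof -
      have "h * \<bar>s k / h - real_of_int (z k)\<bar> = \<bar>h * (s k / h - real_of_int (z k))\<bar>" using h by (simp add: abs_mult)
      thus ?thesis using h by (simp add: right_diff_distrib w_def)
    qed
    ultimately show ?thesis by simp
  qed
  let ?L = "\<lambda>f. L2_set f {..<d}"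
  have Ls: "?L s = 1" using s by (simp add: unit_sphere_def)
  have Lw: "?L w \<le> 1"
  proof -
    have "?L w \<le> ?L (\<lambda>k. \<bar>s k\<bar>)" unfolding L2_set_def
      using wk by (intro real_sqrt_le_mono sum_mono) (simp add: abs_le_square_iff)
    also have "\<dots> = ?L s" by (simp add: L2_set_def)
    finally show ?thesis using Ls by simp
  qed
  have Ld: "?L (\<lambda>k. s k - w k) \<le> r"
  proof -
    have "(\<Sum>k<d. (s k - w k)\<^sup>2) \<le> (\<Sum>k<d. h\<^sup>2)"
      using wk h by (intro sum_mono) (metis abs_le_square_iff abs_of_pos lessThan_iff)
    also have "\<dots> = r\<^sup>2" using d by (simp add: h2)
    finally show ?thesis unfolding L2_set_def using r by (intro real_le_lsqrt) (auto intro: sum_nonneg)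
  qed
  have "?L s \<le> ?L w + ?L (\<lambda>k. s k - w k)"
    using L2_set_triangle_ineq[of w "\<lambda>k. s k - w k" "{..<d}"] by simp
  hence Lw2: "1 - r \<le> ?L w" using Ls Ld by linarith
  let ?N = "?L (\<lambda>k. real_of_int (z k))"
  have wN: "?L w = h * ?N"
    using L2_set_right_distrib[of h "\<lambda>k. real_of_int (z k)" "{..<d}"] h by (simp add: w_def[abs_def])
  have N: "?N > 0" using wN Lw2 r h by (metis diff_gt_0_iff_gt less_le_trans zero_less_mult_pos)
  have "z \<in> net d r"
  proof -
    have "(h * ?N)\<^sup>2 \<le> 1" using Lw wN N h by (intro power_le_one) auto
    hence "r\<^sup>2 / real d * (\<Sum>k<d. (real_of_int (z k))\<^sup>2) \<le> 1"
      by (simp add: power_mult_distrib h2 L2_set_def sum_nonneg)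
    thus ?thesis unfolding net_def using r d by (auto simp: z_def field_simps)
  qed
  define u where "u k = real_of_int (z k) / ?N" for k
  have u: "u \<in> net_dirs d r" unfolding net_dirs_def u_def[abs_def] using N \<open>z \<in> net d r\<close> by blast
  have "\<bar>inner_prod d x s - ?L w * inner_prod d x u\<bar> \<le> ?L x * r" for x
  proof -
    have "?L w * inner_prod d x u = inner_prod d x w"
      unfolding inner_prod_scale[symmetric] using N by (intro inner_prod_cong) (simp add: u_def wN w_def)
    hence "\<bar>inner_prod d x s - ?L w * inner_prod d x u\<bar> = \<bar>inner_prod d x (\<lambda>k. s k - w k)\<bar>"
      by (simp add: inner_prod_diff)
    also have "\<dots> \<le> ?L x * ?L (\<lambda>k. s k - w k)" by (rule inner_prod_le)
    also have "\<dots> \<le> ?L x * r" using Ld by (intro mult_left_mono) auto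
    finally show ?thesis .
  qed
  with u Lw Lw2 show ?thesis by blast
qed

section \<open>The binomial random graph: empty cuts and isolated vertices\<close>

lemma card_cut_set:
  assumes S: "S \<subseteq> {1..n}"
  shows "card (cut_set n S) = card S * (n - card S)"
proof -
  let ?f = "\<lambda>(i, j). if i < j then (i, j) else (j, i :: nat)"
  have fS: "finite S" using S finite_subset by blast
  have "bij_betw ?f (S \<times> ({1..n} - S)) (cut_set n S)"
  proof (rule bij_betw_imageI)
    show "inj_on ?f (S \<times> ({1..n} - S))" by (auto simp: inj_on_def split: if_splits)
    show "?f ` (S \<times> ({1..n} - S)) = cut_set n S"
    proof
      show "?f ` (S \<times> ({1..n} - S)) \<subseteq> cut_set n S"
      proof (rule image_subsetI)
        fix e assume "e \<in> S \<times> ({1..n} - S)"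
        then obtain i j where e: "e = (i, j)" "i \<in> S" "j \<in> {1..n}" "j \<notin> S" by auto
        moreover from this have "i \<noteq> j" "i \<in> {1..n}" using S by auto
        ultimately show "?f e \<in> cut_set n S" by (auto simp: cut_set_def pairs_def)
      qed
      show "cut_set n S \<subseteq> ?f ` (S \<times> ({1..n} - S))"
      proof safe
        fix i j assume "(i, j) \<in> cut_set n S"
        hence ij: "1 \<le> i" "i < j" "j \<le> n" "(i \<in> S) \<noteq> (j \<in> S)" by (auto simp: cut_set_def pairs_def)
        show "(i, j) \<in> ?f ` (S \<times> ({1..n} - S))"
        proof (cases "i \<in> S")
          case True thus ?thesis using ij by (intro image_eqI[of _ _ "(i, j)"]) auto
        next
          case False thus ?thesis using ij by (intro image_eqI[of _ _ "(j, i)"]) auto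
        qed
      qed
    qed
  qed
  hence "card (cut_set n S) = card (S \<times> ({1..n} - S))" by (simp add: bij_betw_same_card)
  also have "\<dots> = card S * (n - card S)" using S fS by (simp add: card_cartesian_product card_Diff_subset)
  finally show ?thesis .
qed

text \<open>The binomial random graph with edge probability \<open>q\<close>. It is abstracted from
  the Gaussian vectors to serve every single direction, including the first axis.\<close>

locale random_graph = prob_space M for M :: "'w measure" +
  fixes n :: nat and q :: real and A :: "nat \<times> nat \<Rightarrow> 'w \<Rightarrow> bool"
  assumes indep_A: "indep_vars (\<lambda>_. count_space UNIV) A (pairs n)"
    and prob_A: "\<And>e. e \<in> pairs n \<Longrightarrow> prob {\<omega>\<in>space M. A e \<omega>} = q"
begin

definition edges :: "'w \<Rightarrow> (nat \<times> nat) set" where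
  "edges \<omega> = {e \<in> pairs n. A e \<omega>}"

lemma measurable_A [measurable]: "e \<in> pairs n \<Longrightarrow> A e \<in> measurable M (count_space UNIV)"
  using indep_A by (auto simp: indep_vars_def)

lemma measurable_no_edges [measurable]:
  assumes "J \<subseteq> pairs n" shows "{\<omega>\<in>space M. \<forall>e\<in>J. \<not> A e \<omega>} \<in> events"
proof -
  have fin: "finite J" using assms by (rule finite_subset) simp
  have "Measurable.pred M (\<lambda>\<omega>. \<forall>e\<in>J. \<not> A e \<omega>)"
    using fin assms by (intro pred_intros_finite pred_intros_logic) (auto intro: measurable_A)
  thus ?thesis by (simp add: pred_def)
qed

lemma prob_no_edges:
  assumes J: "J \<subseteq> pairs n"
  shows "prob {\<omega>\<in>space M. \<forall>e\<in>J. \<not> A e \<omega>} = (1 - q) ^ card J"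
proof (cases "J = {}")
  case True thus ?thesis by (simp add: prob_space)
next
  case False
  have fJ: "finite J" using J by (rule finite_subset) simp
  have "{\<omega>\<in>space M. \<forall>e\<in>J. \<not> A e \<omega>} = (\<Inter>e\<in>J. A e -` {False} \<inter> space M)" using False by auto
  also have "prob \<dots> = (\<Prod>e\<in>J. prob (A e -` {False} \<inter> space M))"
    by (rule indep_varsD[OF indep_A False fJ J]) auto
  also have "\<dots> = (\<Prod>e\<in>J. 1 - q)"
  proof (rule prod.cong)
    fix e assume "e \<in> J"
    hence e: "e \<in> pairs n" using J by auto
    have "A e -` {False} \<inter> space M = space M - {\<omega>\<in>space M. A e \<omega>}" by auto
    moreover have "{\<omega>\<in>space M. A e \<omega>} \<in> events" using measurable_A[OF e] by (simp add: pred_def)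
    ultimately show "prob (A e -` {False} \<inter> space M) = 1 - q" using prob_A[OF e] by (simp add: prob_compl)
  qed simp
  finally show ?thesis by simp
qed

lemma prob_empty_cut:
  assumes F: "\<S> \<subseteq> Pow {1..n}"
  shows "prob {\<omega>\<in>space M. \<exists>S\<in>\<S>. edges \<omega> \<inter> cut_set n S = {}} \<le> (\<Sum>S\<in>\<S>. (1 - q) ^ (card S * (n - card S)))"
    "{\<omega>\<in>space M. \<exists>S\<in>\<S>. edges \<omega> \<inter> cut_set n S = {}} \<in> events"
proof -
  have fin: "finite \<S>" using F by (rule finite_subset) simp
  let ?E = "\<lambda>S. {\<omega>\<in>space M. \<forall>e\<in>cut_set n S. \<not> A e \<omega>}"
  have E: "?E S \<in> events" for S by (rule measurable_no_edges[OF cut_set_subset])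
  have eq: "{\<omega>\<in>space M. \<exists>S\<in>\<S>. edges \<omega> \<inter> cut_set n S = {}} = (\<Union>S\<in>\<S>. ?E S)"
    using cut_set_subset unfolding edges_def by blast
  show "{\<omega>\<in>space M. \<exists>S\<in>\<S>. edges \<omega> \<inter> cut_set n S = {}} \<in> events"
    unfolding eq using E by (intro sets.finite_UN fin)
  have "prob (\<Union>S\<in>\<S>. ?E S) \<le> (\<Sum>S\<in>\<S>. prob (?E S))"
    using E by (intro finite_measure_subadditive_finite fin) auto
  also have "\<dots> = (\<Sum>S\<in>\<S>. (1 - q) ^ (card S * (n - card S)))"
    using F by (intro sum.cong refl) (subst prob_no_edges[OF cut_set_subset], simp add: card_cut_set subset_iff)
  finally show "prob {\<omega>\<in>space M. \<exists>S\<in>\<S>. edges \<omega> \<inter> cut_set n S = {}} \<le> (\<Sum>S\<in>\<S>. (1 - q) ^ (card S * (n - card S)))"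
    unfolding eq .
qed

text \<open>Exponential Markov inequality for independent scores: \<open>Y i\<close> is nonzero with
  probability \<open>x\<close>, namely when all of \<open>Out i\<close> is absent, and then it is
  most likely \<open>1\<close>, because \<open>Bk i\<close> contains few expected edges. Hence
  \<open>exp (- Y i)\<close> has mean at most \<open>1 - x / 2\<close>, and disjoint blocks make the
  means multiply.\<close>

lemma isolated_exp_moment:
  fixes Out Bk :: "nat \<Rightarrow> (nat \<times> nat) set"
  assumes sub: "\<And>i. i \<in> L \<Longrightarrow> Out i \<subseteq> pairs n" "\<And>i. i \<in> L \<Longrightarrow> Bk i \<subseteq> pairs n"
    and disj: "\<And>i. i \<in> L \<Longrightarrow> Out i \<inter> Bk i = {}"
    and disj': "\<And>i j. i \<in> L \<Longrightarrow> j \<in> L \<Longrightarrow> i \<noteq> j \<Longrightarrow> (Out i \<union> Bk i) \<inter> (Out j \<union> Bk j) = {}"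
    and L: "finite L" and x: "\<And>i. i \<in> L \<Longrightarrow> (1 - q) ^ card (Out i) = x"
    and y: "\<And>i. i \<in> L \<Longrightarrow> real (card (Bk i)) * q \<le> 1 / 20" and q: "0 \<le> q" "q \<le> 1"
  defines "Y \<equiv> (\<lambda>i \<omega>. if \<forall>e\<in>Out i. \<not> A e \<omega> then (if \<forall>e\<in>Bk i. \<not> A e \<omega> then 1 else - 1) else 0 :: real)"
  shows "{\<omega>\<in>space M. (\<Sum>i\<in>L. Y i \<omega>) \<le> 0} \<in> events"
    "prob {\<omega>\<in>space M. (\<Sum>i\<in>L. Y i \<omega>) \<le> 0} \<le> (1 - x / 2) ^ card L"
proof -
  let ?K = "\<lambda>i. Out i \<union> Bk i"
  have fin: "finite (Out i)" "finite (Bk i)" if "i \<in> L" for i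
    using sub[OF that] by (auto intro: finite_subset[of _ "pairs n"])
  have x01: "0 \<le> x" "x \<le> 1" if "i \<in> L" for i using x[OF that] q by (auto simp: power_le_one)
  define g where "g i z = exp (- (if \<forall>e\<in>Out i. \<not> z e then (if \<forall>e\<in>Bk i. \<not> z e then 1 else - 1) else 0 :: real))" for i z
  have gm: "g i \<in> borel_measurable (PiM (?K i) (\<lambda>_. count_space UNIV))" if i: "i \<in> L" for i
  proof -
    have c: "(\<lambda>z. z e) \<in> measurable (PiM (?K i) (\<lambda>_. count_space UNIV)) (count_space (UNIV :: bool set))" if "e \<in> ?K i" for e
      using that by (rule measurable_component_singleton)
    have "Measurable.pred (PiM (?K i) (\<lambda>_. count_space UNIV)) (\<lambda>z. \<forall>e\<in>Out i. \<not> z e)"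
      "Measurable.pred (PiM (?K i) (\<lambda>_. count_space UNIV)) (\<lambda>z. \<forall>e\<in>Bk i. \<not> z e)"
      using fin[OF i] c by (auto intro!: pred_intros_finite pred_intros_logic)
    thus ?thesis unfolding g_def by measurable
  qed
  have ind: "indep_vars (\<lambda>_. borel) (\<lambda>i \<omega>. exp (- Y i \<omega>)) L"
  proof -
    have "indep_vars (\<lambda>i. PiM (?K i) (\<lambda>_. count_space UNIV)) (\<lambda>i \<omega>. \<lambda>e\<in>?K i. A e \<omega>) L"
      using sub disj' by (intro indep_vars_restrict[OF indep_A]) (auto simp: disjoint_family_on_def)
    hence "indep_vars (\<lambda>_. borel) (\<lambda>i \<omega>. g i (\<lambda>e\<in>?K i. A e \<omega>)) L"
      by (rule indep_vars_compose2) (rule gm)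
    also have "(\<lambda>i \<omega>. g i (\<lambda>e\<in>?K i. A e \<omega>)) = (\<lambda>i \<omega>. exp (- Y i \<omega>))"
      unfolding g_def Y_def by (intro ext) simp
    finally show ?thesis .
  qed
  have Em: "(\<lambda>\<omega>. exp (- Y i \<omega>)) \<in> borel_measurable M" if "i \<in> L" for i
    using ind that by (auto simp: indep_vars_def)
  have bd: "norm (exp (- Y i \<omega>)) \<le> exp 1" for i \<omega>
    by (simp only: real_norm_def abs_exp_cancel exp_le_cancel_iff) (simp add: Y_def)
  have int: "integrable M (\<lambda>\<omega>. exp (- Y i \<omega>))" if "i \<in> L" for i
    by (rule integrable_const_bound[OF _ Em[OF that]]) (rule AE_I2, rule bd)
  have ex: "expectation (\<lambda>\<omega>. exp (- Y i \<omega>)) \<le> 1 - x / 2" if i: "i \<in> L" for i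
  proof -
    let ?I = "{\<omega>\<in>space M. \<forall>e\<in>Out i. \<not> A e \<omega>}" and ?J = "{\<omega>\<in>space M. \<forall>e\<in>Out i \<union> Bk i. \<not> A e \<omega>}"
    have m: "?I \<in> events" "?J \<in> events" using sub[OF i] by (auto intro!: measurable_no_edges)
    have "expectation (\<lambda>\<omega>. exp (- Y i \<omega>)) = expectation (\<lambda>\<omega>. 1 + (exp 1 - 1) * indicator ?I \<omega> - (exp 1 - exp (- 1)) * indicator ?J \<omega>)"
      by (rule Bochner_Integration.integral_cong) (auto simp: Y_def split: split_indicator)
    also have "\<dots> = 1 + (exp 1 - 1) * prob ?I - (exp 1 - exp (- 1)) * prob ?J"
      using m by (simp add: prob_space emeasure_eq_measure)
    also have "prob ?I = x" using prob_no_edges[OF sub(1)[OF i]] x[OF i] by simp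
    also have "prob ?J = x * (1 - q) ^ card (Bk i)"
      using prob_no_edges[of "Out i \<union> Bk i"] sub[OF i] x[OF i] fin[OF i] disj[OF i]
      by (simp add: card_Un_disjoint power_add)
    also have "1 + (exp 1 - 1) * x - (exp 1 - exp (- 1)) * (x * (1 - q) ^ card (Bk i)) \<le> 1 + (exp 1 - 1) * x - (exp 1 - exp (- 1)) * (x * (19/20))"
    proof -
      \<comment> \<open>Given that \<open>Out i\<close> is absent, the score is \<open>1\<close>
        with probability at least \<open>19 / 20\<close>, by Bernoulli's inequality.\<close>
      have "1 + real (card (Bk i)) * (- q) \<le> (1 + (- q)) ^ card (Bk i)" using q by (intro Bernoulli_inequality) simp
      hence "19 / 20 \<le> (1 - q) ^ card (Bk i)" using y[OF i] by simp
      moreover have "(exp (- 1) :: real) \<le> exp 1" by simp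
      ultimately have "(exp 1 - exp (- 1)) * (x * (19/20)) \<le> (exp 1 - exp (- 1)) * (x * (1 - q) ^ card (Bk i))"
        using x01[OF i] by (intro mult_left_mono) auto
      thus ?thesis by simp
    qed
    \<comment> \<open>The bracket is about 0.51; the bound \<open>1 / 20\<close> on the expected
      number of edges in \<open>Bk i\<close> was chosen to keep it above one half.\<close>
    also have "\<dots> = 1 - x * (1 - exp 1 / 20 - 19/20 * exp (- 1))" by (simp add: field_simps)
    also have "\<dots> \<le> 1 - x * (1 / 2)"
    proof -
      have "\<bar>exp 1 - 5837465777 / 2147483648\<bar> \<le> (inverse (2 ^ 32) :: real)" by (rule e_approx_32)
      moreover have "inverse (2 ^ 32) \<le> (1 / 100 :: real)" by (simp add: divide_simps)
      ultimately have e: "27 / 10 \<le> (exp 1 :: real)" "(exp 1 :: real) \<le> 273 / 100" by linarith+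
      have "exp (- 1) \<le> (10 / 27 :: real)" using e(1) by (simp add: exp_minus field_simps)
      hence "1 / 2 \<le> 1 - exp 1 / 20 - 19/20 * exp (- 1 :: real)" using e(2) by simp
      thus ?thesis using x01[OF i] by (simp only: diff_left_mono mult_left_mono)
    qed
    finally show ?thesis by simp
  qed
  have Ym: "(\<lambda>\<omega>. \<Prod>i\<in>L. exp (- Y i \<omega>)) \<in> borel_measurable M"
    using Em by (rule borel_measurable_prod)
  have eq: "{\<omega>\<in>space M. (\<Sum>i\<in>L. Y i \<omega>) \<le> 0} = {\<omega>\<in>space M. (\<Prod>i\<in>L. exp (- Y i \<omega>)) \<ge> 1}"
    using L by (simp add: exp_sum[symmetric] sum_negf)
  show "{\<omega>\<in>space M. (\<Sum>i\<in>L. Y i \<omega>) \<le> 0} \<in> events"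
    unfolding eq using Ym by measurable
  have "prob {\<omega>\<in>space M. (\<Prod>i\<in>L. exp (- Y i \<omega>)) \<ge> 1} \<le> expectation (\<lambda>\<omega>. \<Prod>i\<in>L. exp (- Y i \<omega>)) / 1"
    using indep_vars_integrable[OF L ind int]
    by (intro integral_Markov_inequality_measure[where A="{}"]) (auto intro!: prod_nonneg)
  also have "\<dots> = (\<Prod>i\<in>L. expectation (\<lambda>\<omega>. exp (- Y i \<omega>)))"
    using indep_vars_lebesgue_integral[OF L ind int] by simp
  also have "\<dots> \<le> (\<Prod>i\<in>L. 1 - x / 2)"
    using ex by (intro prod_mono conjI integral_nonneg_AE) auto
  finally show "prob {\<omega>\<in>space M. (\<Sum>i\<in>L. Y i \<omega>) \<le> 0} \<le> (1 - x / 2) ^ card L" unfolding eq by simp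
qed

text \<open>If the graph is connected, then a vertex of \<open>{1..m}\<close> without a neighbour outside \<open>{1..m}\<close> has a smaller or a
  larger neighbour inside. Each of these two alternatives, taken separately, involves independent variables for the
  different vertices, and one of them has to hold for at least half of the vertices in question.\<close>

lemma prob_connected_le:
  assumes n: "n \<ge> 2" and m: "m \<le> n" and q: "0 \<le> q" "q \<le> 1" and mq: "real m * q \<le> 1 / 20"
  shows "prob {\<omega>\<in>space M. cut_connected n (edges \<omega>)} \<le> 2 * exp (- (real m / 2 * (1 - q) ^ (n - m)))"
proof -
  let ?x = "(1 - q) ^ (n - m)"
  define Out where "Out i = {i} \<times> {m<..n}" for i :: nat
  define B1 where "B1 i = {1..<i} \<times> {i}" for i :: nat
  define B2 where "B2 i = {i} \<times> {i<..m}" for i :: nat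
  define Y where "Y Bk i \<omega> = (if \<forall>e\<in>Out i. \<not> A e \<omega> then (if \<forall>e\<in>Bk i. \<not> A e \<omega> then 1 else - 1) else 0 :: real)"
    for Bk :: "nat \<Rightarrow> (nat \<times> nat) set" and i \<omega>
  have co: "card (Out i) = n - m" for i by (simp add: Out_def card_cartesian_product)
  have out: "Out i \<subseteq> pairs n" "B1 i \<subseteq> pairs n" "B2 i \<subseteq> pairs n" if "i \<in> {1..m}" for i
    using that m by (auto simp: Out_def B1_def B2_def pairs_def)
  have "real (card (B1 i)) * q \<le> real m * q" "real (card (B2 i)) * q \<le> real m * q" if "i \<in> {1..m}" for i
    using that q by (auto simp: B1_def B2_def card_cartesian_product intro!: mult_right_mono)
  hence cb: "real (card (B1 i)) * q \<le> 1 / 20" "real (card (B2 i)) * q \<le> 1 / 20" if "i \<in> {1..m}" for i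
    using that mq by force+
  have 1: "{\<omega>\<in>space M. (\<Sum>i\<in>{1..m}. Y B1 i \<omega>) \<le> 0} \<in> events"
    "prob {\<omega>\<in>space M. (\<Sum>i\<in>{1..m}. Y B1 i \<omega>) \<le> 0} \<le> (1 - ?x / 2) ^ card {1..m}"
  proof -
    have d: "Out i \<inter> B1 i = {}" "(1 - q) ^ card (Out i) = ?x" if "i \<in> {1..m}" for i
      using that co by (auto simp: Out_def B1_def)
    have d': "(Out i \<union> B1 i) \<inter> (Out j \<union> B1 j) = {}" if "i \<in> {1..m}" "j \<in> {1..m}" "i \<noteq> j" for i j
      using that by (auto simp: Out_def B1_def)
    note I = isolated_exp_moment[of "{1..m}" Out B1 ?x, OF out(1) out(2) d(1) d' _ d(2) cb(1) q, folded Y_def]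
    show "{\<omega>\<in>space M. (\<Sum>i\<in>{1..m}. Y B1 i \<omega>) \<le> 0} \<in> events" by (rule I(1)) auto
    show "prob {\<omega>\<in>space M. (\<Sum>i\<in>{1..m}. Y B1 i \<omega>) \<le> 0} \<le> (1 - ?x / 2) ^ card {1..m}" by (rule I(2)) auto
  qed
  have 2: "{\<omega>\<in>space M. (\<Sum>i\<in>{1..m}. Y B2 i \<omega>) \<le> 0} \<in> events"
    "prob {\<omega>\<in>space M. (\<Sum>i\<in>{1..m}. Y B2 i \<omega>) \<le> 0} \<le> (1 - ?x / 2) ^ card {1..m}"
  proof -
    have d: "Out i \<inter> B2 i = {}" "(1 - q) ^ card (Out i) = ?x" if "i \<in> {1..m}" for i
      using that co by (auto simp: Out_def B2_def)
    have d': "(Out i \<union> B2 i) \<inter> (Out j \<union> B2 j) = {}" if "i \<in> {1..m}" "j \<in> {1..m}" "i \<noteq> j" for i j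
      using that by (auto simp: Out_def B2_def)
    note I = isolated_exp_moment[of "{1..m}" Out B2 ?x, OF out(1) out(3) d(1) d' _ d(2) cb(2) q, folded Y_def]
    show "{\<omega>\<in>space M. (\<Sum>i\<in>{1..m}. Y B2 i \<omega>) \<le> 0} \<in> events" by (rule I(1)) auto
    show "prob {\<omega>\<in>space M. (\<Sum>i\<in>{1..m}. Y B2 i \<omega>) \<le> 0} \<le> (1 - ?x / 2) ^ card {1..m}" by (rule I(2)) auto
  qed
  have "{\<omega>\<in>space M. cut_connected n (edges \<omega>)} \<subseteq>
    {\<omega>\<in>space M. (\<Sum>i\<in>{1..m}. Y B1 i \<omega>) \<le> 0} \<union> {\<omega>\<in>space M. (\<Sum>i\<in>{1..m}. Y B2 i \<omega>) \<le> 0}"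
  proof
    fix \<omega> assume w: "\<omega> \<in> {\<omega>\<in>space M. cut_connected n (edges \<omega>)}"
    \<comment> \<open>In a connected graph the two scores of a vertex cannot both be
      \<open>1\<close>, so they add up to at most \<open>0\<close>, and one of the two total scores
      is not positive.\<close>
    have "Y B1 i \<omega> + Y B2 i \<omega> \<le> 0" if i: "i \<in> {1..m}" for i
    proof (cases "\<forall>e\<in>Out i. \<not> A e \<omega>")
      case True
      have "{i} \<noteq> {1..n}"
      proof
        assume "{i} = {1..n}"
        hence "card {i} = card {1..n}" by simp
        thus False using n by simp
      qed
      hence "edges \<omega> \<inter> cut_set n {i} \<noteq> {}"
        using w i m unfolding cut_connected_def by auto
      then obtain a b where ab: "A (a, b) \<omega>" "1 \<le> a" "a < b" "b \<le> n" "(a = i) \<noteq> (b = i)"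
        by (auto simp: edges_def cut_set_def pairs_def)
      have "(a, b) \<notin> Out i" using True ab by auto
      hence "(a, b) \<in> B1 i \<union> B2 i" using ab i by (auto simp: Out_def B1_def B2_def)
      thus ?thesis using True ab(1) by (auto simp: Y_def)
    qed (simp add: Y_def)
    hence "(\<Sum>i\<in>{1..m}. Y B1 i \<omega> + Y B2 i \<omega>) \<le> 0" by (intro sum_nonpos)
    hence "(\<Sum>i\<in>{1..m}. Y B1 i \<omega>) + (\<Sum>i\<in>{1..m}. Y B2 i \<omega>) \<le> 0" by (simp only: sum.distrib)
    thus "\<omega> \<in> {\<omega>\<in>space M. (\<Sum>i\<in>{1..m}. Y B1 i \<omega>) \<le> 0} \<union> {\<omega>\<in>space M. (\<Sum>i\<in>{1..m}. Y B2 i \<omega>) \<le> 0}"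
      using w by (simp, linarith)
  qed
  hence "prob {\<omega>\<in>space M. cut_connected n (edges \<omega>)} \<le>
    prob ({\<omega>\<in>space M. (\<Sum>i\<in>{1..m}. Y B1 i \<omega>) \<le> 0} \<union> {\<omega>\<in>space M. (\<Sum>i\<in>{1..m}. Y B2 i \<omega>) \<le> 0})"
    using 1 2 by (intro finite_measure_mono) auto
  also have "\<dots> \<le> (1 - ?x / 2) ^ m + (1 - ?x / 2) ^ m"
    using measure_Un_le[OF 1(1) 2(1)] 1(2) 2(2) by simp
  also have "(1 - ?x / 2) ^ m \<le> exp (- (?x / 2)) ^ m"
  proof (rule power_mono)
    have "?x \<le> 1" using q by (simp add: power_le_one)
    thus "0 \<le> 1 - ?x / 2" by simp
    show "1 - ?x / 2 \<le> exp (- (?x / 2))" using exp_ge_add_one_self[of "- (?x / 2)"] by simp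
  qed
  also have "exp (- (?x / 2)) ^ m = exp (- (real m / 2 * ?x))" by (simp add: exp_of_nat_mult[symmetric])
  finally show ?thesis by simp
qed

end

context gauss_array
begin

lemma random_graph_inner:
  assumes u: "(\<Sum>k<d. (u k)\<^sup>2) = 1"
  shows "random_graph M n (gtail \<tau>) (\<lambda>e \<omega>. inner_prod d (X e \<omega>) u \<ge> \<tau>)"
proof
  show "indep_vars (\<lambda>_. count_space UNIV) (\<lambda>e \<omega>. inner_prod d (X e \<omega>) u \<ge> \<tau>) (pairs n)"
    by (rule indep_vars_compose2[OF indep_inner, of "\<lambda>_ x. x \<ge> \<tau>"]) simp
  show "prob {\<omega>\<in>space M. inner_prod d (X e \<omega>) u \<ge> \<tau>} = gtail \<tau>" if "e \<in> pairs n" for e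
    by (rule prob_std_normal_ge[OF inner_std_normal[OF that u]])
qed

lemma random_graph_edges:
  assumes u: "(\<Sum>k<d. (u k)\<^sup>2) = 1"
  shows "random_graph.edges n (\<lambda>e \<omega>. inner_prod d (X e \<omega>) u \<ge> \<tau>) \<omega> = edge_set n d (\<lambda>e. X e \<omega>) u \<tau>"
  by (simp add: random_graph.edges_def[OF random_graph_inner[OF u]] edge_set_def)

end

lemma whpI:
  assumes ev: "\<forall>\<^sub>F n in sequentially. prob_space (M n) \<and> {\<omega>\<in>space (M n). A n \<omega>} \<in> sets (M n) \<and>
      measure (M n) {\<omega>\<in>space (M n). \<not> A n \<omega>} \<le> f n"
    and f: "f \<longlonglongrightarrow> 0"
  shows "whp M A"
  unfolding whp_def
proof (rule tendsto_sandwich)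
  have e: "\<forall>\<^sub>F n in sequentially. 1 - f n \<le> measure (M n) {\<omega> \<in> space (M n). A n \<omega>} \<and> measure (M n) {\<omega> \<in> space (M n). A n \<omega>} \<le> 1"
    using ev
  proof eventually_elim
    case (elim n)
    then interpret prob_space "M n" by simp
    have "{\<omega>\<in>space (M n). \<not> A n \<omega>} = space (M n) - {\<omega>\<in>space (M n). A n \<omega>}" by auto
    hence "prob {\<omega>\<in>space (M n). \<not> A n \<omega>} = 1 - prob {\<omega>\<in>space (M n). A n \<omega>}" using elim by (simp add: prob_compl)
    thus ?case using elim by simp
  qed
  show "\<forall>\<^sub>F n in sequentially. 1 - f n \<le> measure (M n) {\<omega> \<in> space (M n). A n \<omega>}" using e by eventually_elim simp
  show "\<forall>\<^sub>F n in sequentially. measure (M n) {\<omega> \<in> space (M n). A n \<omega>} \<le> 1" using e by eventually_elim simp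
  show "(\<lambda>n. 1 - f n) \<longlonglongrightarrow> 1" using tendsto_diff[OF tendsto_const f, of 1] by simp
qed simp

lemma sum_power_card_Pow:
  fixes x :: real
  assumes "finite A"
  shows "(\<Sum>S\<in>Pow A. x ^ card S) = (1 + x) ^ card A"
  using assms
proof induction
  case (insert a A)
  have "(\<Sum>S\<in>Pow (insert a A). x ^ card S) = (\<Sum>S\<in>Pow A. x ^ card S) + (\<Sum>S\<in>insert a ` Pow A. x ^ card S)"
    unfolding Pow_insert using insert by (intro sum.union_disjoint) auto
  also have "(\<Sum>S\<in>insert a ` Pow A. x ^ card S) = (\<Sum>S\<in>Pow A. x ^ card (insert a S))"
    using insert by (subst sum.reindex) (auto simp: inj_on_def)
  also have "\<dots> = (\<Sum>S\<in>Pow A. x * x ^ card S)"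
    using insert by (intro sum.cong refl) (subst card_insert_disjoint, auto intro: finite_subset)
  finally show ?case using insert by (simp add: sum_distrib_left[symmetric] algebra_simps)
qed simp

lemma one_minus_power_le_exp:
  assumes "0 \<le> q" "q \<le> (1::real)" shows "(1 - q) ^ k \<le> exp (- (q * real k))"
proof -
  have "1 - q \<le> exp (- q)" using exp_ge_add_one_self[of "- q"] by simp
  hence "(1 - q) ^ k \<le> exp (- q) ^ k" using assms by (intro power_mono) auto
  also have "\<dots> = exp (- (q * real k))" by (simp add: exp_of_nat_mult[symmetric] mult.commute)
  finally show ?thesis .
qed

text \<open>A side of at most \<open>\<kappa> * n\<close> vertices has at least
  \<open>(1 - \<kappa>) * n\<close> vertices opposite; these terms sum to a binomial power, and
  leaving out the empty set gives the \<open>- 1\<close> that makes the bound small. For larger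
  sides the exponent is quadratic in \<open>n\<close>, which is meant to beat the number
  \<open>2 ^ n\<close> of sets.\<close>

lemma sum_cuts_le:
  assumes q: "0 \<le> q" "q \<le> (1::real)" and k: "0 < \<kappa>" "\<kappa> \<le> 1 / 2"
  shows "(\<Sum>S\<in>{S\<in>Pow {1..n}. S \<noteq> {} \<and> 2 * card S \<le> n}. (1 - q) ^ (card S * (n - card S)))
    \<le> (exp (real n * exp (- (q * (1 - \<kappa>) * real n))) - 1) + 2 ^ n * exp (- (q * \<kappa> * (real n)\<^sup>2 / 2))"
proof -
  let ?F = "{S\<in>Pow {1..n}. S \<noteq> {} \<and> 2 * card S \<le> n}"
  let ?w = "exp (- (q * (1 - \<kappa>) * real n))" and ?b = "exp (- (q * \<kappa> * (real n)\<^sup>2 / 2))"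
  have t: "(1 - q) ^ (card S * (n - card S)) \<le> ?w ^ card S + ?b" if S: "S \<in> ?F" for S
  proof -
    let ?k = "card S"
    have kn: "2 * ?k \<le> n" using S by simp
    have "(1 - q) ^ (?k * (n - ?k)) \<le> exp (- (q * real (?k * (n - ?k))))" by (rule one_minus_power_le_exp[OF q])
    also have "\<dots> \<le> ?w ^ ?k + ?b"
    proof (cases "real ?k \<le> \<kappa> * real n")
      case True
      have "(1 - \<kappa>) * real n \<le> real (n - ?k)" using True kn by (simp add: algebra_simps of_nat_diff)
      hence "q * real ?k * ((1 - \<kappa>) * real n) \<le> q * real ?k * real (n - ?k)" using q by (intro mult_left_mono) auto
      hence "exp (- (q * real (?k * (n - ?k)))) \<le> exp (real ?k * (- (q * (1 - \<kappa>) * real n)))" by (simp add: mult_ac)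
      also have "\<dots> = ?w ^ ?k" by (rule exp_of_nat_mult)
      finally show ?thesis by (simp add: add_increasing2)
    next
      case False
      have "real n / 2 \<le> real (n - ?k)" using kn by (simp add: of_nat_diff)
      hence "\<kappa> * real n * (real n / 2) \<le> real ?k * real (n - ?k)" using False k by (intro mult_mono) auto
      hence "q * (\<kappa> * real n * (real n / 2)) \<le> q * (real ?k * real (n - ?k))" using q by (intro mult_left_mono) auto
      hence "exp (- (q * real (?k * (n - ?k)))) \<le> ?b" by (simp add: mult_ac power2_eq_square)
      thus ?thesis by (simp add: add_increasing)
    qed
    finally show ?thesis .
  qed
  have "(\<Sum>S\<in>?F. (1 - q) ^ (card S * (n - card S))) \<le> (\<Sum>S\<in>?F. ?w ^ card S + ?b)"
    by (intro sum_mono t)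
  also have "\<dots> = (\<Sum>S\<in>?F. ?w ^ card S) + real (card ?F) * ?b" by (simp add: sum.distrib)
  also have "(\<Sum>S\<in>?F. ?w ^ card S) \<le> (\<Sum>S\<in>Pow {1..n} - {{}}. ?w ^ card S)"
    by (intro sum_mono2) auto
  also have "\<dots> = (1 + ?w) ^ n - 1" by (subst sum_diff1) (auto simp: sum_power_card_Pow)
  also have "(1 + ?w) ^ n \<le> exp ?w ^ n" by (intro power_mono exp_ge_add_one_self) (simp add: add_nonneg_nonneg)
  also have "exp ?w ^ n = exp (real n * ?w)" by (rule exp_of_nat_mult[symmetric])
  also have "real (card ?F) * ?b \<le> 2 ^ n * ?b"
  proof (rule mult_right_mono)
    have "card ?F \<le> card (Pow {1..n})" by (intro card_mono) auto
    hence "real (card ?F) \<le> real (2 ^ n)" by (simp add: card_Pow del: of_nat_power)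
    thus "real (card ?F) \<le> 2 ^ n" by simp
  qed simp
  finally show ?thesis by simp
qed

lemma cut_set_compl: "cut_set n ({1..n} - S) = cut_set n S"
  by (auto simp: cut_set_def pairs_def)

text \<open>A set and its complement have the same cut, so the smaller side suffices. This halves
  nothing essential in the count but guarantees at least \<open>n / 2\<close> vertices
  opposite.\<close>

lemma not_cut_connected_iff:
  "\<not> cut_connected n E \<longleftrightarrow> (\<exists>S\<in>{S\<in>Pow {1..n}. S \<noteq> {} \<and> 2 * card S \<le> n}. E \<inter> cut_set n S = {})"
proof
  assume "\<not> cut_connected n E"
  then obtain S where S: "S \<subseteq> {1..n}" "S \<noteq> {}" "S \<noteq> {1..n}" "E \<inter> cut_set n S = {}"
    by (auto simp: cut_connected_def)
  show "\<exists>S\<in>{S\<in>Pow {1..n}. S \<noteq> {} \<and> 2 * card S \<le> n}. E \<inter> cut_set n S = {}"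
  proof (cases "2 * card S \<le> n")
    case True thus ?thesis using S by blast
  next
    case False
    have "card ({1..n} - S) = n - card S" using S by (simp add: card_Diff_subset finite_subset)
    hence "2 * card ({1..n} - S) \<le> n" using False by simp
    moreover have "{1..n} - S \<noteq> {}" using S by blast
    moreover have "E \<inter> cut_set n ({1..n} - S) = {}" using S(4) by (simp only: cut_set_compl)
    ultimately show ?thesis by blast
  qed
next
  assume "\<exists>S\<in>{S\<in>Pow {1..n}. S \<noteq> {} \<and> 2 * card S \<le> n}. E \<inter> cut_set n S = {}"
  then obtain S where S: "S \<subseteq> {1..n}" "S \<noteq> {}" "2 * card S \<le> n" "E \<inter> cut_set n S = {}" by auto
  have "S \<noteq> {1..n}"
  proof
    assume "S = {1..n}"
    hence "n = 0" using S(3) by simp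
    thus False using S \<open>S = {1..n}\<close> by simp
  qed
  thus "\<not> cut_connected n E" using S by (auto simp: cut_connected_def)
qed

section \<open>From the points of a net to all directions\<close>

context gauss_array
begin

lemma measurable_norm_gt:
  "{\<omega>\<in>space M. \<exists>e\<in>pairs n. L2_set (X e \<omega>) {..<d} > R} \<in> events"
proof -
  have "(\<lambda>\<omega>. L2_set (X e \<omega>) {..<d}) \<in> borel_measurable M" if "e \<in> pairs n" for e
  proof -
    have [measurable]: "(\<lambda>\<omega>. \<Sum>k<d. (X e \<omega> k)\<^sup>2) \<in> borel_measurable M"
      using that by (intro borel_measurable_sum borel_measurable_power measurable_X) auto
    show ?thesis unfolding L2_set_def by measurable
  qed
  hence "Measurable.pred M (\<lambda>\<omega>. \<exists>e\<in>pairs n. L2_set (X e \<omega>) {..<d} > R)"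
    by (intro pred_intros_finite borel_measurable_pred_less) auto
  thus ?thesis by (simp add: pred_def)
qed

text \<open>If all norms are at most \<open>R\<close>, then passing from \<open>s\<close> to its net
  direction only adds edges once the threshold is lowered by \<open>R * r\<close>. Connectivity is
  increasing, so a union bound over the net with \<open>prob_connected_le\<close> applies.\<close>

lemma prob_exists_connected_le:
  assumes n: "n \<ge> 2" and d: "d \<ge> 1" and r: "0 < r" "r < 1" and t: "R * r \<le> t"
    and m: "m \<le> n" "real m * gtail (t - R * r) \<le> 1 / 20"
  shows "prob {\<omega>\<in>space M. \<exists>s\<in>unit_sphere d. graph_connected (Gam n d (\<lambda>e. X e \<omega>) s t)} \<le>
    prob {\<omega>\<in>space M. \<exists>e\<in>pairs n. L2_set (X e \<omega>) {..<d} > R} +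
    (11 / r) ^ d * (2 * exp (- (real m / 2 * (1 - gtail (t - R * r)) ^ (n - m))))"
    (is "prob ?A \<le> prob ?B + _ * ?p")
proof -
  let ?\<tau> = "t - R * r"
  let ?C = "\<lambda>u. {\<omega>\<in>space M. cut_connected n (edge_set n d (\<lambda>e. X e \<omega>) u ?\<tau>)}"
  have C: "?C u \<in> events" "prob (?C u) \<le> ?p" if u: "u \<in> net_dirs d r" for u
  proof -
    note un = net_dirs_unit[OF u]
    interpret random_graph M n "gtail ?\<tau>" "\<lambda>e \<omega>. inner_prod d (X e \<omega>) u \<ge> ?\<tau>"
      by (rule random_graph_inner[OF un])
    show "prob (?C u) \<le> ?p"
      using prob_connected_le[OF n m(1) _ _ m(2)] unfolding random_graph_edges[OF un] by simp
    have "{\<omega>\<in>space M. \<not> cut_connected n (edge_set n d (\<lambda>e. X e \<omega>) u ?\<tau>)} \<in> events"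
      using prob_empty_cut(2)[of "{S\<in>Pow {1..n}. S \<noteq> {} \<and> 2 * card S \<le> n}"]
      unfolding not_cut_connected_iff random_graph_edges[OF un] by auto
    moreover have "?C u = space M - {\<omega>\<in>space M. \<not> cut_connected n (edge_set n d (\<lambda>e. X e \<omega>) u ?\<tau>)}" by auto
    ultimately show "?C u \<in> events" by auto
  qed
  have fin: "finite (net_dirs d r)" by (rule card_net_dirs[OF d]) (use r in auto)
  have "?A \<subseteq> ?B \<union> (\<Union>u\<in>net_dirs d r. ?C u)"
  proof
    fix \<omega> assume w: "\<omega> \<in> ?A"
    then obtain s where s: "s \<in> unit_sphere d" "cut_connected n (edge_set n d (\<lambda>e. X e \<omega>) s t)"
      using n by (auto simp: graph_connected_Gam)
    show "\<omega> \<in> ?B \<union> (\<Union>u\<in>net_dirs d r. ?C u)"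
    proof (cases "\<omega> \<in> ?B")
      case False
      hence R: "L2_set (X e \<omega>) {..<d} \<le> R" if "e \<in> pairs n" for e using that w by (auto simp: not_less)
      obtain u a where u: "u \<in> net_dirs d r" "1 - r \<le> a" "a \<le> 1"
        "\<And>x. \<bar>inner_prod d x s - a * inner_prod d x u\<bar> \<le> L2_set x {..<d} * r"
        using net_dirs_approx[OF d r s(1)] by blast
      have "edge_set n d (\<lambda>e. X e \<omega>) s t \<subseteq> edge_set n d (\<lambda>e. X e \<omega>) u ?\<tau>"
      proof
        fix e assume "e \<in> edge_set n d (\<lambda>e. X e \<omega>) s t"
        hence e: "e \<in> pairs n" "inner_prod d (X e \<omega>) s \<ge> t" by (auto simp: edge_set_def)
        have "L2_set (X e \<omega>) {..<d} * r \<le> R * r" using R[OF e(1)] r by (intro mult_right_mono) auto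
        hence ge: "a * inner_prod d (X e \<omega>) u \<ge> ?\<tau>" using u(4)[of "X e \<omega>"] e(2) by linarith
        have a: "0 < a" using u(2) r by linarith
        have "inner_prod d (X e \<omega>) u \<ge> 0" using ge t a by (meson diff_ge_0_iff_ge order_trans zero_le_mult_iff not_less)
        hence "a * inner_prod d (X e \<omega>) u \<le> inner_prod d (X e \<omega>) u" using u(3) by (simp add: mult_left_le_one_le a less_imp_le)
        thus "e \<in> edge_set n d (\<lambda>e. X e \<omega>) u ?\<tau>" using e(1) ge by (simp add: edge_set_def)
      qed
      hence "cut_connected n (edge_set n d (\<lambda>e. X e \<omega>) u ?\<tau>)" by (rule cut_connected_mono[OF s(2)])
      thus ?thesis using u(1) w by blast
    qed blast
  qed
  hence "prob ?A \<le> prob (?B \<union> (\<Union>u\<in>net_dirs d r. ?C u))"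
    using C(1) by (intro finite_measure_mono sets.Un sets.finite_UN fin measurable_norm_gt)
  also have "\<dots> \<le> prob ?B + prob (\<Union>u\<in>net_dirs d r. ?C u)"
    using C(1) by (intro measure_Un_le sets.finite_UN fin measurable_norm_gt)
  also have "prob (\<Union>u\<in>net_dirs d r. ?C u) \<le> (\<Sum>u\<in>net_dirs d r. prob (?C u))"
    using C(1) fin by (intro finite_measure_subadditive_finite) auto
  also have "\<dots> \<le> (\<Sum>u\<in>net_dirs d r. ?p)" by (intro sum_mono C)
  also have "\<dots> = real (card (net_dirs d r)) * ?p" by simp
  also have "\<dots> \<le> (11 / r) ^ d * ?p"
    using card_net_dirs(2)[OF d, of r] r by (intro mult_right_mono) auto
  finally show ?thesis by simp
qed

text \<open>Now the edges present in the net direction have to survive the passage to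
  \<open>s\<close>. The threshold is therefore raised by \<open>R * r\<close>, and the division by
  \<open>1 - r\<close> compensates for the factor \<open>a \<ge> 1 - r\<close>.\<close>

lemma prob_exists_disconnected_le:
  assumes n: "n \<ge> 2" and d: "d \<ge> 1" and r: "0 < r" "r < 1" and t: "0 \<le> t + R * r"
    and k: "0 < \<kappa>" "\<kappa> \<le> 1 / 2"
  defines "q \<equiv> gtail ((t + R * r) / (1 - r))"
  shows "prob {\<omega>\<in>space M. \<exists>s\<in>unit_sphere d. \<not> graph_connected (Gam n d (\<lambda>e. X e \<omega>) s t)} \<le>
    prob {\<omega>\<in>space M. \<exists>e\<in>pairs n. L2_set (X e \<omega>) {..<d} > R} +
    (11 / r) ^ d * ((exp (real n * exp (- (q * (1 - \<kappa>) * real n))) - 1) + 2 ^ n * exp (- (q * \<kappa> * (real n)\<^sup>2 / 2)))"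
    (is "prob ?A \<le> prob ?B + _ * ?p")
proof -
  let ?\<tau> = "(t + R * r) / (1 - r)"
  let ?C = "\<lambda>u. {\<omega>\<in>space M. \<not> cut_connected n (edge_set n d (\<lambda>e. X e \<omega>) u ?\<tau>)}"
  have C: "?C u \<in> events" "prob (?C u) \<le> ?p" if u: "u \<in> net_dirs d r" for u
  proof -
    note un = net_dirs_unit[OF u]
    interpret random_graph M n "gtail ?\<tau>" "\<lambda>e \<omega>. inner_prod d (X e \<omega>) u \<ge> ?\<tau>"
      by (rule random_graph_inner[OF un])
    have s: "{S\<in>Pow {1..n}. S \<noteq> {} \<and> 2 * card S \<le> n} \<subseteq> Pow {1..n}" by auto
    show "?C u \<in> events"
      using prob_empty_cut(2)[OF s] unfolding not_cut_connected_iff random_graph_edges[OF un] .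
    have "prob (?C u) \<le> (\<Sum>S\<in>{S\<in>Pow {1..n}. S \<noteq> {} \<and> 2 * card S \<le> n}. (1 - gtail ?\<tau>) ^ (card S * (n - card S)))"
      using prob_empty_cut(1)[OF s] unfolding not_cut_connected_iff random_graph_edges[OF un] .
    also have "\<dots> \<le> ?p" unfolding q_def by (rule sum_cuts_le) (use k in auto)
    finally show "prob (?C u) \<le> ?p" .
  qed
  have fin: "finite (net_dirs d r)" by (rule card_net_dirs[OF d]) (use r in auto)
  have "?A \<subseteq> ?B \<union> (\<Union>u\<in>net_dirs d r. ?C u)"
  proof
    fix \<omega> assume w: "\<omega> \<in> ?A"
    then obtain s where s: "s \<in> unit_sphere d" "\<not> cut_connected n (edge_set n d (\<lambda>e. X e \<omega>) s t)"
      using n by (auto simp: graph_connected_Gam)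
    show "\<omega> \<in> ?B \<union> (\<Union>u\<in>net_dirs d r. ?C u)"
    proof (cases "\<omega> \<in> ?B")
      case False
      hence R: "L2_set (X e \<omega>) {..<d} \<le> R" if "e \<in> pairs n" for e using that w by (auto simp: not_less)
      obtain u a where u: "u \<in> net_dirs d r" "1 - r \<le> a" "a \<le> 1"
        "\<And>x. \<bar>inner_prod d x s - a * inner_prod d x u\<bar> \<le> L2_set x {..<d} * r"
        using net_dirs_approx[OF d r s(1)] by blast
      have "edge_set n d (\<lambda>e. X e \<omega>) u ?\<tau> \<subseteq> edge_set n d (\<lambda>e. X e \<omega>) s t"
      proof
        fix e assume "e \<in> edge_set n d (\<lambda>e. X e \<omega>) u ?\<tau>"
        hence e: "e \<in> pairs n" "inner_prod d (X e \<omega>) u \<ge> ?\<tau>" by (auto simp: edge_set_def)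
        have "L2_set (X e \<omega>) {..<d} * r \<le> R * r" using R[OF e(1)] r by (intro mult_right_mono) auto
        moreover have "(1 - r) * ?\<tau> = t + R * r" using r by simp
        moreover have "(1 - r) * ?\<tau> \<le> a * inner_prod d (X e \<omega>) u"
          using u(2) e(2) t r by (intro mult_mono) auto
        ultimately have "inner_prod d (X e \<omega>) s \<ge> t" using u(4)[of "X e \<omega>"] by linarith
        thus "e \<in> edge_set n d (\<lambda>e. X e \<omega>) s t" using e(1) by (simp add: edge_set_def)
      qed
      hence "\<not> cut_connected n (edge_set n d (\<lambda>e. X e \<omega>) u ?\<tau>)" using s(2) cut_connected_mono by blast
      thus ?thesis using u(1) w by blast
    qed blast
  qed
  hence "prob ?A \<le> prob (?B \<union> (\<Union>u\<in>net_dirs d r. ?C u))"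
    using C(1) by (intro finite_measure_mono sets.Un sets.finite_UN fin measurable_norm_gt)
  also have "\<dots> \<le> prob ?B + prob (\<Union>u\<in>net_dirs d r. ?C u)"
    using C(1) by (intro measure_Un_le sets.finite_UN fin measurable_norm_gt)
  also have "prob (\<Union>u\<in>net_dirs d r. ?C u) \<le> (\<Sum>u\<in>net_dirs d r. prob (?C u))"
    using C(1) fin by (intro finite_measure_subadditive_finite) auto
  also have "\<dots> \<le> (\<Sum>u\<in>net_dirs d r. ?p)" by (intro sum_mono C)
  also have "\<dots> = real (card (net_dirs d r)) * ?p" by simp
  also have "\<dots> \<le> (11 / r) ^ d * ?p"
    using card_net_dirs(2)[OF d, of r] r by (intro mult_right_mono add_nonneg_nonneg) auto
  finally show ?thesis by simp
qed

text \<open>Chernoff's bound with parameter \<open>1 / 4\<close>, which costs \<open>sqrt 2\<close>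
  per coordinate. It is effective once \<open>R\<^sup>2\<close> is well above
  \<open>8 * ln n + 2 * d * ln 2\<close>.\<close>

lemma prob_norm_gt_le:
  assumes R: "0 \<le> R"
  shows "prob {\<omega>\<in>space M. \<exists>e\<in>pairs n. L2_set (X e \<omega>) {..<d} > R} \<le> (real n)\<^sup>2 * (exp (- (R\<^sup>2 / 4)) * sqrt 2 ^ d)"
proof -
  let ?C = "\<lambda>e. {\<omega>\<in>space M. (1/4) * (\<Sum>k\<in>{..<d}. (X e \<omega> k)\<^sup>2) \<ge> R\<^sup>2 / 4}"
  have Cm: "?C e \<in> events" if "e \<in> pairs n" for e
  proof -
    have "(\<lambda>\<omega>. (1/4) * (\<Sum>k\<in>{..<d}. (X e \<omega> k)\<^sup>2)) \<in> borel_measurable M"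
      using that by (intro borel_measurable_times borel_measurable_const borel_measurable_sum borel_measurable_power measurable_X) auto
    thus ?thesis by measurable
  qed
  have "{\<omega>\<in>space M. \<exists>e\<in>pairs n. L2_set (X e \<omega>) {..<d} > R} \<subseteq> (\<Union>e\<in>pairs n. ?C e)"
  proof safe
    fix \<omega> i j assume w: "\<omega> \<in> space M" "(i, j) \<in> pairs n" "R < L2_set (X (i, j) \<omega>) {..<d}"
    have "R\<^sup>2 \<le> (L2_set (X (i, j) \<omega>) {..<d})\<^sup>2" using w R by (intro power_mono) auto
    also have "\<dots> = (\<Sum>k<d. (X (i, j) \<omega> k)\<^sup>2)" by (simp add: L2_set_def sum_nonneg)
    finally show "\<omega> \<in> (\<Union>e\<in>pairs n. ?C e)" using w by (intro UN_I[of "(i, j)"]) auto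
  qed
  hence "prob {\<omega>\<in>space M. \<exists>e\<in>pairs n. L2_set (X e \<omega>) {..<d} > R} \<le> prob (\<Union>e\<in>pairs n. ?C e)"
    using Cm by (intro finite_measure_mono) auto
  also have "\<dots> \<le> (\<Sum>e\<in>pairs n. prob (?C e))"
    using Cm by (intro finite_measure_subadditive_finite) auto
  also have "\<dots> \<le> (\<Sum>e\<in>pairs n. exp (- (R\<^sup>2 / 4)) * sqrt 2 ^ d)"
  proof (rule sum_mono)
    fix e assume e: "e \<in> pairs n"
    have "1 / sqrt (1 - 2 * (1/4)) = sqrt (2::real)" by (simp add: real_sqrt_divide field_simps)
    thus "prob (?C e) \<le> exp (- (R\<^sup>2 / 4)) * sqrt 2 ^ d"
      using norm_square_tail[OF e, of "1/4" "{..<d}" "R\<^sup>2 / 4"] by simp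
  qed
  also have "\<dots> = real (card (pairs n)) * (exp (- (R\<^sup>2 / 4)) * sqrt 2 ^ d)" by simp
  also have "\<dots> \<le> (real n)\<^sup>2 * (exp (- (R\<^sup>2 / 4)) * sqrt 2 ^ d)"
    by (intro mult_right_mono card_pairs_le) simp
  finally show ?thesis .
qed

end

section \<open>Few dimensions: all directions behave alike\<close>

lemma eventually_edge_prob:
  assumes c: "c > 0"
  shows "\<forall>\<^sub>F n in sequentially. n \<ge> 3 \<and> 0 < edge_prob c n \<and> edge_prob c n < 1"
proof -
  have "\<forall>\<^sub>F n in sequentially. (0::real) < c * ln (real n) / real n" using c by real_asymp
  moreover have "\<forall>\<^sub>F n in sequentially. c * ln (real n) / real n < (1::real)" using c by real_asymp
  ultimately show ?thesis
    using eventually_ge_at_top[of "3::nat"] unfolding edge_prob_def by eventually_elim auto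
qed

lemma eventually_model:
  assumes c: "c > 0" and g: "gaussian_model c d M X"
  shows "\<forall>\<^sub>F n in sequentially. n \<ge> 3 \<and> d n \<ge> 1 \<and> gauss_array (M n) n (d n) (X n) \<and>
    gtail (threshold c n) = edge_prob c n"
  using eventually_edge_prob[OF c]
proof eventually_elim
  case (elim n)
  hence "d n \<ge> 1 \<and> prob_space (M n) \<and>
        prob_space.indep_vars (M n) (\<lambda>_. Rd (d n)) (X n) (pairs n) \<and>
        (\<forall>e\<in>pairs n. std_normal_vector (M n) (d n) (X n e))"
    using g unfolding gaussian_model_def by (meson le_trans one_le_numeral)
  thus ?case using elim gauss_arrayI[of "M n" "d n" "X n" n] gtail_threshold by auto
qed

text \<open>At \<open>sqrt (ln n)\<close> the tail is still of order
  \<open>1 / sqrt (n * ln n)\<close>, far more than the edge probability, so the threshold lies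
  higher. The upper bound compares \<open>edge_prob c n \<ge> 1 / n\<close> with the tail bound
  \<open>exp (- t\<^sup>2 / 2)\<close>.\<close>

lemma eventually_threshold:
  assumes c: "c > 0"
  shows "\<forall>\<^sub>F n in sequentially. 1 \<le> threshold c n \<and> sqrt (ln (real n)) \<le> threshold c n \<and> threshold c n \<le> sqrt (2 * ln (real n))"
proof -
  have "\<forall>\<^sub>F n::nat in sequentially. c * ln (real n) / real n < 1 / sqrt (2 * pi) * exp (- ln (real n) / 2) / (exp (3/2) * sqrt (ln (real n)))"
    using c by real_asymp
  moreover have "\<forall>\<^sub>F n in sequentially. 1 \<le> sqrt (ln (real n))" by real_asymp
  moreover have "\<forall>\<^sub>F n in sequentially. 1 \<le> c * ln (real n)" using c by real_asymp
  ultimately show ?thesis using eventually_edge_prob[OF c]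
  proof eventually_elim
    case (elim n)
    let ?t = "threshold c n" and ?u = "sqrt (ln (real n))"
    have p: "gtail ?t = edge_prob c n" using elim by (intro gtail_threshold) auto
    have u: "?u \<le> ?t"
    proof (rule ccontr)
      assume "\<not> ?u \<le> ?t"
      hence "gtail ?u \<le> edge_prob c n" unfolding p[symmetric] by (intro gtail_antimono) simp
      moreover have "std_normal_density ?u / (exp (3/2) * ?u) \<le> gtail ?u"
        using std_normal_density_le_gtail[OF elim(2)] elim(2) by (simp add: divide_le_eq mult_ac)
      moreover have "(sqrt (ln (real n)))\<^sup>2 = ln (real n)" using elim by simp
      ultimately show False using elim(1) unfolding edge_prob_def std_normal_density_def by simp
    qed
    have t: "?t \<ge> 1" using u elim(2) by linarith
    have n: "real n \<ge> 3" using elim by simp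
    have "1 / real n \<le> edge_prob c n" using elim n unfolding edge_prob_def by (intro divide_right_mono) auto
    also have "\<dots> \<le> exp (- ?t\<^sup>2 / 2)" unfolding p[symmetric] using t by (intro gtail_le_exp) simp
    finally have "ln (1 / real n) \<le> ln (exp (- ?t\<^sup>2 / 2))" using n by (subst ln_le_cancel_iff) auto
    hence "ln (1 / real n) \<le> - ?t\<^sup>2 / 2" by simp
    hence "?t\<^sup>2 \<le> 2 * ln (real n)" using n by (simp add: ln_div)
    hence "?t \<le> sqrt (2 * ln (real n))" by (rule real_le_rsqrt)
    thus ?case using t u by simp
  qed
qed

text \<open>A very fine net is affordable: norms up to \<open>n\<close> and mesh
  \<open>1 / n\<^sup>2\<close> shift the threshold by \<open>1 / n\<close>, at the price of an
  entropy of order \<open>d * ln n\<close>. This is dominated by the exponent, of order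
  \<open>n powr (1 - c - \<epsilon> / 2)\<close>, in the probability that a fixed direction is
  connected.\<close>

lemma disconnected_whp:
  assumes c: "0 < c" "c < 1" and g: "gaussian_model c d M X" and e: "0 < \<epsilon>"
    and O: "(\<lambda>n. real (d n)) \<in> O(\<lambda>n. real n powr (1 - c - \<epsilon>))"
  shows "whp M (\<lambda>n \<omega>. \<forall>s\<in>unit_sphere (d n). \<not> graph_connected (rand_graph c d X n \<omega> s))"
proof -
  note model = eventually_model[OF c(1) g]
  obtain K where K: "K > 0" "\<forall>\<^sub>F n in sequentially. norm (real (d n)) \<le> K * norm (real n powr (1 - c - \<epsilon>))"
    using landau_o.bigE[OF O] by blast
  hence dK: "\<forall>\<^sub>F n in sequentially. real (d n) \<le> K * real n powr (1 - c - \<epsilon>)" by simp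
  show ?thesis
  proof (cases "c + \<epsilon> \<le> 1")
    case False
    \<comment> \<open>Here the bound on the dimension tends to \<open>0\<close> although
      \<open>d n \<ge> 1\<close>, so the assumptions are contradictory.\<close>
    hence "\<forall>\<^sub>F n in sequentially. K * real n powr (1 - c - \<epsilon>) < 1" using K(1) by real_asymp
    with dK model have "\<forall>\<^sub>F n :: nat in sequentially. False" by eventually_elim auto
    thus ?thesis by simp
  next
    case True
    \<comment> \<open>The density is at most \<open>1\<close>, so lowering the threshold by
      \<open>1 / n\<close> adds at most \<open>1 / n\<close> to the edge probability;
      \<open>Q\<close> is the resulting bound.\<close>
    define Q where "Q n = (c * ln (real n) + 1) / real n" for n :: nat
    \<comment> \<open>\<open>m n * Q n\<close> tends to \<open>0\<close>, as
      \<open>prob_connected_le\<close> requires, while \<open>m n * n powr (- c)\<close> still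
      exceeds the entropy of the net by a power of \<open>n\<close>.\<close>
    define m where "m n = nat \<lfloor>real n powr (1 - \<epsilon> / 2)\<rfloor>" for n :: nat
    define f where "f n = (real n)\<^sup>2 * exp (- ((real n)\<^sup>2 / 4) + real n * ln 2) +
      2 * exp (K * real n powr (1 - c - \<epsilon>) * (ln 11 + 2 * ln (real n)) - (real n powr (1 - \<epsilon> / 2) - 1) / 2 * (real n powr (- c) * exp (- 2)))" for n :: nat
    have "(\<lambda>n::nat. (real n)\<^sup>2 * exp (- ((real n)\<^sup>2 / 4) + real n * ln 2)) \<longlonglongrightarrow> 0" by real_asymp
    moreover have "filterlim (\<lambda>n::nat. K * real n powr (1 - c - \<epsilon>) * (ln 11 + 2 * ln (real n)) - (real n powr (1 - \<epsilon>/2) - 1) / 2 * (real n powr (- c) * exp (- 2))) at_bot sequentially"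
      using c e True K(1) by real_asymp
    hence "(\<lambda>n. 2 * exp (K * real n powr (1 - c - \<epsilon>) * (ln 11 + 2 * ln (real n)) - (real n powr (1 - \<epsilon> / 2) - 1) / 2 * (real n powr (- c) * exp (- 2)))) \<longlonglongrightarrow> 2 * 0"
      by (intro tendsto_mult tendsto_const filterlim_compose[OF exp_at_bot])
    ultimately have f0: "f \<longlonglongrightarrow> 0" unfolding f_def using tendsto_add by fastforce
    have a1: "\<forall>\<^sub>F n::nat in sequentially. - (c * ln n) - 2 \<le> real n * (- ((c * ln n + 1)/n) - 2 * ((c * ln n + 1)/n)^2)"
      using c by real_asymp
    have a2: "\<forall>\<^sub>F n::nat in sequentially. (c * ln n + 1)/n \<le> 1/2" using c by real_asymp
    have a3: "\<forall>\<^sub>F n::nat in sequentially. real n powr (1 - \<epsilon> / 2) * ((c * ln n + 1)/n) \<le> 1/20" using c e by real_asymp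
    have a4: "\<forall>\<^sub>F n::nat in sequentially. K * real n powr (1 - c - \<epsilon>) \<le> real n" using c e K True by real_asymp
    show ?thesis
    proof (rule whpI[OF _ f0])
      show "\<forall>\<^sub>F n in sequentially. prob_space (M n) \<and>
        {\<omega>\<in>space (M n). \<forall>s\<in>unit_sphere (d n). \<not> graph_connected (rand_graph c d X n \<omega> s)} \<in> sets (M n) \<and>
        measure (M n) {\<omega>\<in>space (M n). \<not> (\<forall>s\<in>unit_sphere (d n). \<not> graph_connected (rand_graph c d X n \<omega> s))} \<le> f n"
        using model eventually_threshold[OF c(1)] a1 a2 a3 a4 dK
      proof eventually_elim
        case (elim n)
        then interpret gauss_array "M n" n "d n" "X n" by simp
        let ?t = "threshold c n" and ?r = "1 / (real n)\<^sup>2"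
        let ?q = "gtail (?t - real n * ?r)"
        let ?A = "{\<omega>\<in>space (M n). \<exists>s\<in>unit_sphere (d n). graph_connected (Gam n (d n) (\<lambda>e. X n e \<omega>) s ?t)}"
        have n: "n \<ge> 3" "real n \<ge> 3" and d: "d n \<ge> 1" using elim by auto
        have nr: "real n * ?r = 1 / real n" using n by (simp add: power2_eq_square)
        have r: "0 < ?r" "?r < 1"
        proof -
          have "1 < (real n)\<^sup>2" using n by (intro one_less_power) auto
          thus "0 < ?r" "?r < 1" using n by auto
        qed
        have am: "?A \<in> sets (M n)" using n measurable_X by (intro measurable_exists_connected) auto
        have qQ: "?q \<le> Q n"
        proof -
          have "?q - gtail ?t \<le> ?t - (?t - real n * ?r)" using r by (intro gtail_diff_le) simp
          thus ?thesis using elim nr by (simp add: Q_def edge_prob_def add_divide_distrib)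
        qed
        have Qh: "Q n \<le> 1/2" "0 \<le> Q n" using elim n c by (auto simp: Q_def)
        have mle: "real (m n) \<le> real n powr (1 - \<epsilon> / 2)" "real n powr (1 - \<epsilon> / 2) - 1 \<le> real (m n)"
          unfolding m_def using powr_ge_zero[of "real n" "1 - \<epsilon> / 2"] by linarith+
        have "real n powr (1 - \<epsilon> / 2) \<le> real n powr 1" using n e by (intro powr_mono) auto
        hence mn: "m n \<le> n" using mle n by simp
        have "real (m n) * ?q \<le> real n powr (1 - \<epsilon> / 2) * Q n"
          using mle qQ Qh by (intro mult_mono) auto
        also have "\<dots> \<le> 1/20" unfolding Q_def by (rule elim(5))
        finally have mq: "real (m n) * ?q \<le> 1/20" .
        have "1 / real n \<le> 1" using n by simp
        hence tr: "real n * ?r \<le> ?t" unfolding nr using elim(2) by linarith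
        \<comment> \<open>The factor \<open>exp (- 2)\<close> pays for the additional mean degree
          \<open>1\<close> in \<open>Q\<close> and for the second-order term of
          \<open>ln (1 - Q n)\<close>.\<close>
        have q01: "real n powr (- c) * exp (- 2) \<le> (1 - ?q) ^ (n - m n)"
        proof -
          have "real n powr (- c) * exp (- 2) = exp (- (c * ln (real n)) - 2)" using n by (simp add: powr_def exp_diff exp_minus field_simps)
          also have "\<dots> \<le> exp (real n * (- Q n - 2 * (Q n)\<^sup>2))" using elim by (simp add: Q_def)
          also have "\<dots> \<le> exp (real n * ln (1 - Q n))"
            using ln_one_minus_pos_lower_bound[of "Q n"] Qh by (simp add: mult_left_mono)
          also have "\<dots> = (1 - Q n) ^ n" using Qh by (simp add: exp_of_nat_mult)
          also have "\<dots> \<le> (1 - Q n) ^ (n - m n)" using Qh by (intro power_decreasing) auto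
          also have "\<dots> \<le> (1 - ?q) ^ (n - m n)" using Qh qQ by (intro power_mono) auto
          finally show ?thesis .
        qed
        have "prob ?A \<le> prob {\<omega>\<in>space (M n). \<exists>e\<in>pairs n. L2_set (X n e \<omega>) {..<d n} > real n} +
          (11 / ?r) ^ d n * (2 * exp (- (real (m n) / 2 * (1 - ?q) ^ (n - m n))))"
          by (rule prob_exists_connected_le) (use n d r tr mn mq in auto)
        also have "prob {\<omega>\<in>space (M n). \<exists>e\<in>pairs n. L2_set (X n e \<omega>) {..<d n} > real n} \<le> (real n)\<^sup>2 * (exp (- ((real n)\<^sup>2 / 4)) * sqrt 2 ^ d n)"
          by (rule prob_norm_gt_le) simp
        also have "\<dots> \<le> (real n)\<^sup>2 * (exp (- ((real n)\<^sup>2 / 4)) * exp (real n * ln 2))"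
        proof -
          have "d n \<le> n" using elim by (metis of_nat_le_iff order_trans)
          have "sqrt 2 ^ d n \<le> (2::real) ^ d n" by (intro power_mono real_le_lsqrt) auto
          also have "\<dots> \<le> 2 ^ n" using \<open>d n \<le> n\<close> by (intro power_increasing) auto
          also have "\<dots> = exp (real n * ln 2)" by (simp add: exp_of_nat_mult)
          finally show ?thesis by (intro mult_left_mono) auto
        qed
        also have "\<dots> = (real n)\<^sup>2 * exp (- ((real n)\<^sup>2 / 4) + real n * ln 2)" by (simp only: exp_add)
        also have "(11 / ?r) ^ d n * (2 * exp (- (real (m n) / 2 * (1 - ?q) ^ (n - m n)))) \<le>
          exp (K * real n powr (1 - c - \<epsilon>) * (ln 11 + 2 * ln (real n))) * (2 * exp (- ((real n powr (1 - \<epsilon> / 2) - 1) / 2 * (real n powr (- c) * exp (- 2)))))"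
        proof (rule mult_mono)
          have "(11 / ?r) ^ d n = exp (real (d n) * (ln 11 + 2 * ln (real n)))"
          proof -
            have "11 / ?r = exp (ln 11 + 2 * ln (real n))" using n by (simp add: exp_add exp_double power2_eq_square mult_exp_exp[symmetric])
            thus ?thesis by (simp only: exp_of_nat_mult)
          qed
          also have "\<dots> \<le> exp (K * real n powr (1 - c - \<epsilon>) * (ln 11 + 2 * ln (real n)))"
            using elim n by (simp only: exp_le_cancel_iff) (intro mult_right_mono add_nonneg_nonneg, auto)
          finally show "(11 / ?r) ^ d n \<le> exp (K * real n powr (1 - c - \<epsilon>) * (ln 11 + 2 * ln (real n)))" .
          have "(real n powr (1 - \<epsilon> / 2) - 1) / 2 * (real n powr (- c) * exp (- 2)) \<le> real (m n) / 2 * (real n powr (- c) * exp (- 2))"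
            using mle by (intro mult_right_mono) auto
          also have "\<dots> \<le> real (m n) / 2 * (1 - ?q) ^ (n - m n)" using q01 by (intro mult_left_mono) auto
          finally show "2 * exp (- (real (m n) / 2 * (1 - ?q) ^ (n - m n))) \<le> 2 * exp (- ((real n powr (1 - \<epsilon> / 2) - 1) / 2 * (real n powr (- c) * exp (- 2))))"
            by simp
        qed auto
        also have "\<dots> = 2 * exp (K * real n powr (1 - c - \<epsilon>) * (ln 11 + 2 * ln (real n)) - (real n powr (1 - \<epsilon> / 2) - 1) / 2 * (real n powr (- c) * exp (- 2)))"
          by (simp only: diff_conv_add_uminus exp_add mult_ac)
        finally have "prob ?A \<le> f n" unfolding f_def by simp
        moreover have "{\<omega>\<in>space (M n). \<forall>s\<in>unit_sphere (d n). \<not> graph_connected (Gam n (d n) (\<lambda>e. X n e \<omega>) s ?t)} = space (M n) - ?A" by auto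
        ultimately show ?case using am prob_space_axioms unfolding rand_graph_def by (simp add: sets.compl_sets)
      qed
    qed
  qed
qed

text \<open>The net has \<open>n powr (a + o(1))\<close> points, and a net direction fails with
  probability about \<open>n powr (- b)\<close>, where \<open>a < b < c - 1\<close>. The gap between
  \<open>b\<close> and \<open>c - 1\<close> absorbs the raised threshold and the parameter
  \<open>\<kappa>\<close> of the cut estimate.\<close>

lemma connected_whp:
  assumes c: "c > 1" and g: "gaussian_model c d M X" and e: "0 < \<epsilon>"
    and D: "\<forall>\<^sub>F n in sequentially. real (d n) \<le> (1 - \<epsilon>) * (c - 1) * ln (real n) / ln (ln (real n))"
  shows "whp M (\<lambda>n \<omega>. \<forall>s\<in>unit_sphere (d n). graph_connected (rand_graph c d X n \<omega> s))"
proof -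
  have c0: "c > 0" using c by simp
  note model = eventually_model[OF c0 g]
  show ?thesis
  proof (cases "\<epsilon> < 1")
    case False
    \<comment> \<open>For \<open>\<epsilon> \<ge> 1\<close> the upper bound on the dimension is not
      positive, which contradicts \<open>d n \<ge> 1\<close>.\<close>
    have "\<forall>\<^sub>F n::nat in sequentially. 0 < ln (real n) / ln (ln (real n))" by real_asymp
    with D model have "\<forall>\<^sub>F n :: nat in sequentially. False"
    proof eventually_elim
      case (elim n)
      have "(1 - \<epsilon>) * (c - 1) * (ln (real n) / ln (ln (real n))) \<le> 0"
        using False c elim by (intro mult_nonpos_nonneg) (auto simp: mult_nonpos_nonneg)
      thus ?case using elim by simp
    qed
    thus ?thesis by simp
  next
    case True
    define a where "a = (1 - \<epsilon>) * (c - 1)"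
    define b where "b = (1 - \<epsilon> / 2) * (c - 1)"
    \<comment> \<open>\<open>c'\<close> lies halfway between \<open>1 + b\<close> and
      \<open>c\<close>; it replaces \<open>c\<close> after the threshold is raised.
      \<open>\<kappa>\<close> is then chosen so that \<open>(1 - \<kappa>) * c' = 1 + b\<close>,
      which turns the expected number of isolated vertices into \<open>n powr (- b)\<close>.\<close>
    define c' where "c' = (c + 1 + b) / 2"
    define \<kappa> where "\<kappa> = 1 - (1 + b) / c'"
    have a: "0 < a" "a < b" using c e True by (auto simp: a_def b_def)
    have b: "(c - 1) / 2 < b" "b < c - 1"
    proof -
      have "1/2 * (c - 1) < (1 - \<epsilon> / 2) * (c - 1)" using c e True by (intro mult_strict_right_mono) auto
      thus "(c - 1) / 2 < b" by (simp add: b_def)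
      have "(1 - \<epsilon> / 2) * (c - 1) < 1 * (c - 1)" using c e by (intro mult_strict_right_mono) auto
      thus "b < c - 1" by (simp add: b_def)
    qed
    have c': "1 + b < c'" "c' < c" "0 < c'" using b a by (auto simp: c'_def)
    have \<kappa>: "0 < \<kappa>" "\<kappa> \<le> 1/2" "(1 - \<kappa>) * c' = 1 + b"
      using c' b by (auto simp: \<kappa>_def field_simps)
    \<comment> \<open>The factor \<open>ln (ln n)\<close> makes the mesh small compared with
      \<open>1 / ln n\<close>, yet contributes only \<open>n powr o(1)\<close> to the size of the
      net.\<close>
    define r where "r n = 1 / (ln (real n) * ln (ln (real n)))" for n :: nat
    define f where "f n = (real n)\<^sup>2 * exp (- (4 * ln (real n)) + a * ln (real n) / ln (ln (real n)) * ln 2) +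
      exp (a * ln (real n) / ln (ln (real n)) * ln (11 * (ln (real n) * ln (ln (real n))))) *
      ((exp (real n powr (- b)) - 1) + exp (real n * ln 2 - \<kappa> * c' * real n * ln (real n) / 2))" for n :: nat
    have f0: "f \<longlonglongrightarrow> 0"
    proof -
      have "(\<lambda>n::nat. (real n)\<^sup>2 * exp (- (4 * ln (real n)) + a * ln (real n) / ln (ln (real n)) * ln 2)) \<longlonglongrightarrow> 0"
        using a by real_asymp
      moreover have "(\<lambda>n::nat. exp (a * ln (real n) / ln (ln (real n)) * ln (11 * (ln (real n) * ln (ln (real n))))) *
        ((exp (real n powr (- b)) - 1) + exp (real n * ln 2 - \<kappa> * c' * real n * ln (real n) / 2))) \<longlonglongrightarrow> 0"
        using a c' \<kappa> by real_asymp
      ultimately show ?thesis unfolding f_def using tendsto_add by fastforce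
    qed
    have a1: "\<forall>\<^sub>F n::nat in sequentially. 0 < 1 / (ln (real n) * ln (ln (real n)))" by real_asymp
    have a2: "\<forall>\<^sub>F n::nat in sequentially. 1 / (ln (real n) * ln (ln (real n))) \<le> 1/2" by real_asymp
    have a3: "\<forall>\<^sub>F n::nat in sequentially. c' * ln (real n) / real n \<le> c * ln (real n) / real n * (1 - 24 * exp (3/2) * (ln (real n) * (1 / (ln (real n) * ln (ln (real n))))))"
      using c' c by real_asymp
    show ?thesis
    proof (rule whpI[OF _ f0])
      show "\<forall>\<^sub>F n in sequentially. prob_space (M n) \<and>
        {\<omega>\<in>space (M n). \<forall>s\<in>unit_sphere (d n). graph_connected (rand_graph c d X n \<omega> s)} \<in> sets (M n) \<and>
        measure (M n) {\<omega>\<in>space (M n). \<not> (\<forall>s\<in>unit_sphere (d n). graph_connected (rand_graph c d X n \<omega> s))} \<le> f n"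
        using model eventually_threshold[OF c0] a1 a2 a3 D
      proof eventually_elim
        case (elim n)
        then interpret gauss_array "M n" n "d n" "X n" by simp
        \<comment> \<open>\<open>?R\<close> gives each norm a failure probability of
          \<open>n powr (- 4 + o(1))\<close>, enough for at most \<open>n\<^sup>2\<close> edges,
          while \<open>?R * ?r * ?t\<close> tends to \<open>0\<close>.\<close>
        let ?t = "threshold c n" and ?r = "r n" and ?R = "4 * sqrt (ln (real n))"
        let ?\<tau> = "(?t + ?R * ?r) / (1 - ?r)"
        let ?q = "gtail ?\<tau>"
        let ?A = "{\<omega>\<in>space (M n). \<exists>s\<in>unit_sphere (d n). \<not> graph_connected (Gam n (d n) (\<lambda>e. X n e \<omega>) s ?t)}"
        have n: "n \<ge> 3" "real n \<ge> 3" and d: "d n \<ge> 1" using elim by auto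
        have ln0: "ln (real n) > 0" using n by simp
        have r: "0 < ?r" "?r \<le> 1/2" using elim by (auto simp: r_def)
        have am: "?A \<in> sets (M n)" using n measurable_X by (intro measurable_exists_disconnected) auto
        have t2: "?t \<le> 2 * sqrt (ln (real n))" "1 \<le> ?t"
        proof -
          have "sqrt (2 * ln (real n)) \<le> 2 * sqrt (ln (real n))"
            using ln0 by (intro real_le_lsqrt) (auto simp: power_mult_distrib)
          thus "?t \<le> 2 * sqrt (ln (real n))" "1 \<le> ?t" using elim by auto
        qed
        have R0: "0 \<le> ?R" using ln0 by simp
        have \<tau>t: "?\<tau> - ?t = ?r * (?R + ?t) / (1 - ?r)" using r by (simp add: field_simps)
        have "?\<tau> - ?t \<le> ?r * (?R + ?t) / (1/2)" unfolding \<tau>t using r R0 t2 by (intro divide_left_mono) auto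
        also have "\<dots> \<le> ?r * (6 * sqrt (ln (real n))) / (1/2)" using r t2 by (intro divide_right_mono mult_left_mono) auto
        finally have \<tau>1: "?\<tau> - ?t \<le> 12 * ?r * sqrt (ln (real n))" by simp
        have \<tau>0: "?t \<le> ?\<tau>" using \<tau>t r R0 t2 by (simp add: field_simps)
        \<comment> \<open>By the Mills-type bound the relative loss of the tail is at most of the
          order of the shift times \<open>?t\<close>, here of the order
          \<open>ln n * ?r\<close>.\<close>
        have "edge_prob c n - ?q \<le> (?\<tau> - ?t) * std_normal_density ?t"
          using gtail_diff_le_density[of ?t ?\<tau>] \<tau>0 t2 elim by simp
        also have "\<dots> \<le> (12 * ?r * sqrt (ln (real n))) * (exp (3/2) * ?t * edge_prob c n)"
          using \<tau>1 \<tau>0 std_normal_density_le_gtail[OF t2(2)] elim by (intro mult_mono) auto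
        also have "\<dots> \<le> (12 * ?r * sqrt (ln (real n))) * (exp (3/2) * (2 * sqrt (ln (real n))) * edge_prob c n)"
          using t2 r ln0 c by (intro mult_left_mono mult_right_mono) (auto simp: edge_prob_def)
        also have "\<dots> = 24 * exp (3/2) * (ln (real n) * ?r) * edge_prob c n"
          using ln0 by (simp add: mult_ac)
        finally have "edge_prob c n * (1 - 24 * exp (3/2) * (ln (real n) * ?r)) \<le> ?q" by (simp add: algebra_simps)
        hence q: "c' * ln (real n) / real n \<le> ?q" using elim by (simp add: edge_prob_def r_def)
        have "prob ?A \<le> prob {\<omega>\<in>space (M n). \<exists>e\<in>pairs n. L2_set (X n e \<omega>) {..<d n} > ?R} +
          (11 / ?r) ^ d n * ((exp (real n * exp (- (?q * (1 - \<kappa>) * real n))) - 1) + 2 ^ n * exp (- (?q * \<kappa> * (real n)\<^sup>2 / 2)))"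
          by (rule prob_exists_disconnected_le) (use n d r t2 R0 \<kappa> in auto)
        also have "prob {\<omega>\<in>space (M n). \<exists>e\<in>pairs n. L2_set (X n e \<omega>) {..<d n} > ?R} \<le> (real n)\<^sup>2 * (exp (- (?R\<^sup>2 / 4)) * sqrt 2 ^ d n)"
          by (rule prob_norm_gt_le[OF R0])
        also have "\<dots> \<le> (real n)\<^sup>2 * (exp (- (4 * ln (real n))) * exp (a * ln (real n) / ln (ln (real n)) * ln 2))"
        proof -
          have "sqrt 2 ^ d n \<le> (2::real) ^ d n" by (intro power_mono real_le_lsqrt) auto
          also have "\<dots> = exp (real (d n) * ln 2)" by (simp add: exp_of_nat_mult)
          also have "\<dots> \<le> exp (a * ln (real n) / ln (ln (real n)) * ln 2)"
            unfolding exp_le_cancel_iff a_def by (intro mult_right_mono elim(6)) simp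
          finally show ?thesis using ln0 by (intro mult_left_mono mult_mono) (auto simp: power_mult_distrib)
        qed
        also have "\<dots> = (real n)\<^sup>2 * exp (- (4 * ln (real n)) + a * ln (real n) / ln (ln (real n)) * ln 2)" by (simp only: exp_add)
        also have "(11 / ?r) ^ d n * ((exp (real n * exp (- (?q * (1 - \<kappa>) * real n))) - 1) + 2 ^ n * exp (- (?q * \<kappa> * (real n)\<^sup>2 / 2)))
          \<le> exp (a * ln (real n) / ln (ln (real n)) * ln (11 * (ln (real n) * ln (ln (real n))))) *
      ((exp (real n powr (- b)) - 1) + exp (real n * ln 2 - \<kappa> * c' * real n * ln (real n) / 2))"
        proof (rule mult_mono)
          have r11: "11 / ?r = 11 * (ln (real n) * ln (ln (real n)))" by (simp add: r_def)
          have "11 / ?r \<ge> 1" using r by (simp add: field_simps)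
          have "(11 / ?r) ^ d n = exp (ln (11 / ?r)) ^ d n" using r by (subst exp_ln) auto
          also have "\<dots> = exp (real (d n) * ln (11 / ?r))" by (rule exp_of_nat_mult[symmetric])
          also have "\<dots> \<le> exp (a * ln (real n) / ln (ln (real n)) * ln (11 / ?r))"
            using elim \<open>11 / ?r \<ge> 1\<close> by (simp only: exp_le_cancel_iff) (intro mult_right_mono ln_ge_zero, auto simp: a_def)
          finally show "(11 / ?r) ^ d n \<le> exp (a * ln (real n) / ln (ln (real n)) * ln (11 * (ln (real n) * ln (ln (real n)))))"
            unfolding r11 .
          have "c' * ln (real n) / real n * (1 - \<kappa>) * real n \<le> ?q * (1 - \<kappa>) * real n"
            using \<kappa> by (intro mult_right_mono q) auto
          hence "exp (- (?q * (1 - \<kappa>) * real n)) \<le> exp (- (c' * ln (real n) / real n * (1 - \<kappa>) * real n))"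
            by (simp only: exp_le_cancel_iff neg_le_iff_le)
          hence "real n * exp (- (?q * (1 - \<kappa>) * real n)) \<le> real n * exp (- (c' * ln (real n) / real n * (1 - \<kappa>) * real n))"
            by (rule mult_left_mono) simp
          also have "\<dots> = real n * exp (- ((1 - \<kappa>) * c' * ln (real n)))" using n by simp
          also have "\<dots> = real n * exp (- ((1 + b) * ln (real n)))" unfolding \<kappa>(3) ..
          also have "\<dots> = real n powr (- b)"
          proof -
            have "real n * exp (- ((1 + b) * ln (real n))) = exp (ln (real n)) * exp (- ((1 + b) * ln (real n)))" using n by simp
            also have "\<dots> = exp (- b * ln (real n))" by (simp only: exp_add[symmetric]) (simp add: algebra_simps)
            finally show ?thesis using n by (simp add: powr_def)
          qed
          finally have 1: "exp (real n * exp (- (?q * (1 - \<kappa>) * real n))) - 1 \<le> exp (real n powr (- b)) - 1" by simp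
          have "\<kappa> * c' * real n * ln (real n) / 2 = c' * ln (real n) / real n * \<kappa> * (real n)\<^sup>2 / 2" using n by (simp add: power2_eq_square)
          also have "\<dots> \<le> ?q * \<kappa> * (real n)\<^sup>2 / 2" using q \<kappa> by (intro divide_right_mono mult_right_mono) auto
          finally have "real n * ln 2 + - (?q * \<kappa> * (real n)\<^sup>2 / 2) \<le> real n * ln 2 - \<kappa> * c' * real n * ln (real n) / 2" by simp
          hence "exp (real n * ln 2) * exp (- (?q * \<kappa> * (real n)\<^sup>2 / 2)) \<le> exp (real n * ln 2 - \<kappa> * c' * real n * ln (real n) / 2)"
            by (simp only: exp_add[symmetric] exp_le_cancel_iff)
          hence "2 ^ n * exp (- (?q * \<kappa> * (real n)\<^sup>2 / 2)) \<le> exp (real n * ln 2 - \<kappa> * c' * real n * ln (real n) / 2)"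
            by (simp add: exp_of_nat_mult)
          with 1 show "(exp (real n * exp (- (?q * (1 - \<kappa>) * real n))) - 1) + 2 ^ n * exp (- (?q * \<kappa> * (real n)\<^sup>2 / 2))
            \<le> (exp (real n powr (- b)) - 1) + exp (real n * ln 2 - \<kappa> * c' * real n * ln (real n) / 2)" by (rule add_mono)
        qed (auto intro!: add_nonneg_nonneg)
        finally have "prob ?A \<le> f n" unfolding f_def by simp
        moreover have "{\<omega>\<in>space (M n). \<forall>s\<in>unit_sphere (d n). graph_connected (Gam n (d n) (\<lambda>e. X n e \<omega>) s ?t)} = space (M n) - ?A" by auto
        ultimately show ?case using am prob_space_axioms unfolding rand_graph_def by (simp add: sets.compl_sets)
      qed
    qed
  qed
qed

section \<open>A disconnected direction\<close>

text \<open>If no event occurs, then the number of occurring events differs from its mean by exactly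
  \<open>\<mu>\<close>; so \<open>\<mu>\<^sup>2\<close> times this probability is at most the
  variance, which is at most \<open>\<beta> * \<mu>\<^sup>2\<close> by \<open>S\<close>.\<close>

lemma (in prob_space) second_moment_method:
  assumes I: "finite I" and E: "\<And>i. i \<in> I \<Longrightarrow> E i \<in> events"
    and \<mu>: "\<mu> = (\<Sum>i\<in>I. prob (E i))" "\<mu> > 0"
    and S: "(\<Sum>i\<in>I. \<Sum>j\<in>I. prob (E i \<inter> E j)) \<le> (1 + \<beta>) * \<mu>\<^sup>2"
  shows "prob {\<omega>\<in>space M. \<forall>i\<in>I. \<omega> \<notin> E i} \<le> \<beta>"
proof -
  let ?W = "\<lambda>\<omega>. \<Sum>i\<in>I. indicat_real (E i) \<omega>"
  let ?Z = "{\<omega>\<in>space M. \<forall>i\<in>I. \<omega> \<notin> E i}"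
  have "?Z = space M - (\<Union>i\<in>I. E i)" by auto
  moreover have "(\<Union>i\<in>I. E i) \<in> events" using E by (intro sets.finite_UN I)
  ultimately have Z: "?Z \<in> events" by (simp add: sets.compl_sets)
  have int2: "integrable M (indicat_real (E i \<inter> E j))" if "i \<in> I" "j \<in> I" for i j
    using E[OF that(1)] E[OF that(2)] by (intro integrable_real_indicator) (auto simp: emeasure_eq_measure)
  have int1: "integrable M (indicat_real (E i))" if "i \<in> I" for i using int2[OF that that] by simp
  have sq: "(?W \<omega> - \<mu>)\<^sup>2 = (\<Sum>i\<in>I. \<Sum>j\<in>I. indicat_real (E i \<inter> E j) \<omega>) - 2 * \<mu> * ?W \<omega> + \<mu>\<^sup>2" for \<omega>
  proof -
    have "?W \<omega> * ?W \<omega> = (\<Sum>i\<in>I. \<Sum>j\<in>I. indicat_real (E i \<inter> E j) \<omega>)"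
      by (simp only: sum_product indicator_inter_arith)
    moreover have "(w - \<mu>)\<^sup>2 = w * w - 2 * \<mu> * w + \<mu>\<^sup>2" for w by (simp add: power2_eq_square algebra_simps)
    ultimately show ?thesis by simp
  qed
  have "\<mu>\<^sup>2 * prob ?Z = expectation (\<lambda>\<omega>. \<mu>\<^sup>2 * indicat_real ?Z \<omega>)" using Z by simp
  also have "\<dots> \<le> expectation (\<lambda>\<omega>. (?W \<omega> - \<mu>)\<^sup>2)"
  proof (rule integral_mono)
    show "integrable M (\<lambda>\<omega>. \<mu>\<^sup>2 * indicat_real ?Z \<omega>)" using Z by (intro integrable_mult_right integrable_real_indicator) (auto simp: emeasure_eq_measure)
    show "integrable M (\<lambda>\<omega>. (?W \<omega> - \<mu>)\<^sup>2)" unfolding sq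
      by (intro Bochner_Integration.integrable_add Bochner_Integration.integrable_diff Bochner_Integration.integrable_sum integrable_mult_right integrable_const int1 int2)
    fix \<omega> show "\<mu>\<^sup>2 * indicat_real ?Z \<omega> \<le> (?W \<omega> - \<mu>)\<^sup>2" by (auto split: split_indicator)
  qed
  also have "\<dots> = (\<Sum>i\<in>I. \<Sum>j\<in>I. prob (E i \<inter> E j)) - 2 * \<mu> * \<mu> + \<mu>\<^sup>2"
  proof -
    have e1: "expectation ?W = \<mu>" using E int1 by (simp add: \<mu>(1))
    have e2: "expectation (\<lambda>\<omega>. \<Sum>i\<in>I. \<Sum>j\<in>I. indicat_real (E i \<inter> E j) \<omega>) = (\<Sum>i\<in>I. \<Sum>j\<in>I. prob (E i \<inter> E j))"
    proof -
      have "expectation (\<lambda>\<omega>. \<Sum>i\<in>I. \<Sum>j\<in>I. indicat_real (E i \<inter> E j) \<omega>) = (\<Sum>i\<in>I. expectation (\<lambda>\<omega>. \<Sum>j\<in>I. indicat_real (E i \<inter> E j) \<omega>))"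
        by (intro Bochner_Integration.integral_sum Bochner_Integration.integrable_sum int2)
      also have "\<dots> = (\<Sum>i\<in>I. \<Sum>j\<in>I. expectation (indicat_real (E i \<inter> E j)))"
        by (intro sum.cong refl Bochner_Integration.integral_sum int2)
      also have "\<dots> = (\<Sum>i\<in>I. \<Sum>j\<in>I. prob (E i \<inter> E j))"
        using E by (intro sum.cong refl) (simp add: sets.Int)
      finally show ?thesis .
    qed
    have "integrable M ?W" by (intro Bochner_Integration.integrable_sum int1)
    moreover have "integrable M (\<lambda>\<omega>. \<Sum>i\<in>I. \<Sum>j\<in>I. indicat_real (E i \<inter> E j) \<omega>)"
      by (intro Bochner_Integration.integrable_sum int2)
    ultimately have iW: "integrable M ?W" "integrable M (\<lambda>\<omega>. \<Sum>i\<in>I. \<Sum>j\<in>I. indicat_real (E i \<inter> E j) \<omega>)" .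
    have "expectation (\<lambda>\<omega>. (?W \<omega> - \<mu>)\<^sup>2) = expectation (\<lambda>\<omega>. (\<Sum>i\<in>I. \<Sum>j\<in>I. indicat_real (E i \<inter> E j) \<omega>) - 2 * \<mu> * ?W \<omega>) + expectation (\<lambda>\<omega>. \<mu>\<^sup>2)"
      unfolding sq by (intro Bochner_Integration.integral_add Bochner_Integration.integrable_diff integrable_mult_right integrable_const iW)
    also have "expectation (\<lambda>\<omega>. (\<Sum>i\<in>I. \<Sum>j\<in>I. indicat_real (E i \<inter> E j) \<omega>) - 2 * \<mu> * ?W \<omega>) = expectation (\<lambda>\<omega>. \<Sum>i\<in>I. \<Sum>j\<in>I. indicat_real (E i \<inter> E j) \<omega>) - expectation (\<lambda>\<omega>. 2 * \<mu> * ?W \<omega>)"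
      by (intro Bochner_Integration.integral_diff integrable_mult_right iW)
    also have "expectation (\<lambda>\<omega>. 2 * \<mu> * ?W \<omega>) = 2 * \<mu> * \<mu>" unfolding e1[symmetric] by (rule integral_mult_right_zero)
    finally show ?thesis unfolding e2 by (simp add: prob_space)
  qed
  also have "\<dots> \<le> \<beta> * \<mu>\<^sup>2" using S by (simp add: power2_eq_square algebra_simps)
  finally show ?thesis using \<mu>(2) by (simp add: mult.commute)
qed

section \<open>The second moment of isolated vertices over finitely many directions\<close>

context gauss_array
begin

lemma prob_all_inner2:
  assumes J: "J \<subseteq> pairs n" and B: "B \<in> sets (borel \<Otimes>\<^sub>M borel)"
  shows "prob {\<omega>\<in>space M. \<forall>e\<in>J. (inner_prod d (X e \<omega>) (u e), inner_prod d (X e \<omega>) (v e)) \<in> B}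
    = (\<Prod>e\<in>J. prob {\<omega>\<in>space M. (inner_prod d (X e \<omega>) (u e), inner_prod d (X e \<omega>) (v e)) \<in> B})"
proof (cases "J = {}")
  case True thus ?thesis by (simp add: prob_space)
next
  case False
  have fJ: "finite J" using J by (rule finite_subset) simp
  let ?Z = "\<lambda>e \<omega>. (inner_prod d (X e \<omega>) (u e), inner_prod d (X e \<omega>) (v e))"
  have "prob (\<Inter>e\<in>J. ?Z e -` B \<inter> space M) = (\<Prod>e\<in>J. prob (?Z e -` B \<inter> space M))"
    by (rule indep_varsD[OF indep_inner2 False fJ J B])
  moreover have "(\<Inter>e\<in>J. ?Z e -` B \<inter> space M) = {\<omega>\<in>space M. \<forall>e\<in>J. ?Z e \<omega> \<in> B}" using False by auto
  moreover have "?Z e -` B \<inter> space M = {\<omega>\<in>space M. ?Z e \<omega> \<in> B}" for e by auto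
  ultimately show ?thesis by simp
qed

lemma measurable_all_less:
  assumes J: "J \<subseteq> pairs n"
  shows "{\<omega>\<in>space M. \<forall>e\<in>J. inner_prod d (X e \<omega>) (u e) < t} \<in> events"
proof -
  have "finite J" using J by (rule finite_subset) simp
  hence "Measurable.pred M (\<lambda>\<omega>. \<forall>e\<in>J. inner_prod d (X e \<omega>) (u e) < t)"
    using J by (intro pred_intros_finite borel_measurable_pred_less measurable_inner borel_measurable_const) auto
  thus ?thesis by (simp add: pred_def)
qed

lemma prob_all_less:
  assumes J: "J \<subseteq> pairs n" and u: "\<And>e. e \<in> J \<Longrightarrow> (\<Sum>k<d. (u e k)\<^sup>2) = 1"
  shows "prob {\<omega>\<in>space M. \<forall>e\<in>J. inner_prod d (X e \<omega>) (u e) < t} = (1 - gtail t) ^ card J"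
proof -
  have "{..<t} \<times> UNIV \<in> sets (borel \<Otimes>\<^sub>M (borel :: real measure))" by (intro pair_measureI) auto
  from prob_all_inner2[OF J this, of u u]
  have "prob {\<omega>\<in>space M. \<forall>e\<in>J. inner_prod d (X e \<omega>) (u e) < t} = (\<Prod>e\<in>J. prob {\<omega>\<in>space M. inner_prod d (X e \<omega>) (u e) < t})"
    by simp
  also have "\<dots> = (\<Prod>e\<in>J. 1 - gtail t)"
    using J u by (intro prod.cong refl prob_std_normal_less inner_std_normal) auto
  finally show ?thesis by simp
qed

text \<open>If both inner products reach \<open>t\<close>, then the one with \<open>u + v\<close>
  reaches \<open>2 * t\<close>, and by the parallelogram law \<open>u + v\<close> has squared norm
  only \<open>4 - D\<close>. So a standard normal variable exceeds
  \<open>2 * t / sqrt (4 - D)\<close>.\<close>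

lemma prob_both_ge_le:
  assumes e: "e \<in> pairs n" and t: "0 \<le> t" and u: "(\<Sum>k<d. (u k)\<^sup>2) = 1" and v: "(\<Sum>k<d. (v k)\<^sup>2) = 1"
    and uv: "(\<Sum>k<d. (u k - v k)\<^sup>2) = D" "D < 4"
  shows "prob {\<omega>\<in>space M. inner_prod d (X e \<omega>) u \<ge> t \<and> inner_prod d (X e \<omega>) v \<ge> t} \<le> exp (- (t\<^sup>2 / 2 * (1 + D / 4)))"
proof -
  let ?s = "\<lambda>k. u k + v k"
  have "(\<Sum>k<d. (u k + v k)\<^sup>2) + (\<Sum>k<d. (u k - v k)\<^sup>2) = (\<Sum>k<d. 2 * (u k)\<^sup>2 + 2 * (v k)\<^sup>2)"
    unfolding sum.distrib[symmetric] by (intro sum.cong refl) (simp add: power2_eq_square algebra_simps)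
  also have "\<dots> = 4" using u v by (simp add: sum.distrib sum_distrib_left[symmetric])
  finally have N: "(\<Sum>k<d. (?s k)\<^sup>2) = 4 - D" using uv by simp
  have D0: "0 \<le> D" unfolding uv(1)[symmetric] by (intro sum_nonneg) auto
  let ?N = "sqrt (4 - D)"
  let ?u = "\<lambda>k. (1 / ?N) * ?s k"
  have "(\<Sum>k<d. (?u k)\<^sup>2) = (1 / ?N)\<^sup>2 * (4 - D)" unfolding power_mult_distrib sum_distrib_left[symmetric] N ..
  also have "\<dots> = 1" using uv(2) by (simp add: power_divide)
  finally have un: "(\<Sum>k<d. (?u k)\<^sup>2) = 1" .
  have "prob {\<omega>\<in>space M. inner_prod d (X e \<omega>) u \<ge> t \<and> inner_prod d (X e \<omega>) v \<ge> t} \<le>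
    prob {\<omega>\<in>space M. inner_prod d (X e \<omega>) ?u \<ge> 2 * t / ?N}"
  proof (rule finite_measure_mono)
    show "{\<omega>\<in>space M. inner_prod d (X e \<omega>) ?u \<ge> 2 * t / ?N} \<in> events"
      using measurable_inner[OF e, of ?u] by measurable
    show "{\<omega>\<in>space M. inner_prod d (X e \<omega>) u \<ge> t \<and> inner_prod d (X e \<omega>) v \<ge> t} \<subseteq> {\<omega>\<in>space M. inner_prod d (X e \<omega>) ?u \<ge> 2 * t / ?N}"
      unfolding inner_prod_scale inner_prod_add using uv(2) by (auto intro!: divide_right_mono)
  qed
  also have "\<dots> = gtail (2 * t / ?N)" by (rule prob_std_normal_ge[OF inner_std_normal[OF e un]])
  also have "\<dots> \<le> exp (- (2 * t / ?N)\<^sup>2 / 2)" using t uv(2) by (intro gtail_le_exp) auto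
  also have "\<dots> \<le> exp (- (t\<^sup>2 / 2 * (1 + D / 4)))"
  proof -
    have "1 + D / 4 \<le> 4 / (4 - D)" using D0 uv(2) by (simp add: field_simps)
    hence "t\<^sup>2 / 2 * (1 + D / 4) \<le> t\<^sup>2 / 2 * (4 / (4 - D))" by (intro mult_left_mono) auto
    also have "\<dots> = (2 * t)\<^sup>2 / (4 - D) / 2" using uv(2) by (simp add: power_mult_distrib field_simps)
    also have "\<dots> = (2 * t / ?N)\<^sup>2 / 2" using uv(2) by (simp add: power_divide)
    finally show ?thesis by simp
  qed
  finally show ?thesis .
qed

text \<open>Each term of the bound comes from one kind of pair of isolation events. Different
  vertices share a single edge, which costs \<open>1 / (1 - p)\<close>. For the same vertex and far
  directions the events are nearly independent, and fixing the vertex leaves a fraction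
  \<open>1 / n\<close> of the pairs. For near directions the joint probability is bounded by that of
  one event, and \<open>V\<close> counts them.\<close>

lemma prob_all_connected_le:
  assumes n: "n \<ge> 2" and F: "finite F" "F \<noteq> {}" "F \<subseteq> unit_sphere d" and t: "gtail t \<le> 1 / 2"
    and V: "\<And>f. f \<in> F \<Longrightarrow> real (card {f'\<in>F. \<not> far f f'}) \<le> V"
    and p2: "\<And>f f' e. f \<in> F \<Longrightarrow> f' \<in> F \<Longrightarrow> far f f' \<Longrightarrow> e \<in> pairs n \<Longrightarrow>
      prob {\<omega>\<in>space M. inner_prod d (X e \<omega>) f \<ge> t \<and> inner_prod d (X e \<omega>) f' \<ge> t} \<le> p2"
    and p20: "0 \<le> p2"
  defines "p \<equiv> gtail t"
  shows "prob {\<omega>\<in>space M. \<forall>s\<in>unit_sphere d. graph_connected (Gam n d (\<lambda>e. X e \<omega>) s t)} \<le>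
    1 / (1 - p) - 1 + exp (4 * p2 * real n) / real n + V / (real n * real (card F) * (1 - p) ^ (n - 1))"
proof -
  let ?I = "{1..n} \<times> F"
  define a where "a = (1 - p) ^ (n - 1)"
  define E where "E = (\<lambda>(i, f). {\<omega>\<in>space M. \<forall>e\<in>cut_set n {i}. inner_prod d (X e \<omega>) f < t})"
  have p: "0 \<le> p" "p \<le> 1/2" using t by (auto simp: p_def)
  have un: "(\<Sum>k<d. (f k)\<^sup>2) = 1" if "f \<in> F" for f using that F by (auto simp: unit_sphere_iff)
  have cst: "card (cut_set n {i}) = n - 1" if "i \<in> {1..n}" for i
    using card_cut_set[of "{i}" n] that by simp
  have Em: "E x \<in> events" for x unfolding E_def by (cases x) (simp, rule measurable_all_less[OF cut_set_subset])
  have EP: "prob (E (i, f)) = a" if "i \<in> {1..n}" "f \<in> F" for i f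
    unfolding E_def a_def p_def using prob_all_less[OF cut_set_subset, of "{i}" "\<lambda>_. f" t] un that cst by simp
  have a0: "0 < a" using p by (simp add: a_def)
  define \<mu> where "\<mu> = (\<Sum>x\<in>?I. prob (E x))"
  have \<mu>: "\<mu> = real n * real (card F) * a"
  proof -
    have "\<mu> = (\<Sum>x\<in>?I. a)" unfolding \<mu>_def by (intro sum.cong refl) (use EP in auto)
    thus ?thesis by (simp add: card_cartesian_product)
  qed
  have cF: "0 < real (card F)" using F by (simp add: card_gt_0_iff)
  have \<mu>0: "\<mu> > 0" unfolding \<mu> using n a0 cF by simp
  have two: "prob (E (i, f) \<inter> E (j, f')) \<le> a\<^sup>2 / (1 - p)" if ij: "i \<in> {1..n}" "j \<in> {1..n}" "i \<noteq> j" and f: "f \<in> F" "f' \<in> F" for i j f f'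
  proof -
    let ?J = "cut_set n {i} \<union> cut_set n {j}"
    \<comment> \<open>On the common edge of the two stars only the condition for \<open>f\<close> is
      kept; the events then concern distinct independent vectors.\<close>
    let ?u = "\<lambda>e. if e \<in> cut_set n {i} then f else f'"
    have "prob (E (i, f) \<inter> E (j, f')) \<le> prob {\<omega>\<in>space M. \<forall>e\<in>?J. inner_prod d (X e \<omega>) (?u e) < t}"
    proof (rule finite_measure_mono)
      show "{\<omega>\<in>space M. \<forall>e\<in>?J. inner_prod d (X e \<omega>) (?u e) < t} \<in> events"
        by (rule measurable_all_less) (use cut_set_subset in blast)
    qed (auto simp: E_def)
    also have "\<dots> = (1 - gtail t) ^ card ?J"
      using un f by (intro prob_all_less) (auto simp: cut_set_subset[THEN subsetD])
    also have "\<dots> \<le> (1 - p) ^ (2 * (n - 1) - 1)"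
    proof -
      have "cut_set n {i} \<inter> cut_set n {j} \<subseteq> {(min i j, max i j)}"
        using ij by (auto simp: cut_set_def pairs_def)
      hence "card (cut_set n {i} \<inter> cut_set n {j}) \<le> card {(min i j, max i j)}" by (intro card_mono) auto
      moreover have "card ?J + card (cut_set n {i} \<inter> cut_set n {j}) = card (cut_set n {i}) + card (cut_set n {j})"
        by (rule card_Un_Int[symmetric]) auto
      ultimately have "2 * (n - 1) - 1 \<le> card ?J" using cst ij by simp
      thus ?thesis unfolding p_def[symmetric] using p by (intro power_decreasing) auto
    qed
    also have "\<dots> = a\<^sup>2 / (1 - p)"
    proof -
      have "(1 - p) ^ (2 * (n - 1) - 1) * (1 - p) = (1 - p) ^ (2 * (n - 1))"
        using n by (subst power_Suc2[symmetric]) (simp add: Suc_diff_le)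
      also have "\<dots> = a\<^sup>2" unfolding a_def by (simp add: power_mult[symmetric] mult.commute)
      finally show ?thesis using p by (simp add: field_simps)
    qed
    finally show ?thesis .
  qed
  have far: "prob (E (i, f) \<inter> E (i, f')) \<le> a\<^sup>2 * exp (4 * p2 * real n)" if i: "i \<in> {1..n}" and f: "f \<in> F" "f' \<in> F" "far f f'" for i f f'
  proof -
    let ?J = "cut_set n {i}"
    have "E (i, f) \<inter> E (i, f') = {\<omega>\<in>space M. \<forall>e\<in>?J. (inner_prod d (X e \<omega>) f, inner_prod d (X e \<omega>) f') \<in> {..<t} \<times> {..<t}}"
      by (auto simp: E_def)
    also have "prob \<dots> = (\<Prod>e\<in>?J. prob {\<omega>\<in>space M. (inner_prod d (X e \<omega>) f, inner_prod d (X e \<omega>) f') \<in> {..<t} \<times> {..<t}})"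
      by (rule prob_all_inner2[OF cut_set_subset]) (intro pair_measureI; simp)
    also have "\<dots> \<le> (\<Prod>e\<in>?J. (1 - p)\<^sup>2 + p2)"
    proof (intro prod_mono conjI measure_nonneg)
      fix e assume "e \<in> ?J"
      hence e: "e \<in> pairs n" using cut_set_subset by blast
      let ?A = "{\<omega>\<in>space M. inner_prod d (X e \<omega>) f \<ge> t}" and ?B = "{\<omega>\<in>space M. inner_prod d (X e \<omega>) f' \<ge> t}"
      have m: "?A \<in> events" "?B \<in> events" using measurable_inner[OF e] by measurable
      \<comment> \<open>Inclusion and exclusion: the probability is \<open>1 - 2 * p\<close> plus
        that of both reaching \<open>t\<close>, hence at most
        \<open>(1 - p)\<^sup>2 + p2\<close>.\<close>
      have "{\<omega>\<in>space M. (inner_prod d (X e \<omega>) f, inner_prod d (X e \<omega>) f') \<in> {..<t} \<times> {..<t}} = space M - (?A \<union> ?B)" by auto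
      also have "prob \<dots> = 1 - prob (?A \<union> ?B)" using m by (intro prob_compl) auto
      also have "prob (?A \<union> ?B) = prob ?A + prob ?B - prob (?A \<inter> ?B)"
        using m by (intro measure_Un3) (auto simp: fmeasurable_eq_sets)
      also have "prob ?A = p" unfolding p_def by (rule prob_std_normal_ge[OF inner_std_normal[OF e un[OF f(1)]]])
      also have "prob ?B = p" unfolding p_def by (rule prob_std_normal_ge[OF inner_std_normal[OF e un[OF f(2)]]])
      also have "?A \<inter> ?B = {\<omega>\<in>space M. inner_prod d (X e \<omega>) f \<ge> t \<and> inner_prod d (X e \<omega>) f' \<ge> t}" by auto
      finally show "prob {\<omega>\<in>space M. (inner_prod d (X e \<omega>) f, inner_prod d (X e \<omega>) f') \<in> {..<t} \<times> {..<t}} \<le> (1 - p)\<^sup>2 + p2"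
        using p2[OF f e] by (simp add: power2_eq_square algebra_simps add_increasing2)
    qed
    also have "\<dots> = ((1 - p)\<^sup>2 + p2) ^ (n - 1)" using cst[OF i] by simp
    also have "\<dots> \<le> ((1 - p)\<^sup>2 * exp (4 * p2)) ^ (n - 1)"
    proof (rule power_mono)
      \<comment> \<open>\<open>p \<le> 1 / 2\<close> makes \<open>(1 - p)\<^sup>2\<close> at least
        \<open>1 / 4\<close>, which is the origin of the factor 4 in the exponential.\<close>
      have "(1/2)\<^sup>2 \<le> (1 - p)\<^sup>2" using p by (intro power_mono) auto
      hence "(1 - p)\<^sup>2 * 1 + (1/4) * (4 * p2) \<le> (1 - p)\<^sup>2 * 1 + (1 - p)\<^sup>2 * (4 * p2)"
        using p20 by (intro add_left_mono mult_right_mono) (auto simp: power2_eq_square)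
      also have "\<dots> = (1 - p)\<^sup>2 * (1 + 4 * p2)" by (simp add: algebra_simps)
      also have "\<dots> \<le> (1 - p)\<^sup>2 * exp (4 * p2)" by (intro mult_left_mono exp_ge_add_one_self) auto
      finally show "(1 - p)\<^sup>2 + p2 \<le> (1 - p)\<^sup>2 * exp (4 * p2)" by simp
    qed (use p20 in auto)
    also have "\<dots> = a\<^sup>2 * exp (4 * p2) ^ (n - 1)"
      unfolding a_def by (simp add: power_mult_distrib power_mult[symmetric] mult.commute)
    also have "exp (4 * p2) ^ (n - 1) \<le> exp (4 * p2) ^ n" using p20 by (intro power_increasing) auto
    also have "exp (4 * p2) ^ n = exp (4 * p2 * real n)" by (simp add: exp_of_nat2_mult)
    finally show ?thesis by (simp add: mult_left_mono)
  qed
  have near: "prob (E (i, f) \<inter> E (i, f')) \<le> a" if i: "i \<in> {1..n}" and f: "f \<in> F" for i f f'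
    using EP[OF i f] Em by (metis finite_measure_mono inf_le1)
  have V0: "0 \<le> V"
  proof -
    obtain f where "f \<in> F" using F by auto
    from V[OF this] show ?thesis using of_nat_0_le_iff order_trans by blast
  qed
  have row: "(\<Sum>y\<in>?I. prob (E (i, f) \<inter> E y)) \<le> real n * real (card F) * (a\<^sup>2 / (1 - p)) + real (card F) * (a\<^sup>2 * exp (4 * p2 * real n)) + V * a"
    if i: "i \<in> {1..n}" and f: "f \<in> F" for i f
  proof -
    have "(\<Sum>y\<in>?I. prob (E (i, f) \<inter> E y)) = (\<Sum>j\<in>{1..n}. \<Sum>f'\<in>F. prob (E (i, f) \<inter> E (j, f')))"
      by (simp add: sum.cartesian_product)
    also have "\<dots> = (\<Sum>f'\<in>F. prob (E (i, f) \<inter> E (i, f'))) + (\<Sum>j\<in>{1..n} - {i}. \<Sum>f'\<in>F. prob (E (i, f) \<inter> E (j, f')))"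
      using i by (intro sum.remove) auto
    also have "(\<Sum>j\<in>{1..n} - {i}. \<Sum>f'\<in>F. prob (E (i, f) \<inter> E (j, f'))) \<le> (\<Sum>j\<in>{1..n} - {i}. \<Sum>f'\<in>F. a\<^sup>2 / (1 - p))"
      by (intro sum_mono two) (use i f in auto)
    also have "\<dots> \<le> (\<Sum>j\<in>{1..n}. \<Sum>f'\<in>F. a\<^sup>2 / (1 - p))" using p by (intro sum_mono2 sum_nonneg) auto
    also have "\<dots> = real n * real (card F) * (a\<^sup>2 / (1 - p))" by simp
    also have "(\<Sum>f'\<in>F. prob (E (i, f) \<inter> E (i, f'))) \<le> (\<Sum>f'\<in>F. a\<^sup>2 * exp (4 * p2 * real n) + (if far f f' then 0 else a))"
      using far[OF i f] near[OF i f] a0 by (intro sum_mono) (auto simp: add_increasing add_increasing2)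
    also have "\<dots> = real (card F) * (a\<^sup>2 * exp (4 * p2 * real n)) + real (card {f'\<in>F. \<not> far f f'}) * a"
    proof -
      have "(\<Sum>f'\<in>F. if far f f' then 0 else a) = (\<Sum>f'\<in>{f'\<in>F. \<not> far f f'}. a)"
        using F(1) by (intro sum.mono_neutral_cong_right) auto
      thus ?thesis by (simp add: sum.distrib)
    qed
    also have "\<dots> \<le> real (card F) * (a\<^sup>2 * exp (4 * p2 * real n)) + V * a"
      using V[OF f] a0 by (simp add: mult_right_mono)
    finally show ?thesis by simp
  qed
  let ?\<beta> = "1 / (1 - p) - 1 + exp (4 * p2 * real n) / real n + V / (real n * real (card F) * a)"
  have "(\<Sum>x\<in>?I. \<Sum>y\<in>?I. prob (E x \<inter> E y)) \<le> (\<Sum>x\<in>?I. real n * real (card F) * (a\<^sup>2 / (1 - p)) + real (card F) * (a\<^sup>2 * exp (4 * p2 * real n)) + V * a)"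
    using row by (intro sum_mono) auto
  also have "\<dots> = real n * real (card F) * (real n * real (card F) * (a\<^sup>2 / (1 - p)) + real (card F) * (a\<^sup>2 * exp (4 * p2 * real n)) + V * a)"
    by (simp add: card_cartesian_product)
  also have "\<dots> = (1 + ?\<beta>) * \<mu>\<^sup>2"
  proof -
    have "real n > 0" using n by simp
    thus ?thesis unfolding \<mu> using a0 cF p by (simp add: field_simps power2_eq_square)
  qed
  finally have S: "(\<Sum>x\<in>?I. \<Sum>y\<in>?I. prob (E x \<inter> E y)) \<le> (1 + ?\<beta>) * \<mu>\<^sup>2" .
  have "prob {\<omega>\<in>space M. \<forall>s\<in>unit_sphere d. graph_connected (Gam n d (\<lambda>e. X e \<omega>) s t)} \<le> prob {\<omega>\<in>space M. \<forall>x\<in>?I. \<omega> \<notin> E x}"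
  proof (rule finite_measure_mono)
    have "{\<omega>\<in>space M. \<forall>x\<in>?I. \<omega> \<notin> E x} = space M - (\<Union>x\<in>?I. E x)" by auto
    moreover have "(\<Union>x\<in>?I. E x) \<in> events" using Em F(1) by (intro sets.finite_UN) auto
    ultimately show "{\<omega>\<in>space M. \<forall>x\<in>?I. \<omega> \<notin> E x} \<in> events" by (simp only: sets.compl_sets)
    show "{\<omega>\<in>space M. \<forall>s\<in>unit_sphere d. graph_connected (Gam n d (\<lambda>e. X e \<omega>) s t)} \<subseteq> {\<omega>\<in>space M. \<forall>x\<in>?I. \<omega> \<notin> E x}"
    proof safe
      fix \<omega> i f
      assume w: "\<forall>s\<in>unit_sphere d. graph_connected (Gam n d (\<lambda>e. X e \<omega>) s t)" "i \<in> {1..n}" "f \<in> F" "\<omega> \<in> E (i, f)"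
      have "cut_connected n (edge_set n d (\<lambda>e. X e \<omega>) f t)" using w F n by (auto simp: graph_connected_Gam)
      moreover have "{i} \<noteq> {1..n}"
      proof
        assume "{i} = {1..n}"
        hence "card {i} = card {1..n}" by simp
        thus False using n by simp
      qed
      ultimately have "edge_set n d (\<lambda>e. X e \<omega>) f t \<inter> cut_set n {i} \<noteq> {}" using w(2) by (auto simp: cut_connected_def)
      thus False using w(4) by (force simp: E_def edge_set_def)
    qed
  qed
  also have "\<dots> \<le> ?\<beta>"
    by (rule second_moment_method[OF _ _ \<mu>_def \<mu>0 S]) (use F(1) Em in auto)
  finally show ?thesis unfolding a_def .
qed

end

text \<open>Neighbouring grid points are too close for the second moment, but most pairs of grid points differ in
  a positive fraction of the coordinates and are therefore far apart.\<close>

definition grid_point :: "nat \<Rightarrow> nat \<Rightarrow> real \<Rightarrow> (nat \<Rightarrow> nat) \<Rightarrow> nat \<Rightarrow> real" where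
  "grid_point d K h f = (\<lambda>k\<in>{..<d}. if k < K then h * real (f k)
     else if k = K then sqrt (1 - (\<Sum>k<K. (h * real (f k))\<^sup>2)) else 0)"

section \<open>A grid code on the sphere: distances and Hamming balls\<close>

lemma sum_grid_coords:
  fixes F :: "nat \<Rightarrow> real"
  assumes "K < d" "\<And>k. K < k \<Longrightarrow> k < d \<Longrightarrow> F k = 0"
  shows "(\<Sum>k<d. F k) = (\<Sum>k<K. F k) + F K"
proof -
  have "(\<Sum>k<d. F k) = (\<Sum>k<Suc K. F k)"
    using assms by (intro sum.mono_neutral_right) auto
  thus ?thesis by simp
qed

lemma grid_sum_le:
  assumes f: "f \<in> PiE {..<K} (\<lambda>_. {..<g})" and h: "0 \<le> h" "2 * real K * (h * real g)\<^sup>2 \<le> 1"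
  shows "(\<Sum>k<K. (h * real (f k))\<^sup>2) \<le> 1/2"
proof -
  have "(\<Sum>k<K. (h * real (f k))\<^sup>2) \<le> (\<Sum>k<K. (h * real g)\<^sup>2)"
    using f h by (intro sum_mono power_mono mult_left_mono) (auto simp: PiE_iff dest!: bspec)
  thus ?thesis using h by simp
qed

lemma grid_point_sphere:
  assumes f: "f \<in> PiE {..<K} (\<lambda>_. {..<g})" and h: "0 \<le> h" "2 * real K * (h * real g)\<^sup>2 \<le> 1" and K: "K < d"
  shows "grid_point d K h f \<in> unit_sphere d"
proof -
  note le = grid_sum_le[OF f h]
  have "(\<Sum>k<d. (grid_point d K h f k)\<^sup>2) = (\<Sum>k<K. (grid_point d K h f k)\<^sup>2) + (grid_point d K h f K)\<^sup>2"
    using K by (intro sum_grid_coords) (auto simp: grid_point_def)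
  also have "(\<Sum>k<K. (grid_point d K h f k)\<^sup>2) = (\<Sum>k<K. (h * real (f k))\<^sup>2)"
    using K by (intro sum.cong) (auto simp: grid_point_def)
  also have "(grid_point d K h f K)\<^sup>2 = 1 - (\<Sum>k<K. (h * real (f k))\<^sup>2)"
    using K le by (simp add: grid_point_def)
  finally show ?thesis by (simp add: unit_sphere_iff grid_point_def)
qed

text \<open>Every differing coordinate contributes at least \<open>h\<^sup>2\<close>. The distance 2
  is never attained, because coordinate \<open>K\<close> is positive at both points, so their sum is
  not zero and the parallelogram law applies.\<close>

lemma grid_point_dist:
  assumes f: "f \<in> PiE {..<K} (\<lambda>_. {..<g})" "f' \<in> PiE {..<K} (\<lambda>_. {..<g})"
    and h: "0 \<le> h" "2 * real K * (h * real g)\<^sup>2 \<le> 1" and K: "K < d"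
  shows "h\<^sup>2 * real (card {k\<in>{..<K}. f k \<noteq> f' k}) \<le> (\<Sum>k<d. (grid_point d K h f k - grid_point d K h f' k)\<^sup>2)"
    "(\<Sum>k<d. (grid_point d K h f k - grid_point d K h f' k)\<^sup>2) < 4"
proof -
  let ?s = "grid_point d K h f" and ?s' = "grid_point d K h f'"
  have "h\<^sup>2 * real (card {k\<in>{..<K}. f k \<noteq> f' k}) = (\<Sum>k\<in>{k\<in>{..<K}. f k \<noteq> f' k}. h\<^sup>2)" by simp
  also have "\<dots> \<le> (\<Sum>k\<in>{k\<in>{..<K}. f k \<noteq> f' k}. (?s k - ?s' k)\<^sup>2)"
  proof (rule sum_mono)
    fix k assume k: "k \<in> {k\<in>{..<K}. f k \<noteq> f' k}"
    hence "1 \<le> \<bar>real (f k) - real (f' k)\<bar>" by auto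
    hence "1 \<le> (real (f k) - real (f' k))\<^sup>2" by (metis abs_1 abs_le_square_iff one_power2)
    hence "h\<^sup>2 * 1 \<le> h\<^sup>2 * (real (f k) - real (f' k))\<^sup>2" by (intro mult_left_mono) auto
    also have "\<dots> = (?s k - ?s' k)\<^sup>2" using k K by (simp add: grid_point_def power_mult_distrib[symmetric] right_diff_distrib)
    finally show "h\<^sup>2 \<le> (?s k - ?s' k)\<^sup>2" by simp
  qed
  also have "\<dots> \<le> (\<Sum>k<d. (?s k - ?s' k)\<^sup>2)" using K by (intro sum_mono2) auto
  finally show "h\<^sup>2 * real (card {k\<in>{..<K}. f k \<noteq> f' k}) \<le> (\<Sum>k<d. (?s k - ?s' k)\<^sup>2)" .
  have "(\<Sum>k<d. (?s k - ?s' k)\<^sup>2) + (\<Sum>k<d. (?s k + ?s' k)\<^sup>2) = (\<Sum>k<d. 2 * (?s k)\<^sup>2 + 2 * (?s' k)\<^sup>2)"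
    unfolding sum.distrib[symmetric] by (intro sum.cong refl) (simp add: power2_eq_square algebra_simps)
  also have "\<dots> = 4" using grid_point_sphere[OF f(1) h K] grid_point_sphere[OF f(2) h K]
    by (simp add: unit_sphere_iff sum.distrib sum_distrib_left[symmetric])
  finally have "(\<Sum>k<d. (?s k - ?s' k)\<^sup>2) = 4 - (\<Sum>k<d. (?s k + ?s' k)\<^sup>2)" by simp
  moreover have "0 < (\<Sum>k<d. (?s k + ?s' k)\<^sup>2)"
  proof (rule sum_pos2[of _ K])
    have "0 < ?s K" "0 < ?s' K" using K grid_sum_le[OF f(1) h] grid_sum_le[OF f(2) h] by (auto simp: grid_point_def)
    thus "0 < (?s K + ?s' K)\<^sup>2" by simp
  qed (use K in auto)
  ultimately show "(\<Sum>k<d. (?s k - ?s' k)\<^sup>2) < 4" by simp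
qed

text \<open>There are at most \<open>2 ^ K\<close> choices for the set of differing coordinates, and
  the values on a set of fewer than \<open>m\<close> coordinates can be chosen in at most
  \<open>g powr m\<close> ways.\<close>

lemma card_hamming_ball:
  assumes f: "f \<in> PiE {..<K} (\<lambda>_. {..<g})" and g: "g \<ge> 1" and m: "0 \<le> m"
  shows "real (card {f'\<in>PiE {..<K} (\<lambda>_. {..<g}). real (card {k\<in>{..<K}. f k \<noteq> f' k}) < m}) \<le> 2 ^ K * real g powr m"
proof -
  let ?B = "{f'\<in>PiE {..<K} (\<lambda>_. {..<g}). real (card {k\<in>{..<K}. f k \<noteq> f' k}) < m}"
  let ?G = "\<lambda>T. {f'\<in>PiE {..<K} (\<lambda>_. {..<g}). {k\<in>{..<K}. f k \<noteq> f' k} = T}"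
  let ?T = "{T\<in>Pow {..<K}. real (card T) < m}"
  have cG: "real (card (?G T)) \<le> real g powr m" if T: "T \<in> ?T" for T
  proof -
    have "card (?G T) \<le> card (PiE T (\<lambda>_. {..<g}))"
    proof (rule card_inj_on_le)
      show "inj_on (\<lambda>f'. restrict f' T) (?G T)"
      proof (rule inj_onI)
        fix x y assume xy: "x \<in> ?G T" "y \<in> ?G T" "restrict x T = restrict y T"
        show "x = y"
        proof
          fix k
          show "x k = y k"
          proof (cases "k < K")
            case False thus ?thesis using xy by (auto simp: PiE_iff extensional_def)
          next
            case True
            show ?thesis
            proof (cases "k \<in> T")
              case True thus ?thesis using xy(3) by (metis restrict_apply')
            next
              case False
              hence "k \<notin> {k\<in>{..<K}. f k \<noteq> x k}" "k \<notin> {k\<in>{..<K}. f k \<noteq> y k}" using xy(1,2) by simp_all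
              thus ?thesis using \<open>k < K\<close> by simp
            qed
          qed
        qed
      qed
      show "(\<lambda>f'. restrict f' T) ` ?G T \<subseteq> PiE T (\<lambda>_. {..<g})" using T by (auto simp: PiE_iff)
      show "finite (PiE T (\<lambda>_. {..<g}))" using T by (intro finite_PiE) (auto intro: finite_subset)
    qed
    also have "\<dots> = g ^ card T" using T by (subst card_PiE) (auto intro: finite_subset)
    finally have "real (card (?G T)) \<le> real g ^ card T" unfolding of_nat_power[symmetric] of_nat_le_iff .
    also have "\<dots> = real g powr real (card T)" using g by (simp add: powr_realpow)
    also have "\<dots> \<le> real g powr m" using T g by (intro powr_mono) auto
    finally show ?thesis .
  qed
  have finT: "finite ?T" by simp
  have finG: "finite (?G T)" for T by (rule finite_subset[of _ "PiE {..<K} (\<lambda>_. {..<g})"]) (auto intro: finite_PiE)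
  have "?B \<subseteq> (\<Union>T\<in>?T. ?G T)"
  proof
    fix x assume x: "x \<in> ?B"
    let ?D = "{k\<in>{..<K}. f k \<noteq> x k}"
    have "?D \<in> Pow {..<K}" by blast
    moreover have "x \<in> PiE {..<K} (\<lambda>_. {..<g})" "real (card ?D) < m" using x unfolding mem_Collect_eq by (rule conjunct1, rule conjunct2)
    ultimately have "?D \<in> ?T" "x \<in> ?G ?D" unfolding mem_Collect_eq by simp_all
    thus "x \<in> (\<Union>T\<in>?T. ?G T)" by (rule UN_I)
  qed
  hence "card ?B \<le> card (\<Union>T\<in>?T. ?G T)" using finT finG by (intro card_mono) auto
  also have "\<dots> \<le> (\<Sum>T\<in>?T. card (?G T))" by (rule card_UN_le[OF finT])
  finally have "real (card ?B) \<le> (\<Sum>T\<in>?T. real (card (?G T)))" unfolding of_nat_sum[symmetric] of_nat_le_iff .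
  also have "\<dots> \<le> (\<Sum>T\<in>?T. real g powr m)" by (intro sum_mono cG)
  also have "\<dots> = real (card ?T) * real g powr m" by simp
  also have "\<dots> \<le> 2 ^ K * real g powr m"
  proof (rule mult_right_mono)
    have "card ?T \<le> card (Pow {..<K})" by (intro card_mono) auto
    hence "real (card ?T) \<le> real (2 ^ K)" by (simp add: card_Pow del: of_nat_power)
    thus "real (card ?T) \<le> 2 ^ K" by simp
  qed simp
  finally show ?thesis .
qed

text \<open>The code has \<open>g ^ K\<close> points with \<open>ln g\<close> about
  \<open>ln (ln n) / 2\<close>. The near pairs are the critical ones: relative to the square of the
  mean they contribute about \<open>n powr (c - 1) * 2 ^ K * g powr (- (1 - \<rho>) * K)\<close>,
  and this tends to \<open>0\<close> because \<open>B * (1 - \<rho>) / 2\<close> exceeds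
  \<open>c - 1\<close>.\<close>

lemma exists_disconnected_whp:
  assumes c: "c > 1" and g: "gaussian_model c d M X" and e: "0 < \<epsilon>"
    and D: "\<forall>\<^sub>F n in sequentially. real (d n) \<ge> (2 + \<epsilon>) * (c - 1) * ln (real n) / ln (ln (real n))"
  shows "whp M (\<lambda>n \<omega>. \<exists>s\<in>unit_sphere (d n). \<not> graph_connected (rand_graph c d X n \<omega> s))"
proof -
  have c0: "c > 0" using c by simp
  define B where "B = (2 + \<epsilon>) * (c - 1)"
  \<comment> \<open>\<open>\<rho>\<close> is the fraction of differing coordinates that makes two
    points far. \<open>\<sigma>\<close> lies slightly below the remaining exponent
    \<open>1 - \<rho>\<close>, to absorb lower-order terms, and is still so large that
    \<open>B * \<sigma> / 2\<close> exceeds \<open>c - 1\<close> by \<open>w\<close>.\<close>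
  define \<rho> where "\<rho> = \<epsilon> / (2 * (2 + \<epsilon>))"
  define \<sigma> where "\<sigma> = (4 + \<epsilon> / 2) / (2 * (2 + \<epsilon>))"
  define w where "w = (c - 1) * \<epsilon> / 8"
  have B: "B > 0" using c e by (simp add: B_def)
  have \<rho>: "0 < \<rho>" "\<rho> < 1" using e by (auto simp: \<rho>_def field_simps intro!: add_pos_pos)
  have \<sigma>: "0 < \<sigma>" "\<sigma> < 1 - \<rho>" using e by (auto simp: \<sigma>_def \<rho>_def field_simps intro!: add_pos_pos)
  have w: "0 < w" "B * \<sigma> / 2 = c - 1 + w"
  proof -
    show "0 < w" using c e by (simp add: w_def)
    have "2 + \<epsilon> \<noteq> 0" using e by simp
    thus "B * \<sigma> / 2 = c - 1 + w" by (simp add: B_def \<sigma>_def w_def field_simps)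
  qed
  \<comment> \<open>The \<open>- 1\<close> leaves a coordinate for normalising the grid points, so
    that \<open>K n < d n\<close>.\<close>
  define K where "K n = nat \<lceil>B * ln (real n) / ln (ln (real n))\<rceil> - 1" for n :: nat
  \<comment> \<open>With about this many values per coordinate, far points have squared distance at
    least \<open>32 * ln (ln n) / ln n\<close>. The constant 64 is twice 32, because the first
    coordinates use only half of the squared norm.\<close>
  define G where "G n = sqrt (\<rho> * ln (real n) / (64 * ln (ln (real n))))" for n :: nat
  define g where "g n = nat \<lfloor>G n\<rfloor>" for n :: nat
  \<comment> \<open>The first factors bound \<open>exp (- t\<^sup>2 / 2)\<close> by the Mills-type
    estimate; the last one is the gain from the separation of far points. Together
    \<open>n * p2 n\<close> tends to \<open>0\<close>.\<close>
  define p2 where "p2 n = sqrt (2 * pi) * (exp (3/2) * sqrt (2 * ln (real n)) * (c * ln (real n) / real n)) * exp (- (4 * ln (ln (real n))))" for n :: nat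
  define f where "f n = 1 / (1 - c * ln (real n) / real n) - 1 + exp (4 * p2 n * real n) / real n +
     exp (1 + \<sigma> * ln (ln (real n)) / 2 - w * ln (real n))" for n :: nat
  have f0: "f \<longlonglongrightarrow> 0"
  proof -
    have "(\<lambda>n::nat. 1 / (1 - c * ln (real n) / real n) - 1) \<longlonglongrightarrow> 0" using c by real_asymp
    moreover have "(\<lambda>n::nat. exp (4 * (sqrt (2 * pi) * (exp (3/2) * sqrt (2 * ln (real n)) * (c * ln (real n) / real n)) * exp (- (4 * ln (ln (real n))))) * real n) / real n) \<longlonglongrightarrow> 0"
      using c by real_asymp
    moreover have "(\<lambda>n::nat. exp (1 + \<sigma> * ln (ln (real n)) / 2 - w * ln (real n))) \<longlonglongrightarrow> 0" using w(1) \<sigma>(1) by real_asymp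
    ultimately have "(\<lambda>n::nat. 1 / (1 - c * ln (real n) / real n) - 1 + exp (4 * p2 n * real n) / real n +
     exp (1 + \<sigma> * ln (ln (real n)) / 2 - w * ln (real n))) \<longlonglongrightarrow> 0 + 0 + 0"
      unfolding p2_def by (intro tendsto_add)
    thus ?thesis unfolding f_def by simp
  qed
  have a1: "\<forall>\<^sub>F n::nat in sequentially. 2 \<le> B * ln (real n) / ln (ln (real n))" using B by real_asymp
  have a2: "\<forall>\<^sub>F n::nat in sequentially. 2 \<le> sqrt (\<rho> * ln (real n) / (64 * ln (ln (real n))))" using \<rho> by real_asymp
  have a3: "\<forall>\<^sub>F n::nat in sequentially. ln 2 - (1 - \<rho>) * ln (sqrt (\<rho> * ln (real n) / (64 * ln (ln (real n)))) - 1) \<le> - \<sigma> * ln (ln (real n)) / 2"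
    using \<rho> \<sigma> by real_asymp
  have a4: "\<forall>\<^sub>F n::nat in sequentially. - (c * ln n) - 1 \<le> real n * (- (c * ln n / n) - 2 * (c * ln n / n)^2)" using c by real_asymp
  have a5: "\<forall>\<^sub>F n::nat in sequentially. c * ln n / n \<le> 1/2" using c by real_asymp
  have a6: "\<forall>\<^sub>F n::nat in sequentially. 0 < ln (ln (real n))" by real_asymp
  have dB: "\<forall>\<^sub>F n in sequentially. B * ln (real n) / ln (ln (real n)) \<le> real (d n)" using D by (simp add: B_def)
  show ?thesis
  proof (rule whpI[OF _ f0])
    show "\<forall>\<^sub>F n in sequentially. prob_space (M n) \<and>
      {\<omega>\<in>space (M n). \<exists>s\<in>unit_sphere (d n). \<not> graph_connected (rand_graph c d X n \<omega> s)} \<in> sets (M n) \<and>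
      measure (M n) {\<omega>\<in>space (M n). \<not> (\<exists>s\<in>unit_sphere (d n). \<not> graph_connected (rand_graph c d X n \<omega> s))} \<le> f n"
      using eventually_model[OF c0 assms(2)] eventually_threshold[OF c0] a1 a2 a3 a4 a5 a6 dB
    proof eventually_elim
      case (elim n)
      then interpret gauss_array "M n" n "d n" "X n" by simp
      let ?t = "threshold c n" and ?K = "K n" and ?g = "g n"
      let ?p = "gtail ?t" and ?L = "ln (real n)"
      have n: "n \<ge> 3" "real n \<ge> 3" using elim by auto
      have L0: "?L > 0" and LL: "ln ?L > 0" using n elim by auto
      have p: "?p = c * ?L / real n" using elim by (simp add: edge_prob_def)
      have t: "1 \<le> ?t" "sqrt ?L \<le> ?t" "?t \<le> sqrt (2 * ?L)" using elim by auto
      have Kd: "?K < d n"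
      proof -
        have "\<lceil>B * ?L / ln ?L\<rceil> \<le> int (d n)" using elim(9) by (simp add: ceiling_le_iff)
        moreover have "1 \<le> d n" using elim by simp
        ultimately show ?thesis unfolding K_def by linarith
      qed
      have K: "B * ?L / ln ?L - 1 \<le> real ?K" "?K \<ge> 1"
      proof -
        have "2 \<le> nat \<lceil>B * ?L / ln ?L\<rceil>" using elim(3) by linarith
        moreover have "B * ?L / ln ?L \<le> real (nat \<lceil>B * ?L / ln ?L\<rceil>)" using elim(3) by linarith
        ultimately show "B * ?L / ln ?L - 1 \<le> real ?K" "?K \<ge> 1" unfolding K_def by (simp_all add: of_nat_diff)
      qed
      have G2: "2 \<le> G n" using elim(4) by (simp add: G_def)
      have g2: "2 \<le> ?g" "real ?g \<le> G n" "G n - 1 \<le> real ?g" using G2 unfolding g_def by linarith+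
      \<comment> \<open>The largest spacing for which the first \<open>?K\<close> coordinates are
        sure to have squared norm at most \<open>1 / 2\<close>, as \<open>grid_sum_le\<close> bounds
        it.\<close>
      define h where "h = 1 / (real ?g * sqrt (2 * real ?K))"
      have h: "0 < h" "2 * real ?K * (h * real ?g)\<^sup>2 = 1" "h\<^sup>2 = 1 / ((real ?g)\<^sup>2 * (2 * real ?K))"
        using g2 K(2) by (auto simp: h_def power_mult_distrib power_divide)
      let ?P = "PiE {..<?K} (\<lambda>_. {..<?g})"
      let ?pt = "grid_point (d n) ?K h"
      let ?F = "?pt ` ?P"
      \<comment> \<open>Farness is read off from the points themselves, because the second moment
        bound speaks of directions; since \<open>h > 0\<close>, the differing coordinates are those
        of the codewords.\<close>
      define far where "far s s' \<longleftrightarrow> \<rho> * real ?K \<le> real (card {k\<in>{..<?K}. s k \<noteq> s' k})" for s s' :: "nat \<Rightarrow> real"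
      have pt: "?pt z k = h * real (z k)" if "k < ?K" for z k using that Kd by (simp add: grid_point_def)
      have ne: "{k\<in>{..<?K}. ?pt z k \<noteq> ?pt z' k} = {k\<in>{..<?K}. z k \<noteq> z' k}" for z z'
        using h(1) by (auto simp: pt)
      have inj: "inj_on ?pt ?P"
      proof (rule inj_onI)
        fix x y assume xy: "x \<in> ?P" "y \<in> ?P" "?pt x = ?pt y"
        have "{k\<in>{..<?K}. x k \<noteq> y k} = {}" unfolding ne[symmetric] xy(3) by simp
        thus "x = y" using xy(1,2) by (intro PiE_ext) auto
      qed
      have finP: "finite ?P" by (intro finite_PiE) auto
      have cF: "real (card ?F) = real ?g ^ ?K" using card_image[OF inj] by (simp add: card_PiE)
      have h1: "2 * real ?K * (h * real ?g)\<^sup>2 \<le> 1" using h(2) by simp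
      let ?a = "(1 - ?p) ^ (n - 1)"
      let ?V = "2 ^ ?K * real ?g powr (\<rho> * real ?K)"
      have main: "prob {\<omega>\<in>space (M n). \<forall>s\<in>unit_sphere (d n). graph_connected (Gam n (d n) (\<lambda>e. X n e \<omega>) s ?t)} \<le>
        1 / (1 - ?p) - 1 + exp (4 * p2 n * real n) / real n + ?V / (real n * real (card ?F) * ?a)"
      proof (rule prob_all_connected_le[where far = far])
        show "2 \<le> n" "finite ?F" using n finP by auto
        have "(\<lambda>k\<in>{..<?K}. 0) \<in> ?P" using g2 by auto
        hence "?P \<noteq> {}" by blast
        thus "?F \<noteq> {}" by simp
        show "?F \<subseteq> unit_sphere (d n)" 
          by (rule image_subsetI) (rule grid_point_sphere[OF _ less_imp_le[OF h(1)] h1 Kd])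
        show "?p \<le> 1/2" using p elim by simp
        show "0 \<le> p2 n" using L0 c0 by (simp add: p2_def)
        fix s assume "s \<in> ?F"
        then obtain z where z: "z \<in> ?P" "s = ?pt z" by auto
        have "real (card {k\<in>{..<?K}. z k \<noteq> z' k}) < \<rho> * real ?K \<longleftrightarrow> \<not> far s (?pt z')" for z'
          unfolding z(2) far_def ne not_le ..
        hence "?pt ` {z'\<in>?P. real (card {k\<in>{..<?K}. z k \<noteq> z' k}) < \<rho> * real ?K} = {s'\<in>?F. \<not> far s s'}"
          by (simp only:) blast
        moreover have "card (?pt ` {z'\<in>?P. real (card {k\<in>{..<?K}. z k \<noteq> z' k}) < \<rho> * real ?K}) = card {z'\<in>?P. real (card {k\<in>{..<?K}. z k \<noteq> z' k}) < \<rho> * real ?K}"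
          by (rule card_image[OF inj_on_subset[OF inj]]) blast
        ultimately have "card {s'\<in>?F. \<not> far s s'} = card {z'\<in>?P. real (card {k\<in>{..<?K}. z k \<noteq> z' k}) < \<rho> * real ?K}"
          by (simp only:)
        thus "real (card {s'\<in>?F. \<not> far s s'}) \<le> ?V"
          using card_hamming_ball[OF z(1), of "\<rho> * real ?K"] g2(1) \<rho>(1) by (simp only:) simp
      next
        fix s s' ed assume s: "s \<in> ?F" "s' \<in> ?F" "far s s'" "ed \<in> pairs n"
        then obtain z z' where z: "z \<in> ?P" "s = ?pt z" "z' \<in> ?P" "s' = ?pt z'" by auto
        let ?D = "\<Sum>k<d n. (s k - s' k)\<^sup>2"
        have un: "(\<Sum>k<d n. (s k)\<^sup>2) = 1" "(\<Sum>k<d n. (s' k)\<^sup>2) = 1"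
          using grid_point_sphere[OF z(1) _ h1 Kd] grid_point_sphere[OF z(3) _ h1 Kd] h z by (auto simp: unit_sphere_iff)
        have D4: "?D < 4" unfolding z using h by (intro grid_point_dist(2)[OF z(1,3) _ h1 Kd]) simp
        have D: "32 * ln ?L / ?L \<le> ?D"
        proof -
          have "G n ^ 2 = \<rho> * ?L / (64 * ln ?L)" unfolding G_def using \<rho> L0 LL by simp
          moreover have "(real ?g)\<^sup>2 \<le> (G n)\<^sup>2" using g2 by (intro power_mono) auto
          ultimately have gg: "(real ?g)\<^sup>2 * (64 * ln ?L) \<le> \<rho> * ?L" using LL by (simp add: le_divide_eq)
          have "32 * ln ?L / ?L \<le> \<rho> / (2 * (real ?g)\<^sup>2)" using gg L0 g2 by (simp add: field_simps)
          also have "\<dots> = h\<^sup>2 * (\<rho> * real ?K)" using K(2) by (simp add: h(3))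
          also have "\<dots> \<le> h\<^sup>2 * real (card {k\<in>{..<?K}. z k \<noteq> z' k})"
            using s(3) unfolding far_def z ne by (intro mult_left_mono) auto
          also have "\<dots> \<le> ?D" unfolding z using h by (intro grid_point_dist(1)[OF z(1,3) _ h1 Kd]) simp
          finally show ?thesis .
        qed
        have "prob {\<omega>\<in>space (M n). inner_prod (d n) (X n ed \<omega>) s \<ge> ?t \<and> inner_prod (d n) (X n ed \<omega>) s' \<ge> ?t} \<le> exp (- (?t\<^sup>2 / 2 * (1 + ?D / 4)))"
          using t by (intro prob_both_ge_le[OF s(4) _ un refl D4]) simp
        also have "\<dots> = exp (- ?t\<^sup>2 / 2) * exp (- (?t\<^sup>2 * ?D / 8))" by (simp add: exp_add[symmetric] algebra_simps)
        also have "\<dots> \<le> (sqrt (2 * pi) * (exp (3/2) * sqrt (2 * ?L) * (c * ?L / real n))) * exp (- (4 * ln ?L))"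
        proof (rule mult_mono)
          have "exp (- ?t\<^sup>2 / 2) = sqrt (2 * pi) * std_normal_density ?t" by (simp add: std_normal_density_def)
          also have "\<dots> \<le> sqrt (2 * pi) * (exp (3/2) * ?t * ?p)"
            by (intro mult_left_mono std_normal_density_le_gtail t) simp
          also have "\<dots> \<le> sqrt (2 * pi) * (exp (3/2) * sqrt (2 * ?L) * ?p)"
            using t by (intro mult_left_mono mult_right_mono) auto
          finally show "exp (- ?t\<^sup>2 / 2) \<le> sqrt (2 * pi) * (exp (3/2) * sqrt (2 * ?L) * (c * ?L / real n))" unfolding p .
          have "?L = (sqrt ?L)\<^sup>2" using L0 by simp
          also have "\<dots> \<le> ?t\<^sup>2" using t L0 by (intro power_mono) auto
          finally have "?L * (32 * ln ?L / ?L) \<le> ?t\<^sup>2 * ?D" using D L0 LL by (intro mult_mono) auto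
          thus "exp (- (?t\<^sup>2 * ?D / 8)) \<le> exp (- (4 * ln ?L))" using L0 by simp
        qed (use L0 c0 in auto)
        finally show "prob {\<omega>\<in>space (M n). inner_prod (d n) (X n ed \<omega>) s \<ge> ?t \<and> inner_prod (d n) (X n ed \<omega>) s' \<ge> ?t} \<le> p2 n"
          unfolding p2_def .
      qed
      \<comment> \<open>A fixed vertex is isolated in a fixed direction with probability at least
        \<open>n powr (- c) / exp 1\<close>.\<close>
      have a: "exp (- (c * ?L) - 1) \<le> ?a"
      proof -
        have ph: "0 \<le> ?p" by simp
        have ph2: "?p \<le> 1/2" using p elim by simp
        have "- (c * ?L) - 1 \<le> real n * (- ?p - 2 * ?p\<^sup>2)" using elim(6) unfolding p .
        also have "\<dots> \<le> real n * ln (1 - ?p)"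
          using ln_one_minus_pos_lower_bound[OF ph ph2] by (intro mult_left_mono) auto
        finally have "exp (- (c * ?L) - 1) \<le> exp (real n * ln (1 - ?p))" by simp
        also have "\<dots> = (1 - ?p) ^ n" using ph2 by (simp add: exp_of_nat_mult)
        also have "\<dots> \<le> ?a" using ph ph2 by (intro power_decreasing) auto
        finally show ?thesis .
      qed
      have "?V / (real n * real (card ?F) * ?a) \<le> ?V / (real n * real (card ?F) * exp (- (c * ?L) - 1))"
        using a n g2 unfolding cF by (intro divide_left_mono mult_left_mono mult_pos_pos) (auto intro: less_le_trans[OF exp_gt_zero])
      also have "\<dots> = exp (real ?K * (ln 2 - (1 - \<rho>) * ln (real ?g)) + (c - 1) * ?L + 1)"
      proof -
        have 1: "2 ^ ?K = exp (real ?K * ln 2)" by (simp add: exp_of_nat_mult)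
        have 2: "real ?g powr (\<rho> * real ?K) = exp (\<rho> * real ?K * ln (real ?g))" using g2 by (simp add: powr_def)
        have 3: "real ?g ^ ?K = exp (real ?K * ln (real ?g))" using g2 by (simp add: exp_of_nat_mult)
        have 4: "real n = exp ?L" using n by simp
        have "?V / (real n * real (card ?F) * exp (- (c * ?L) - 1)) =
          exp (real ?K * ln 2 + \<rho> * real ?K * ln (real ?g)) / exp (?L + real ?K * ln (real ?g) + (- (c * ?L) - 1))"
          unfolding cF 1 2 3 exp_add using 4 by simp
        also have "\<dots> = exp (real ?K * (ln 2 - (1 - \<rho>) * ln (real ?g)) + (c - 1) * ?L + 1)"
          unfolding exp_diff[symmetric] by (simp add: algebra_simps)
        finally show ?thesis .
      qed
      also have "\<dots> \<le> exp (1 + \<sigma> * ln ?L / 2 - w * ?L)"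
      proof -
        have "ln (G n - 1) \<le> ln (real ?g)" using g2 G2 by simp
        hence "(1 - \<rho>) * ln (G n - 1) \<le> (1 - \<rho>) * ln (real ?g)" using \<rho> by (intro mult_left_mono) auto
        hence s: "ln 2 - (1 - \<rho>) * ln (real ?g) \<le> - \<sigma> * ln ?L / 2" using elim(5) unfolding G_def by linarith
        have "real ?K * (ln 2 - (1 - \<rho>) * ln (real ?g)) \<le> real ?K * (- \<sigma> * ln ?L / 2)" using s by (intro mult_left_mono) auto
        \<comment> \<open>The multiplier is negative, so the lower bound for \<open>?K\<close> is
          the relevant one; its \<open>- 1\<close> costs only
          \<open>\<sigma> * ln ?L / 2\<close>.\<close>
        also have "\<dots> \<le> (B * ?L / ln ?L - 1) * (- \<sigma> * ln ?L / 2)" using K(1) \<sigma> LL by (intro mult_right_mono_neg) auto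
        also have "\<dots> = - (B * \<sigma> / 2) * ?L + \<sigma> * ln ?L / 2" using LL by (simp add: field_simps)
        finally show ?thesis unfolding w(2) by (simp add: algebra_simps)
      qed
      finally have V: "?V / (real n * real (card ?F) * ?a) \<le> exp (1 + \<sigma> * ln ?L / 2 - w * ?L)" .
      have "prob {\<omega>\<in>space (M n). \<forall>s\<in>unit_sphere (d n). graph_connected (Gam n (d n) (\<lambda>e. X n e \<omega>) s ?t)} \<le> f n"
        using main V unfolding f_def p by linarith
      moreover have "{\<omega>\<in>space (M n). \<exists>s\<in>unit_sphere (d n). \<not> graph_connected (Gam n (d n) (\<lambda>e. X n e \<omega>) s ?t)} \<in> sets (M n)"
        using n measurable_X by (intro measurable_exists_disconnected) auto
      ultimately show ?case using prob_space_axioms unfolding rand_graph_def by simp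
    qed
  qed
qed

section \<open>A connected direction\<close>

text \<open>Fubini: a bound that holds for every frozen value of \<open>B\<close> carries over to
  the random \<open>B\<close>, since \<open>B\<close> is independent of \<open>A\<close>.\<close>

lemma (in prob_space) prob_indep_var_le:
  assumes ind: "indep_var S A T B" and P: "P \<in> sets (S \<Otimes>\<^sub>M T)"
    and le: "\<And>b. b \<in> space T \<Longrightarrow> prob {\<omega>\<in>space M. (A \<omega>, b) \<in> P} \<le> c"
  shows "prob {\<omega>\<in>space M. (A \<omega>, B \<omega>) \<in> P} \<le> c"
proof -
  have A: "A \<in> measurable M S" and B: "B \<in> measurable M T"
    using ind by (auto dest: indep_var_rv1 indep_var_rv2)
  interpret DA: prob_space "distr M S A" by (rule prob_space_distr[OF A])
  interpret DB: prob_space "distr M T B" by (rule prob_space_distr[OF B])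
  interpret pair_sigma_finite "distr M S A" "distr M T B" ..
  have AB: "(\<lambda>\<omega>. (A \<omega>, B \<omega>)) \<in> measurable M (S \<Otimes>\<^sub>M T)" using A B by (rule measurable_Pair)
  have eq: "distr M S A \<Otimes>\<^sub>M distr M T B = distr M (S \<Otimes>\<^sub>M T) (\<lambda>\<omega>. (A \<omega>, B \<omega>))"
    using ind unfolding indep_var_distribution_eq by simp
  have c0: "0 \<le> c"
  proof -
    obtain \<omega> where "\<omega> \<in> space M" using not_empty by blast
    hence "B \<omega> \<in> space T" using B by (rule measurable_space[rotated])
    from le[OF this] show ?thesis using measure_nonneg order_trans by blast
  qed
  have "emeasure M {\<omega>\<in>space M. (A \<omega>, B \<omega>) \<in> P} = emeasure (distr M (S \<Otimes>\<^sub>M T) (\<lambda>\<omega>. (A \<omega>, B \<omega>))) P"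
    using AB P by (subst emeasure_distr) (auto intro!: arg_cong[where f="emeasure M"])
  also have "\<dots> = emeasure (distr M S A \<Otimes>\<^sub>M distr M T B) P" by (simp only: eq)
  also have "\<dots> = (\<integral>\<^sup>+b. emeasure (distr M S A) ((\<lambda>a. (a, b)) -` P) \<partial>distr M T B)"
    using P by (intro emeasure_pair_measure_alt2) simp
  also have "\<dots> \<le> (\<integral>\<^sup>+b. ennreal c \<partial>distr M T B)"
  proof (rule nn_integral_mono)
    fix b assume "b \<in> space (distr M T B)"
    hence b: "b \<in> space T" by simp
    have "(\<lambda>a. (a, b)) -` P \<in> sets S" using P by (rule sets_Pair2)
    hence "emeasure (distr M S A) ((\<lambda>a. (a, b)) -` P) = emeasure M (A -` ((\<lambda>a. (a, b)) -` P) \<inter> space M)"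
      using A by (intro emeasure_distr)
    also have "A -` ((\<lambda>a. (a, b)) -` P) \<inter> space M = {\<omega>\<in>space M. (A \<omega>, b) \<in> P}" by auto
    also have "emeasure M \<dots> \<le> ennreal c" using le[OF b] by (simp add: emeasure_eq_measure ennreal_leI)
    finally show "emeasure (distr M S A) ((\<lambda>a. (a, b)) -` P) \<le> ennreal c" .
  qed
  also have "\<dots> = ennreal c" using DB.emeasure_space_1 by simp
  finally show ?thesis using c0 by (simp add: emeasure_eq_measure)
qed

text \<open>Coordinate \<open>0\<close> is reserved for the graph to be repaired; the tails are independent of it.\<close>

definition tail_sum :: "('e \<Rightarrow> nat \<Rightarrow> real) \<Rightarrow> 'e set \<Rightarrow> nat \<Rightarrow> real" where
  "tail_sum x F = (\<lambda>k. if k = 0 then 0 else \<Sum>e\<in>F. x e k)"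

lemma tail_sum_remove:
  "finite F \<Longrightarrow> e \<in> F \<Longrightarrow> tail_sum x F = (\<lambda>k. tail_sum x {e} k + tail_sum x (F - {e}) k)"
  by (auto simp: tail_sum_def fun_eq_iff sum.remove)

lemma sum_tail_squares:
  "(\<Sum>k<d. (tail_sum x F k)\<^sup>2) = (\<Sum>k\<in>{1..<d}. (\<Sum>e\<in>F. x e k)\<^sup>2)"
proof -
  have "(\<Sum>k\<in>{1..<d}. (\<Sum>e\<in>F. x e k)\<^sup>2) = (\<Sum>k\<in>{1..<d}. (tail_sum x F k)\<^sup>2)"
    by (intro sum.cong) (auto simp: tail_sum_def)
  also have "\<dots> = (\<Sum>k<d. (tail_sum x F k)\<^sup>2)"
    by (intro sum.mono_neutral_left) (auto simp: tail_sum_def not_le)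
  finally show ?thesis ..
qed

lemma inner_tail_self: "inner_prod d (x e) (tail_sum x {e}) = (\<Sum>k<d. (tail_sum x {e} k)\<^sup>2)"
  unfolding inner_prod_def by (intro sum.cong) (auto simp: tail_sum_def power2_eq_square)

section \<open>Signal and noise in sums of tails\<close>

context gauss_array
begin

lemma measurable_tail_sum:
  assumes "F \<subseteq> pairs n" "k < d"
  shows "(\<lambda>\<omega>. tail_sum (\<lambda>e. X e \<omega>) F k) \<in> borel_measurable M"
  unfolding tail_sum_def using assms by (cases "k = 0") (auto intro!: borel_measurable_sum measurable_X)

text \<open>Since \<open>e \<notin> F\<close>, the sum over \<open>F\<close> may be frozen. The
  inner product with a fixed vector is normal with the norm of that vector as standard deviation, so
  \<open>l\<close> counts standard deviations.\<close>

lemma prob_inner_tail_sum_gt: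
  assumes e: "e \<in> pairs n" and F: "F \<subseteq> pairs n" "e \<notin> F" and l: "0 \<le> l"
  shows "prob {\<omega>\<in>space M. \<bar>inner_prod d (X e \<omega>) (tail_sum (\<lambda>e. X e \<omega>) F)\<bar> > l * L2_set (tail_sum (\<lambda>e. X e \<omega>) F) {..<d}}
    \<le> 2 * exp (- l\<^sup>2 / 2)"
proof -
  let ?A = "{e} \<times> {..<d}" and ?B = "F \<times> {..<d}"
  let ?S = "PiM ?A (\<lambda>_. borel :: real measure)" and ?T = "PiM ?B (\<lambda>_. borel :: real measure)"
  let ?x = "\<lambda>y k. y (e, k)" and ?v = "\<lambda>z. tail_sum (\<lambda>f k. z (f, k)) F"
  let ?P = "{p \<in> space (?S \<Otimes>\<^sub>M ?T). \<bar>inner_prod d (?x (fst p)) (?v (snd p))\<bar> > l * L2_set (?v (snd p)) {..<d}}"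
  have mx: "(\<lambda>p. fst p (e, k)) \<in> borel_measurable (?S \<Otimes>\<^sub>M ?T)" if "k < d" for k
    using measurable_compose[OF measurable_fst measurable_component_singleton[of "(e, k)" ?A "\<lambda>_. borel"]] that by simp
  have mz: "(\<lambda>p. snd p (f, k)) \<in> borel_measurable (?S \<Otimes>\<^sub>M ?T)" if "f \<in> F" "k < d" for f k
    using measurable_compose[OF measurable_snd measurable_component_singleton[of "(f, k)" ?B "\<lambda>_. borel"]] that by simp
  have mv: "(\<lambda>p. ?v (snd p) k) \<in> borel_measurable (?S \<Otimes>\<^sub>M ?T)" if "k < d" for k
    unfolding tail_sum_def using that mz by (cases "k = 0") (auto intro!: borel_measurable_sum)
  have mi: "(\<lambda>p. inner_prod d (?x (fst p)) (?v (snd p))) \<in> borel_measurable (?S \<Otimes>\<^sub>M ?T)"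
    unfolding inner_prod_def using mx mv by (intro borel_measurable_sum borel_measurable_times) auto
  have "(\<lambda>p. \<Sum>k<d. (?v (snd p) k)\<^sup>2) \<in> borel_measurable (?S \<Otimes>\<^sub>M ?T)"
    using mv by (intro borel_measurable_sum borel_measurable_power) auto
  hence mL: "(\<lambda>p. L2_set (?v (snd p)) {..<d}) \<in> borel_measurable (?S \<Otimes>\<^sub>M ?T)"
    unfolding L2_set_def by measurable
  have P: "?P \<in> sets (?S \<Otimes>\<^sub>M ?T)" using mi mL by measurable
  have ind: "indep_var ?S (\<lambda>\<omega>. \<lambda>i\<in>?A. X (fst i) \<omega> (snd i)) ?T (\<lambda>\<omega>. \<lambda>i\<in>?B. X (fst i) \<omega> (snd i))"
    using e F by (intro indep_var_restrict[OF indep]) auto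
  have "prob {\<omega>\<in>space M. ((\<lambda>i\<in>?A. X (fst i) \<omega> (snd i)), (\<lambda>i\<in>?B. X (fst i) \<omega> (snd i))) \<in> ?P} \<le> 2 * exp (- l\<^sup>2 / 2)"
  proof (rule prob_indep_var_le[OF ind P])
    fix z assume z: "z \<in> space ?T"
    let ?N = "L2_set (?v z) {..<d}"
    have "{\<omega>\<in>space M. ((\<lambda>i\<in>?A. X (fst i) \<omega> (snd i)), z) \<in> ?P} =
      {\<omega>\<in>space M. \<bar>inner_prod d (X e \<omega>) (?v z)\<bar> > l * ?N}"
      using z by (auto simp: space_pair_measure space_PiM inner_prod_def)
    also have "prob \<dots> \<le> 2 * exp (- l\<^sup>2 / 2)"
    proof (cases "?N = 0")
      case True
      \<comment> \<open>The strict inequality makes the event empty for the zero vector, which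
        cannot be normalised.\<close>
      have "\<bar>inner_prod d (X e \<omega>) (?v z)\<bar> \<le> 0" for \<omega> using inner_prod_le[of d "X e \<omega>" "?v z"] True by simp
      hence "{\<omega>\<in>space M. \<bar>inner_prod d (X e \<omega>) (?v z)\<bar> > l * ?N} = {}" using True by auto
      thus ?thesis by (simp only: measure_empty) simp
    next
      case False
      hence N: "?N > 0" using L2_set_nonneg[of "?v z" "{..<d}"] by linarith
      let ?u = "\<lambda>k. (1 / ?N) * ?v z k"
      have "?N\<^sup>2 = (\<Sum>k<d. (?v z k)\<^sup>2)" by (simp add: L2_set_def sum_nonneg)
      hence "(\<Sum>k<d. (?u k)\<^sup>2) = (1 / ?N)\<^sup>2 * ?N\<^sup>2" by (simp only: power_mult_distrib sum_distrib_left)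
      hence u: "(\<Sum>k<d. (?u k)\<^sup>2) = 1" using N by (simp add: power_divide)
      have "{\<omega>\<in>space M. \<bar>inner_prod d (X e \<omega>) (?v z)\<bar> > l * ?N} \<subseteq> {\<omega>\<in>space M. \<bar>inner_prod d (X e \<omega>) ?u\<bar> \<ge> l}"
        unfolding inner_prod_scale using N by (auto simp: abs_mult le_divide_eq)
      hence "prob {\<omega>\<in>space M. \<bar>inner_prod d (X e \<omega>) (?v z)\<bar> > l * ?N} \<le> prob {\<omega>\<in>space M. \<bar>inner_prod d (X e \<omega>) ?u\<bar> \<ge> l}"
        using measurable_inner[OF e, of ?u] by (intro finite_measure_mono) measurable
      also have "\<dots> \<le> 2 * exp (- l\<^sup>2 / 2)" by (rule prob_std_normal_abs_ge[OF inner_std_normal[OF e u] l])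
      finally show ?thesis .
    qed
    finally show "prob {\<omega>\<in>space M. ((\<lambda>i\<in>?A. X (fst i) \<omega> (snd i)), z) \<in> ?P} \<le> 2 * exp (- l\<^sup>2 / 2)" .
  qed
  also have "{\<omega>\<in>space M. ((\<lambda>i\<in>?A. X (fst i) \<omega> (snd i)), (\<lambda>i\<in>?B. X (fst i) \<omega> (snd i))) \<in> ?P} =
    {\<omega>\<in>space M. \<bar>inner_prod d (X e \<omega>) (tail_sum (\<lambda>e. X e \<omega>) F)\<bar> > l * L2_set (tail_sum (\<lambda>e. X e \<omega>) F) {..<d}}"
  proof -
    have "inner_prod d (\<lambda>k. (\<lambda>i\<in>?A. X (fst i) \<omega> (snd i)) (e, k)) (tail_sum (\<lambda>f k. (\<lambda>i\<in>?B. X (fst i) \<omega> (snd i)) (f, k)) F)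
      = inner_prod d (X e \<omega>) (tail_sum (\<lambda>e. X e \<omega>) F)" for \<omega>
      unfolding inner_prod_def tail_sum_def by (intro sum.cong) auto
    moreover have "L2_set (tail_sum (\<lambda>f k. (\<lambda>i\<in>?B. X (fst i) \<omega> (snd i)) (f, k)) F) {..<d} = L2_set (tail_sum (\<lambda>e. X e \<omega>) F) {..<d}" for \<omega>
      unfolding tail_sum_def by (intro L2_set_cong) auto
    ultimately show ?thesis by (simp add: space_pair_measure space_PiM)
  qed
  finally show ?thesis .
qed

lemma coord_sum_normal:
  assumes F: "F \<subseteq> pairs n" "F \<noteq> {}" and k: "k < d"
  shows "distributed M lborel (\<lambda>\<omega>. \<Sum>e\<in>F. X e \<omega> k) (normal_density 0 (sqrt (real (card F))))"
proof -
  have fF: "finite F" using F by (auto intro: finite_subset)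
  have "indep_vars (\<lambda>e. PiM {(e, k)} (\<lambda>_. borel)) (\<lambda>e \<omega>. \<lambda>i\<in>{(e, k)}. X (fst i) \<omega> (snd i)) F"
    using F k by (intro indep_vars_restrict[OF indep]) (auto simp: disjoint_family_on_def)
  from indep_vars_compose2[OF this, of "\<lambda>e x. x (e, k)" "\<lambda>_. borel"]
  have ind: "indep_vars (\<lambda>_. borel) (\<lambda>e \<omega>. X e \<omega> k) F" by simp
  have "distributed M lborel (\<lambda>\<omega>. \<Sum>e\<in>F. X e \<omega> k) (normal_density (\<Sum>e\<in>F. 0) (sqrt (\<Sum>e\<in>F. 1\<^sup>2)))"
    using F k normal by (intro sum_indep_normal[OF fF F(2) ind]) auto
  thus ?thesis by simp
qed

text \<open>Each of the \<open>d - 1\<close> coordinates of the sum has second moment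
  \<open>card F\<close>, so this is Markov's inequality.\<close>

lemma prob_tail_norm_gt:
  assumes F: "F \<subseteq> pairs n" "F \<noteq> {}" and a: "a > 0"
  shows "prob {\<omega>\<in>space M. (\<Sum>k<d. (tail_sum (\<lambda>e. X e \<omega>) F k)\<^sup>2) \<ge> a} \<le> real (card F) * real (d - 1) / a"
proof -
  have fF: "finite F" using F by (auto intro: finite_subset)
  have m: "0 < sqrt (real (card F))" using F fF by (simp add: card_gt_0_iff)
  have s: "integrable M (\<lambda>\<omega>. (\<Sum>e\<in>F. X e \<omega> k)\<^sup>2)" "expectation (\<lambda>\<omega>. (\<Sum>e\<in>F. X e \<omega> k)\<^sup>2) = real (card F)" if k: "k < d" for k
  proof -
    note D = coord_sum_normal[OF F k]
    have "expectation (\<lambda>\<omega>. \<Sum>e\<in>F. X e \<omega> k) = 0" by (rule normal_distributed_expectation[OF m D])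
    moreover have "variance (\<lambda>\<omega>. \<Sum>e\<in>F. X e \<omega> k) = (sqrt (real (card F)))\<^sup>2" by (rule normal_distributed_variance[OF m D])
    ultimately show v: "expectation (\<lambda>\<omega>. (\<Sum>e\<in>F. X e \<omega> k)\<^sup>2) = real (card F)" by simp
    \<comment> \<open>A nonintegrable function would have integral \<open>0\<close>, whereas the
      second moment just computed is positive.\<close>
    show "integrable M (\<lambda>\<omega>. (\<Sum>e\<in>F. X e \<omega> k)\<^sup>2)"
    proof (rule ccontr)
      assume "\<not> ?thesis"
      from not_integrable_integral_eq[OF this] v m show False by simp
    qed
  qed
  have "prob {\<omega>\<in>space M. (\<Sum>k\<in>{1..<d}. (\<Sum>e\<in>F. X e \<omega> k)\<^sup>2) \<ge> a} \<le> expectation (\<lambda>\<omega>. \<Sum>k\<in>{1..<d}. (\<Sum>e\<in>F. X e \<omega> k)\<^sup>2) / a"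
    using a s by (intro integral_Markov_inequality_measure[where A="{}"]) (auto intro!: sum_nonneg)
  also have "expectation (\<lambda>\<omega>. \<Sum>k\<in>{1..<d}. (\<Sum>e\<in>F. X e \<omega> k)\<^sup>2) = (\<Sum>k\<in>{1..<d}. real (card F))"
    using s by (subst Bochner_Integration.integral_sum) auto
  finally show ?thesis unfolding sum_tail_squares by (simp add: mult.commute)
qed

text \<open>Chernoff's bound with the parameters \<open>- 1 / 2\<close> and \<open>1 / 4\<close>.
  The common rate \<open>1 / 12\<close> is dictated by the lower tail, where
  \<open>ln 2 \<ge> 2 / 3\<close> gives \<open>ln 2 / 2 - 1 / 4 \<ge> 1 / 12\<close>.\<close>

lemma prob_row_norm:
  assumes e: "e \<in> pairs n"
  shows "prob {\<omega>\<in>space M. (\<Sum>k<d. (tail_sum (\<lambda>e. X e \<omega>) {e} k)\<^sup>2) \<le> real (d - 1) / 2} \<le> exp (- real (d - 1) / 12)"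
    "prob {\<omega>\<in>space M. (\<Sum>k<d. (tail_sum (\<lambda>e. X e \<omega>) {e} k)\<^sup>2) \<ge> 4 * real (d - 1)} \<le> exp (- real (d - 1) / 12)"
proof -
  let ?m = "real (d - 1)"
  have l2: "2 / 3 \<le> ln (2::real)" "ln (2::real) \<le> 25 / 36" by (rule ln2_ge_two_thirds, rule ln2_le_25_over_36)
  have K: "{1..<d} \<subseteq> {..<d}" by auto
  have sq2: "sqrt 2 = exp (ln 2 / 2 :: real)"
    by (rule real_sqrt_unique) (simp_all add: exp_double[symmetric] power2_eq_square mult_exp_exp)
  have "prob {\<omega>\<in>space M. (\<Sum>k<d. (tail_sum (\<lambda>e. X e \<omega>) {e} k)\<^sup>2) \<le> ?m / 2} =
     prob {\<omega>\<in>space M. (- (1/2)) * (\<Sum>k\<in>{1..<d}. (X e \<omega> k)\<^sup>2) \<ge> - ?m / 4}"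
    unfolding sum_tail_squares by (intro arg_cong[where f=prob] Collect_cong) auto
  also have "\<dots> \<le> exp (- (- ?m / 4)) * (1 / sqrt (1 - 2 * (- (1/2)))) ^ card {1..<d}"
    by (rule norm_square_tail[OF e _ K]) simp
  also have "\<dots> = exp (?m / 4) * exp (- (ln 2 / 2)) ^ (d - 1)"
    by (simp add: sq2 exp_minus inverse_eq_divide)
  also have "\<dots> = exp (?m * (1/4 - ln 2 / 2))"
    unfolding exp_of_nat_mult[symmetric] exp_add[symmetric] by (simp add: algebra_simps)
  also have "\<dots> \<le> exp (?m * (- 1/12))" using l2 by (simp only: exp_le_cancel_iff) (intro mult_left_mono, auto)
  finally show "prob {\<omega>\<in>space M. (\<Sum>k<d. (tail_sum (\<lambda>e. X e \<omega>) {e} k)\<^sup>2) \<le> ?m / 2} \<le> exp (- ?m / 12)" by simp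
  have "prob {\<omega>\<in>space M. (\<Sum>k<d. (tail_sum (\<lambda>e. X e \<omega>) {e} k)\<^sup>2) \<ge> 4 * ?m} =
     prob {\<omega>\<in>space M. (1/4) * (\<Sum>k\<in>{1..<d}. (X e \<omega> k)\<^sup>2) \<ge> ?m}"
    unfolding sum_tail_squares by (intro arg_cong[where f=prob] Collect_cong) auto
  also have "\<dots> \<le> exp (- ?m) * (1 / sqrt (1 - 2 * (1/4))) ^ card {1..<d}"
    by (rule norm_square_tail[OF e _ K]) simp
  also have "1 / sqrt (1 - 2 * (1/4)) = exp (ln 2 / 2 :: real)" unfolding sq2[symmetric] by (simp add: real_sqrt_divide)
  also have "exp (- ?m) * exp (ln 2 / 2) ^ card {1..<d} = exp (?m * (- 1 + ln 2 / 2))"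
    unfolding exp_of_nat_mult[symmetric] exp_add[symmetric] by (simp add: algebra_simps)
  also have "\<dots> \<le> exp (?m * (- 1/12))" using l2 by (simp only: exp_le_cancel_iff) (intro mult_left_mono, auto)
  finally show "prob {\<omega>\<in>space M. (\<Sum>k<d. (tail_sum (\<lambda>e. X e \<omega>) {e} k)\<^sup>2) \<ge> 4 * ?m} \<le> exp (- ?m / 12)" by simp
qed

end

section \<open>The star that repairs a graph without large empty cuts\<close>

definition no_sparse_cut :: "nat \<Rightarrow> nat \<Rightarrow> (nat \<times> nat) set \<Rightarrow> bool" where
  "no_sparse_cut n h E \<longleftrightarrow>
     \<not> (\<exists>S\<in>{S\<in>Pow {1..n}. h \<le> card S \<and> 2 * card S \<le> n}. E \<inter> cut_set n S = {})"

text \<open>For \<open>h \<le> n\<close> this is the union of the components of \<open>E\<close>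
  that meet \<open>{1..h}\<close>, expressed by cuts so that no paths are needed.\<close>

definition seed_closure :: "nat \<Rightarrow> nat \<Rightarrow> (nat \<times> nat) set \<Rightarrow> nat set" where
  "seed_closure n h E = \<Inter> {S. {1..h} \<subseteq> S \<and> S \<subseteq> {1..n} \<and> E \<inter> cut_set n S = {}}"

text \<open>Adding this star to \<open>E\<close> makes the graph connected. If \<open>E\<close> has no sparse cut, then the closure misses
  fewer than \<open>h\<close> vertices and the star has at most \<open>2 h\<close> edges.\<close>

definition repair_star :: "nat \<Rightarrow> nat \<Rightarrow> (nat \<times> nat) set \<Rightarrow> (nat \<times> nat) set" where
  "repair_star n h E = Pair 1 ` {j \<in> {2..n}. j \<le> h \<or> j \<notin> seed_closure n h E}"

lemma repair_star_subset: "repair_star n h E \<subseteq> pairs n"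
  by (auto simp: repair_star_def pairs_def)

text \<open>An edge that separates the intersection also separates one of the sets that are
  intersected, and these have empty cuts.\<close>

lemma seed_closure_props:
  assumes "h \<le> n"
  shows "{1..h} \<subseteq> seed_closure n h E" "seed_closure n h E \<subseteq> {1..n}" "E \<inter> cut_set n (seed_closure n h E) = {}"
proof -
  show "{1..h} \<subseteq> seed_closure n h E" by (auto simp: seed_closure_def)
  have "{1..n} \<in> {S. {1..h} \<subseteq> S \<and> S \<subseteq> {1..n} \<and> E \<inter> cut_set n S = {}}"
    using assms by (auto simp: cut_set_def pairs_def)
  thus "seed_closure n h E \<subseteq> {1..n}" unfolding seed_closure_def by (rule Inter_lower)
  have cut: "(i, j) \<in> cut_set n S" if "(i, j) \<in> cut_set n T" "(i \<in> S) \<noteq> (j \<in> S)" for i j S T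
    using that by (auto simp: cut_set_def)
  show "E \<inter> cut_set n (seed_closure n h E) = {}"
  proof (rule ccontr)
    assume "E \<inter> cut_set n (seed_closure n h E) \<noteq> {}"
    then obtain i j where ij: "(i, j) \<in> E" "(i, j) \<in> cut_set n (seed_closure n h E)" by auto
    hence "(i \<in> seed_closure n h E) \<noteq> (j \<in> seed_closure n h E)" by (auto simp: cut_set_def)
    then obtain S where S: "{1..h} \<subseteq> S" "S \<subseteq> {1..n}" "E \<inter> cut_set n S = {}" "(i \<in> S) \<noteq> (j \<in> S)"
      unfolding seed_closure_def by blast
    thus False using cut[OF ij(2) S(4)] ij(1) by blast
  qed
qed

text \<open>Take the side with vertex 1 of a cut that is empty for both graphs. The star forces
  \<open>{1..h}\<close> into it, hence the closure as well, and then the vertices outside the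
  closure.\<close>

lemma repair_star_connected:
  assumes h: "1 \<le> h" "h \<le> n"
  shows "cut_connected n (E \<union> repair_star n h E)"
proof -
  note H = seed_closure_props[OF h(2), of E]
  have *: "S = {1..n}" if S: "S \<subseteq> {1..n}" "1 \<in> S" "(E \<union> repair_star n h E) \<inter> cut_set n S = {}" for S
  proof -
    have U: "j \<in> S" if "j \<in> {2..n}" "j \<le> h \<or> j \<notin> seed_closure n h E" for j
    proof (rule ccontr)
      assume "j \<notin> S"
      hence "(1, j) \<in> repair_star n h E \<inter> cut_set n S" using that S(2) by (auto simp: repair_star_def cut_set_def pairs_def)
      thus False using S(3) by blast
    qed
    have "j \<in> S" if "j \<in> {1..h}" for j
      using U[of j] S(2) that h by (cases "j = 1") auto
    hence "{1..h} \<subseteq> S" by blast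
    moreover have "E \<inter> cut_set n S = {}" using S(3) by blast
    ultimately have "seed_closure n h E \<subseteq> S" using S(1) unfolding seed_closure_def by (intro Inter_lower) blast
    moreover have "j \<in> S" if "j \<in> {1..n}" "j \<notin> seed_closure n h E" for j
      using U[of j] S(2) that by (cases "j = 1") auto
    ultimately show ?thesis using S(1) by blast
  qed
  show ?thesis unfolding cut_connected_def
  proof (intro allI impI notI)
    fix S assume S: "S \<subseteq> {1..n}" "S \<noteq> {}" "S \<noteq> {1..n}" "(E \<union> repair_star n h E) \<inter> cut_set n S = {}"
    show False
    proof (cases "1 \<in> S")
      case True thus ?thesis using *[of S] S by blast
    next
      case False
      hence "1 \<in> {1..n} - S" using h by auto
      moreover have "(E \<union> repair_star n h E) \<inter> cut_set n ({1..n} - S) = {}" using S(4) by (simp only: cut_set_compl)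
      ultimately have "{1..n} - S = {1..n}" using *[of "{1..n} - S"] by blast
      thus ?thesis using S by blast
    qed
  qed
qed

lemma card_repair_star:
  assumes h: "h \<le> n" and E: "no_sparse_cut n h E"
  shows "card (repair_star n h E) \<le> 2 * h"
proof -
  note H = seed_closure_props[OF h, of E]
  let ?C = "seed_closure n h E"
  have fC: "finite ?C" using H(2) finite_subset by blast
  have hC: "h \<le> card ?C" using card_mono[OF fC H(1)] by simp
  have cc: "card ({1..n} - ?C) = n - card ?C" using H(2) fC by (simp add: card_Diff_subset)
  have "card ({1..n} - ?C) \<le> h"
  proof (rule ccontr)
    assume n: "\<not> card ({1..n} - ?C) \<le> h"
    show False
    proof (cases "2 * card ?C \<le> n")
      case True
      thus False using E hC H(2,3) unfolding no_sparse_cut_def by blast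
    next
      case False
      hence "2 * card ({1..n} - ?C) \<le> n" using cc by simp
      moreover have "E \<inter> cut_set n ({1..n} - ?C) = {}" using H(3) by (simp only: cut_set_compl)
      moreover have "h \<le> card ({1..n} - ?C)" "{1..n} - ?C \<in> Pow {1..n}" using n by auto
      ultimately show False using E unfolding no_sparse_cut_def by blast
    qed
  qed
  moreover have "repair_star n h E \<subseteq> Pair 1 ` ({1..h} \<union> ({1..n} - ?C))" by (auto simp: repair_star_def)
  hence "card (repair_star n h E) \<le> card (Pair (1::nat) ` ({1..h} \<union> ({1..n} - ?C)))" by (intro card_mono) auto
  moreover have "card (Pair (1::nat) ` ({1..h} \<union> ({1..n} - ?C))) \<le> card ({1..h} \<union> ({1..n} - ?C))" by (rule card_image_le) auto
  moreover have "card ({1..h} \<union> ({1..n} - ?C)) \<le> card {1..h} + card ({1..n} - ?C)" by (rule card_Un_le)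
  ultimately show ?thesis by simp
qed

text \<open>For sets of at least \<open>h\<close> vertices the weight
  \<open>\<theta> ^ card S * exp (- h * ln \<theta>)\<close> is at least \<open>1\<close>. Inserting
  it allows the sum to run over all subsets, where the binomial theorem evaluates it.\<close>

lemma (in random_graph) prob_sparse_cut:
  assumes q: "0 \<le> q" "q \<le> 1" and \<theta>: "1 \<le> \<theta>"
  shows "prob {\<omega>\<in>space M. \<not> no_sparse_cut n h (edges \<omega>)} \<le> exp (real n * (exp (- (q * real n / 2)) * \<theta>) - real h * ln \<theta>)"
    "{\<omega>\<in>space M. \<not> no_sparse_cut n h (edges \<omega>)} \<in> events"
proof -
  let ?F = "{S\<in>Pow {1..n}. h \<le> card S \<and> 2 * card S \<le> n}"
  let ?w = "exp (- (q * real n / 2))"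
  have s: "?F \<subseteq> Pow {1..n}" by auto
  show "{\<omega>\<in>space M. \<not> no_sparse_cut n h (edges \<omega>)} \<in> events"
    unfolding no_sparse_cut_def not_not by (rule prob_empty_cut(2)[OF s])
  have "prob {\<omega>\<in>space M. \<not> no_sparse_cut n h (edges \<omega>)} \<le> (\<Sum>S\<in>?F. (1 - q) ^ (card S * (n - card S)))"
    unfolding no_sparse_cut_def not_not by (rule prob_empty_cut(1)[OF s])
  also have "\<dots> \<le> (\<Sum>S\<in>?F. (?w * \<theta>) ^ card S * exp (- (real h * ln \<theta>)))"
  proof (rule sum_mono)
    fix S assume S: "S \<in> ?F"
    let ?k = "card S"
    have "(1 - q) ^ (?k * (n - ?k)) \<le> exp (- (q * real (?k * (n - ?k))))" by (rule one_minus_power_le_exp[OF q])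
    also have "\<dots> \<le> exp (real ?k * (- (q * real n / 2)))"
    proof -
      have "real n / 2 \<le> real (n - ?k)" using S by (simp add: of_nat_diff)
      hence "q * real ?k * (real n / 2) \<le> q * real ?k * real (n - ?k)" using q by (intro mult_left_mono) auto
      thus ?thesis by (simp add: mult_ac)
    qed
    also have "\<dots> = ?w ^ ?k" by (rule exp_of_nat_mult)
    also have "\<dots> \<le> ?w ^ ?k * (\<theta> ^ ?k * exp (- (real h * ln \<theta>)))"
    proof -
      have "\<theta> ^ ?k * exp (- (real h * ln \<theta>)) = exp (real ?k * ln \<theta> + - (real h * ln \<theta>))"
        unfolding exp_add using \<theta> by (simp add: exp_of_nat_mult)
      also have "\<dots> \<ge> exp 0" using S \<theta> by (simp only: exp_le_cancel_iff) (simp add: mult_right_mono)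
      finally have "1 \<le> \<theta> ^ ?k * exp (- (real h * ln \<theta>))" by simp
      hence "?w ^ ?k * 1 \<le> ?w ^ ?k * (\<theta> ^ ?k * exp (- (real h * ln \<theta>)))" by (intro mult_left_mono) auto
      thus ?thesis by simp
    qed
    finally show "(1 - q) ^ (?k * (n - ?k)) \<le> (?w * \<theta>) ^ ?k * exp (- (real h * ln \<theta>))"
      by (simp add: power_mult_distrib mult_ac)
  qed
  also have "\<dots> \<le> (\<Sum>S\<in>Pow {1..n}. (?w * \<theta>) ^ card S * exp (- (real h * ln \<theta>)))"
    using \<theta> by (intro sum_mono2) auto
  also have "\<dots> = (1 + ?w * \<theta>) ^ n * exp (- (real h * ln \<theta>))"
    by (subst sum_distrib_right[symmetric]) (simp add: sum_power_card_Pow)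
  also have "\<dots> \<le> exp (?w * \<theta>) ^ n * exp (- (real h * ln \<theta>))"
    using \<theta> by (intro mult_right_mono power_mono exp_ge_add_one_self) auto
  also have "\<dots> = exp (real n * (?w * \<theta>) - real h * ln \<theta>)"
    by (simp add: exp_of_nat_mult[symmetric] exp_diff exp_minus inverse_eq_divide)
  finally show "prob {\<omega>\<in>space M. \<not> no_sparse_cut n h (edges \<omega>)} \<le> exp (real n * (?w * \<theta>) - real h * ln \<theta>)" .
qed

text \<open>The first clause is a lack of signal, the next two are norms that are too large, and the
  last is noise. Removing \<open>e\<close> from \<open>F\<close> in the last clause lets it serve
  both kinds of edges: inside \<open>F\<close> it takes away the edge's own contribution, and
  outside \<open>F\<close> it changes nothing.\<close>

definition bad_tails :: "nat \<Rightarrow> nat \<Rightarrow> real \<Rightarrow> real \<Rightarrow> (nat \<times> nat) set \<Rightarrow> (nat \<times> nat \<Rightarrow> nat \<Rightarrow> real) \<Rightarrow> bool" where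
  "bad_tails n d l R F x \<longleftrightarrow>
     (\<exists>e\<in>F. (\<Sum>k<d. (tail_sum x {e} k)\<^sup>2) \<le> real (d - 1) / 2) \<or>
     (\<exists>e\<in>F. (\<Sum>k<d. (tail_sum x {e} k)\<^sup>2) \<ge> 4 * real (d - 1)) \<or>
     (\<Sum>k<d. (tail_sum x F k)\<^sup>2) \<ge> R\<^sup>2 \<or>
     (\<exists>e\<in>pairs n. \<bar>inner_prod d (x e) (tail_sum x (F - {e}))\<bar> > l * L2_set (tail_sum x (F - {e})) {..<d})"

lemma inner_tail_sum: "inner_prod d y (tail_sum x F) = (\<Sum>k\<in>{1..<d}. y k * (\<Sum>e\<in>F. x e k))"
proof -
  have "(\<Sum>k\<in>{1..<d}. y k * (\<Sum>e\<in>F. x e k)) = (\<Sum>k\<in>{1..<d}. y k * tail_sum x F k)"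
    by (intro sum.cong) (auto simp: tail_sum_def)
  also have "\<dots> = inner_prod d y (tail_sum x F)"
    unfolding inner_prod_def by (intro sum.mono_neutral_left) (auto simp: tail_sum_def not_le)
  finally show ?thesis ..
qed

text \<open>Coordinate 0 does not enter, which is why the event is independent of the graph given by
  the first coordinates.\<close>

lemma bad_tails_cong:
  assumes "F \<subseteq> pairs n" "\<And>e k. e \<in> pairs n \<Longrightarrow> 1 \<le> k \<Longrightarrow> k < d \<Longrightarrow> x e k = x' e k"
  shows "bad_tails n d l R F x \<longleftrightarrow> bad_tails n d l R F x'"
proof -
  have s: "(\<Sum>f\<in>F'. x f k) = (\<Sum>f\<in>F'. x' f k)" if "F' \<subseteq> pairs n" "k \<in> {1..<d}" for F' k
    using that assms by (intro sum.cong) auto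
  have 1: "(\<Sum>k<d. (tail_sum x F' k)\<^sup>2) = (\<Sum>k<d. (tail_sum x' F' k)\<^sup>2)" if "F' \<subseteq> pairs n" for F'
    unfolding sum_tail_squares by (intro sum.cong refl) (simp only: s[OF that])
  have 2: "L2_set (tail_sum x F') {..<d} = L2_set (tail_sum x' F') {..<d}" if "F' \<subseteq> pairs n" for F'
    unfolding L2_set_def using 1[OF that] by simp
  have 3: "inner_prod d (x e) (tail_sum x F') = inner_prod d (x' e) (tail_sum x' F')" if "F' \<subseteq> pairs n" "e \<in> pairs n" for F' e
    unfolding inner_tail_sum using assms that by (intro sum.cong refl) (simp only: s[OF that(1)], simp)
  have "F - {e} \<subseteq> pairs n" "\<And>e. e \<in> F \<Longrightarrow> {e} \<subseteq> pairs n" for e using assms(1) by auto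
  thus ?thesis unfolding bad_tails_def using 1 2 3 assms(1) by (simp cong: bex_cong)
qed

text \<open>Stated over an arbitrary space \<open>N\<close>, because it is needed both on
  \<open>M\<close> and on the product space of the tail coordinates.\<close>

lemma measurable_bad_tails:
  assumes F: "F \<subseteq> pairs n" and X: "\<And>e k. e \<in> pairs n \<Longrightarrow> 1 \<le> k \<Longrightarrow> k < d \<Longrightarrow> (\<lambda>\<omega>. x \<omega> e k) \<in> borel_measurable N"
  shows "Measurable.pred N (\<lambda>\<omega>. bad_tails n d l R F (x \<omega>))"
proof -
  have fF: "finite F" using F by (rule finite_subset) simp
  have s: "(\<lambda>\<omega>. \<Sum>f\<in>F'. x \<omega> f k) \<in> borel_measurable N" if "F' \<subseteq> pairs n" "k \<in> {1..<d}" for F' k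
    using that X by (intro borel_measurable_sum) auto
  have 1: "(\<lambda>\<omega>. \<Sum>k<d. (tail_sum (x \<omega>) F' k)\<^sup>2) \<in> borel_measurable N" if "F' \<subseteq> pairs n" for F'
    unfolding sum_tail_squares by (rule borel_measurable_sum, rule borel_measurable_power, rule s[OF that])
  have 2: "(\<lambda>\<omega>. L2_set (tail_sum (x \<omega>) F') {..<d}) \<in> borel_measurable N" if "F' \<subseteq> pairs n" for F'
    unfolding L2_set_def using 1[OF that] by measurable
  have 3: "(\<lambda>\<omega>. \<bar>inner_prod d (x \<omega> e) (tail_sum (x \<omega>) F')\<bar>) \<in> borel_measurable N" if "F' \<subseteq> pairs n" "e \<in> pairs n" for F' e
    unfolding inner_tail_sum
    by (rule borel_measurable_abs, rule borel_measurable_sum, rule borel_measurable_times, rule X[OF that(2)])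
      (use s[OF that(1)] in auto)
  have row: "Measurable.pred N (\<lambda>\<omega>. (\<Sum>k<d. (tail_sum (x \<omega>) {e} k)\<^sup>2) \<le> real (d - 1) / 2)"
    "Measurable.pred N (\<lambda>\<omega>. (\<Sum>k<d. (tail_sum (x \<omega>) {e} k)\<^sup>2) \<ge> 4 * real (d - 1))" if "e \<in> F" for e
  proof -
    have [measurable]: "(\<lambda>\<omega>. \<Sum>k<d. (tail_sum (x \<omega>) {e} k)\<^sup>2) \<in> borel_measurable N" using that F by (intro 1) auto
    show "Measurable.pred N (\<lambda>\<omega>. (\<Sum>k<d. (tail_sum (x \<omega>) {e} k)\<^sup>2) \<le> real (d - 1) / 2)"
      "Measurable.pred N (\<lambda>\<omega>. (\<Sum>k<d. (tail_sum (x \<omega>) {e} k)\<^sup>2) \<ge> 4 * real (d - 1))" by measurable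
  qed
  have [measurable]: "Measurable.pred N (\<lambda>\<omega>. \<exists>e\<in>F. (\<Sum>k<d. (tail_sum (x \<omega>) {e} k)\<^sup>2) \<le> real (d - 1) / 2)"
    "Measurable.pred N (\<lambda>\<omega>. \<exists>e\<in>F. (\<Sum>k<d. (tail_sum (x \<omega>) {e} k)\<^sup>2) \<ge> 4 * real (d - 1))"
    by (rule pred_intros_finite(4)[OF fF row(1)] pred_intros_finite(4)[OF fF row(2)]; assumption)+
  have [measurable]: "(\<lambda>\<omega>. \<Sum>k<d. (tail_sum (x \<omega>) F k)\<^sup>2) \<in> borel_measurable N" by (rule 1[OF F])
  have "Measurable.pred N (\<lambda>\<omega>. \<bar>inner_prod d (x \<omega> e) (tail_sum (x \<omega>) (F - {e}))\<bar> > l * L2_set (tail_sum (x \<omega>) (F - {e})) {..<d})"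
    if "e \<in> pairs n" for e
  proof -
    have Fe: "F - {e} \<subseteq> pairs n" using F by auto
    show ?thesis using 2[OF Fe] 3[OF Fe that] by measurable
  qed
  hence [measurable]: "Measurable.pred N (\<lambda>\<omega>. \<exists>e\<in>pairs n. \<bar>inner_prod d (x \<omega> e) (tail_sum (x \<omega>) (F - {e}))\<bar> > l * L2_set (tail_sum (x \<omega>) (F - {e})) {..<d})"
    by (rule pred_intros_finite(4)[OF finite_pairs])
  show ?thesis unfolding bad_tails_def by measurable
qed

text \<open>The direction is \<open>sqrt (1 - b\<^sup>2)\<close> times the first axis plus \<open>b\<close> times the normalised sum of the tails over \<open>F\<close>:
  edges of \<open>G\<close> survive because their first coordinate has slack, edges of \<open>F\<close> are pushed over the threshold.\<close>

lemma exists_direction: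
  assumes d: "d \<ge> 2" and F: "F \<subseteq> pairs n" "F \<noteq> {}" and good: "\<not> bad_tails n d l R F x"
    and Z: "\<And>e. e \<in> pairs n \<Longrightarrow> \<bar>x e 0\<bar> \<le> l" and G: "\<And>e. e \<in> G \<Longrightarrow> e \<in> pairs n \<and> x e 0 \<ge> \<tau>"
    and b: "0 \<le> b" "b \<le> 1" and l: "0 \<le> l" and R: "0 < R" and \<tau>: "0 \<le> \<tau>"
    and A: "t \<le> sqrt (1 - b\<^sup>2) * \<tau> - b * l"
    and Q: "0 < Q" "Q \<le> real (d - 1) / 2 - l * (R + 2 * sqrt (real (d - 1)))" and B: "t + l \<le> b * Q / R"
  shows "\<exists>s\<in>unit_sphere d. \<forall>e\<in>G \<union> F. inner_prod d (x e) s \<ge> t"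
proof -
  have fF: "finite F" using F(1) by (rule finite_subset) simp
  let ?V = "tail_sum x F"
  let ?L = "\<lambda>v. L2_set v {..<d}"
  let ?N = "?L ?V"
  have sq: "(?L v)\<^sup>2 = (\<Sum>k<d. (v k)\<^sup>2)" for v :: "nat \<Rightarrow> real" by (simp add: L2_set_def sum_nonneg)
  have g: "(?L (tail_sum x {e}))\<^sup>2 > real (d - 1) / 2" "(?L (tail_sum x {e}))\<^sup>2 < 4 * real (d - 1)" if "e \<in> F" for e
    using good that unfolding bad_tails_def sq by (auto simp: not_le)
  have NR: "?N < R"
  proof -
    have "?N\<^sup>2 < R\<^sup>2" using good unfolding bad_tails_def sq by (auto simp: not_le)
    thus ?thesis using R by (intro power_less_imp_less_base[of _ 2 R]) auto
  qed
  have noise: "\<bar>inner_prod d (x e) (tail_sum x (F - {e}))\<bar> \<le> l * ?L (tail_sum x (F - {e}))" if "e \<in> pairs n" for e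
    using good that unfolding bad_tails_def by (auto simp: not_less)
  \<comment> \<open>The edge's own tail contributes its squared norm, at least
    \<open>(d - 1) / 2\<close>; the other summands are noise of at most \<open>l\<close> times their
    norm, which the triangle inequality bounds.\<close>
  have inF: "Q \<le> inner_prod d (x e) ?V" if e: "e \<in> F" for e
  proof -
    have ep: "e \<in> pairs n" using e F by auto
    have V: "?V = (\<lambda>k. tail_sum x {e} k + tail_sum x (F - {e}) k)" by (rule tail_sum_remove[OF fF e])
    have T: "?L (tail_sum x {e}) \<le> 2 * sqrt (real (d - 1))"
    proof -
      have "?L (tail_sum x {e}) \<le> sqrt (4 * real (d - 1))" using g(2)[OF e] by (intro real_le_rsqrt) simp
      thus ?thesis by (simp add: real_sqrt_mult)
    qed
    have "tail_sum x (F - {e}) = (\<lambda>k. ?V k + - tail_sum x {e} k)" unfolding V by simp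
    hence "?L (tail_sum x (F - {e})) \<le> ?N + ?L (\<lambda>k. - tail_sum x {e} k)"
      using L2_set_triangle_ineq[of ?V "\<lambda>k. - tail_sum x {e} k" "{..<d}"] by simp
    also have "?L (\<lambda>k. - tail_sum x {e} k) = ?L (tail_sum x {e})" by (simp add: L2_set_def)
    finally have "?L (tail_sum x (F - {e})) \<le> R + 2 * sqrt (real (d - 1))" using NR T by linarith
    hence "l * ?L (tail_sum x (F - {e})) \<le> l * (R + 2 * sqrt (real (d - 1)))" using l by (rule mult_left_mono)
    moreover have "inner_prod d (x e) ?V = inner_prod d (x e) (tail_sum x {e}) + inner_prod d (x e) (tail_sum x (F - {e}))"
      by (subst V) (rule inner_prod_add)
    moreover have "inner_prod d (x e) (tail_sum x {e}) > real (d - 1) / 2" using g(1)[OF e] unfolding inner_tail_self sq .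
    ultimately show ?thesis using noise[OF ep] Q(2) by linarith
  qed
  have N: "?N > 0"
  proof -
    obtain e where e: "e \<in> F" using F by auto
    have "0 < \<bar>inner_prod d (x e) ?V\<bar>" using inF[OF e] Q by linarith
    also have "\<dots> \<le> ?L (x e) * ?N" by (rule inner_prod_le)
    finally have "?N \<noteq> 0" by auto
    thus ?thesis using L2_set_nonneg[of ?V "{..<d}"] by linarith
  qed
  define a where "a = sqrt (1 - b\<^sup>2)"
  have b2: "b\<^sup>2 \<le> 1" using b by (simp add: power_le_one)
  have a: "0 \<le> a" "a \<le> 1" "a\<^sup>2 + b\<^sup>2 = 1" using b2 by (auto simp: a_def)
  define s where "s = (\<lambda>k\<in>{..<d}. (if k = 0 then a else 0) + b / ?N * ?V k)"
  have s0: "(s k)\<^sup>2 = (if k = 0 then a\<^sup>2 else 0) + (b / ?N)\<^sup>2 * (?V k)\<^sup>2" if "k < d" for k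
  proof (cases "k = 0")
    case True thus ?thesis using that by (simp add: s_def tail_sum_def)
  next
    case False
    hence "s k = b / ?N * ?V k" using that by (simp add: s_def)
    thus ?thesis using False by (simp only: power_mult_distrib if_False add_0)
  qed
  have "(\<Sum>k<d. (s k)\<^sup>2) = (\<Sum>k<d. (if k = 0 then a\<^sup>2 else 0) + (b / ?N)\<^sup>2 * (?V k)\<^sup>2)"
    by (intro sum.cong refl s0) simp
  also have "\<dots> = a\<^sup>2 + (b / ?N)\<^sup>2 * ?N\<^sup>2"
    using d unfolding sum.distrib sum_distrib_left[symmetric] sq by simp
  also have "\<dots> = 1" using N a by (simp add: power_divide)
  finally have s1: "s \<in> unit_sphere d" by (simp add: unit_sphere_iff s_def)
  have ip: "inner_prod d y s = a * y 0 + b / ?N * inner_prod d y ?V" for y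
  proof -
    have "inner_prod d y s = inner_prod d y (\<lambda>k. (if k = 0 then a else 0) + b / ?N * ?V k)"
      by (rule inner_prod_cong) (simp add: s_def)
    also have "\<dots> = inner_prod d y (\<lambda>k. if k = 0 then a else 0) + b / ?N * inner_prod d y ?V"
      unfolding inner_prod_add inner_prod_scale ..
    also have "inner_prod d y (\<lambda>k. if k = 0 then a else 0) = (\<Sum>k<d. if k = 0 then y 0 * a else 0)"
      unfolding inner_prod_def by (intro sum.cong) auto
    also have "\<dots> = a * y 0" using d by (simp add: mult.commute)
    finally show ?thesis .
  qed
  have "inner_prod d (x e) s \<ge> t" if e: "e \<in> G \<union> F" for e
  proof (cases "e \<in> F")
    case True
    hence ep: "e \<in> pairs n" using F by auto
    \<comment> \<open>On \<open>F\<close> nothing is known about the first coordinate but its size,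
      which is why \<open>B\<close> asks for \<open>t + l\<close> and not just
      \<open>t\<close>.\<close>
    have "- l \<le> a * x e 0"
    proof -
      have "\<bar>a * x e 0\<bar> \<le> 1 * l" unfolding abs_mult using a Z[OF ep] by (intro mult_mono) auto
      thus ?thesis by linarith
    qed
    moreover have "b * Q / R \<le> b / ?N * inner_prod d (x e) ?V"
    proof -
      have "b * Q / R \<le> b * Q / ?N" using b Q N NR R by (intro divide_left_mono) auto
      also have "\<dots> = b / ?N * Q" by simp
      also have "\<dots> \<le> b / ?N * inner_prod d (x e) ?V" using inF[OF True] b N by (intro mult_left_mono) auto
      finally show ?thesis .
    qed
    ultimately show ?thesis unfolding ip using B by linarith
  next
    case False
    hence e: "e \<in> pairs n" "x e 0 \<ge> \<tau>" using e G by auto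
    have "F - {e} = F" using False by auto
    hence "\<bar>inner_prod d (x e) ?V\<bar> \<le> l * ?N" using noise[OF e(1)] by simp
    hence "b / ?N * (- (l * ?N)) \<le> b / ?N * inner_prod d (x e) ?V" using b N by (intro mult_left_mono) auto
    hence "- (b * l) \<le> b / ?N * inner_prod d (x e) ?V" using N by simp
    moreover have "a * \<tau> \<le> a * x e 0" using a e by (intro mult_left_mono) auto
    ultimately show ?thesis unfolding ip using A unfolding a_def by linarith
  qed
  with s1 show ?thesis by blast
qed

section \<open>The graph of the first coordinates and the tails together\<close>

context gauss_array
begin

definition head_edges :: "real \<Rightarrow> 'w \<Rightarrow> (nat \<times> nat) set" where
  "head_edges \<tau> \<omega> = {e \<in> pairs n. X e \<omega> 0 \<ge> \<tau>}"

text \<open>This is the graph in the direction of the first axis.\<close>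

lemma random_graph_head:
  assumes d: "d \<ge> 1"
  shows "random_graph M n (gtail \<tau>) (\<lambda>e \<omega>. X e \<omega> 0 \<ge> \<tau>)"
    "random_graph.edges n (\<lambda>e \<omega>. X e \<omega> 0 \<ge> \<tau>) \<omega> = head_edges \<tau> \<omega>"
proof -
  let ?u = "\<lambda>k::nat. if k = 0 then 1 else 0 :: real"
  have u: "inner_prod d y ?u = y 0" for y
  proof -
    have "inner_prod d y ?u = (\<Sum>k<d. if k = 0 then y 0 else 0)" unfolding inner_prod_def by (intro sum.cong) auto
    thus ?thesis using d by simp
  qed
  have "(\<Sum>k<d. (?u k)\<^sup>2) = (\<Sum>k<d. if k = 0 then 1 else 0)" by (intro sum.cong) auto
  hence "(\<Sum>k<d. (?u k)\<^sup>2) = 1" using d by simp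
  from random_graph_inner[OF this, of \<tau>] show r: "random_graph M n (gtail \<tau>) (\<lambda>e \<omega>. X e \<omega> 0 \<ge> \<tau>)" unfolding u .
  show "random_graph.edges n (\<lambda>e \<omega>. X e \<omega> 0 \<ge> \<tau>) \<omega> = head_edges \<tau> \<omega>"
    by (simp add: random_graph.edges_def[OF r] head_edges_def)
qed

lemma measurable_head_edges:
  assumes d: "d \<ge> 1" and G: "G \<subseteq> pairs n" shows "{\<omega>\<in>space M. head_edges \<tau> \<omega> = G} \<in> events"
proof -
  have "Measurable.pred M (\<lambda>\<omega>. (X e \<omega> 0 \<ge> \<tau>) = (e \<in> G))" if e: "e \<in> pairs n" for e
    using measurable_X[OF e, of 0] d by (cases "e \<in> G") (simp_all, measurable)
  hence "Measurable.pred M (\<lambda>\<omega>. \<forall>e\<in>pairs n. (X e \<omega> 0 \<ge> \<tau>) = (e \<in> G))"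
    by (rule pred_intros_finite(3)[OF finite_pairs])
  moreover have "(\<forall>e\<in>pairs n. (X e \<omega> 0 \<ge> \<tau>) = (e \<in> G)) \<longleftrightarrow> head_edges \<tau> \<omega> = G" for \<omega>
    using G by (auto simp: head_edges_def)
  ultimately show ?thesis by (simp add: pred_def)
qed

text \<open>The two events depend on disjoint blocks of one independent family: coordinate 0, and
  the coordinates from 1 on. \<open>F\<close> has to be a fixed set here.\<close>

lemma head_bad_indep:
  assumes F: "F \<subseteq> pairs n" and d: "d \<ge> 1" and G: "G \<subseteq> pairs n"
  shows "prob ({\<omega>\<in>space M. head_edges \<tau> \<omega> = G} \<inter> {\<omega>\<in>space M. bad_tails n d l R F (\<lambda>e. X e \<omega>)})
    = prob {\<omega>\<in>space M. head_edges \<tau> \<omega> = G} * prob {\<omega>\<in>space M. bad_tails n d l R F (\<lambda>e. X e \<omega>)}"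
proof -
  let ?A = "pairs n \<times> {0::nat}" and ?B = "pairs n \<times> {1..<d}"
  let ?S = "PiM ?A (\<lambda>_. borel :: real measure)" and ?T = "PiM ?B (\<lambda>_. borel :: real measure)"
  let ?Y = "\<lambda>C \<omega>. \<lambda>i\<in>C. X (fst i) \<omega> (snd i)"
  have ind: "indep_var ?S (?Y ?A) ?T (?Y ?B)"
    using d by (intro indep_var_restrict[OF indep]) auto
  let ?P = "{z\<in>space ?S. \<forall>e\<in>pairs n. (z (e, 0) \<ge> \<tau>) = (e \<in> G)}"
  let ?Q = "{z\<in>space ?T. bad_tails n d l R F (\<lambda>e k. z (e, k))}"
  have "Measurable.pred ?S (\<lambda>z. (z (e, 0) \<ge> \<tau>) = (e \<in> G))" if e: "e \<in> pairs n" for e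
  proof -
    have "(\<lambda>z. z (e, 0)) \<in> borel_measurable ?S" using e by (intro measurable_component_singleton) auto
    thus ?thesis by (cases "e \<in> G") (simp_all, measurable)
  qed
  hence "Measurable.pred ?S (\<lambda>z. \<forall>e\<in>pairs n. (z (e, 0) \<ge> \<tau>) = (e \<in> G))"
    by (rule pred_intros_finite(3)[OF finite_pairs])
  hence P: "?P \<in> sets ?S" by (simp add: pred_def)
  have "Measurable.pred ?T (\<lambda>z. bad_tails n d l R F (\<lambda>e k. z (e, k)))"
    using F by (intro measurable_bad_tails measurable_component_singleton) auto
  hence Q: "?Q \<in> sets ?T" by (simp add: pred_def)
  have 1: "?Y ?A -` ?P \<inter> space M = {\<omega>\<in>space M. head_edges \<tau> \<omega> = G}"
    using G by (auto simp: space_PiM head_edges_def)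
  have "bad_tails n d l R F (\<lambda>e k. ?Y ?B \<omega> (e, k)) \<longleftrightarrow> bad_tails n d l R F (\<lambda>e. X e \<omega>)" for \<omega>
    by (rule bad_tails_cong[OF F]) auto
  hence 2: "?Y ?B -` ?Q \<inter> space M = {\<omega>\<in>space M. bad_tails n d l R F (\<lambda>e. X e \<omega>)}"
    by (auto simp: space_PiM)
  have "(\<lambda>\<omega>. (?Y ?A \<omega>, ?Y ?B \<omega>)) -` (?P \<times> ?Q) \<inter> space M = (?Y ?A -` ?P \<inter> space M) \<inter> (?Y ?B -` ?Q \<inter> space M)" by blast
  thus ?thesis using indep_varD[OF ind P Q] unfolding 1 2 by simp
qed

text \<open>A union bound over the four clauses. \<open>\<Lambda>\<close> is the room given to
  Markov's inequality: \<open>R\<^sup>2\<close> is \<open>\<Lambda>\<close> times the bound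
  \<open>m * (d - 1)\<close> on the mean squared norm.\<close>

lemma prob_bad_tails:
  assumes F: "F \<subseteq> pairs n" "F \<noteq> {}" "real (card F) \<le> m" and d: "d \<ge> 2" and l: "0 \<le> l" and \<Lambda>: "\<Lambda> > 0"
    and R: "R\<^sup>2 = m * real (d - 1) * \<Lambda>"
  shows "prob {\<omega>\<in>space M. bad_tails n d l R F (\<lambda>e. X e \<omega>)} \<le>
    2 * m * exp (- real (d - 1) / 12) + 1 / \<Lambda> + 2 * (real n)\<^sup>2 * exp (- l\<^sup>2 / 2)"
proof -
  have fF: "finite F" using F(1) by (rule finite_subset) simp
  have m0: "m > 0" using F fF by (metis card_gt_0_iff less_le_trans of_nat_0_less_iff)
  have d1: "real (d - 1) > 0" using d by simp
  let ?x = "\<lambda>\<omega> e. X e \<omega>"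
  let ?E1 = "\<lambda>e. {\<omega>\<in>space M. (\<Sum>k<d. (tail_sum (?x \<omega>) {e} k)\<^sup>2) \<le> real (d - 1) / 2}"
  let ?E2 = "\<lambda>e. {\<omega>\<in>space M. (\<Sum>k<d. (tail_sum (?x \<omega>) {e} k)\<^sup>2) \<ge> 4 * real (d - 1)}"
  let ?E3 = "{\<omega>\<in>space M. (\<Sum>k<d. (tail_sum (?x \<omega>) F k)\<^sup>2) \<ge> R\<^sup>2}"
  let ?E4 = "\<lambda>e. {\<omega>\<in>space M. \<bar>inner_prod d (X e \<omega>) (tail_sum (?x \<omega>) (F - {e}))\<bar> > l * L2_set (tail_sum (?x \<omega>) (F - {e})) {..<d}}"
  have sm: "(\<lambda>\<omega>. \<Sum>k<d. (tail_sum (?x \<omega>) F' k)\<^sup>2) \<in> borel_measurable M" if "F' \<subseteq> pairs n" for F'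
    using measurable_tail_sum[OF that] by (intro borel_measurable_sum borel_measurable_power) auto
  have E12: "?E1 e \<in> events" "?E2 e \<in> events" if "e \<in> F" for e
  proof -
    have "(\<lambda>\<omega>. \<Sum>k<d. (tail_sum (?x \<omega>) {e} k)\<^sup>2) \<in> borel_measurable M" using that F by (intro sm) auto
    thus "?E1 e \<in> events" "?E2 e \<in> events" by measurable
  qed
  have E3: "?E3 \<in> events" using sm[OF F(1)] by measurable
  have E4: "?E4 e \<in> events" if e: "e \<in> pairs n" for e
  proof -
    have Fe: "F - {e} \<subseteq> pairs n" using F by auto
    have "(\<lambda>\<omega>. L2_set (tail_sum (?x \<omega>) (F - {e})) {..<d}) \<in> borel_measurable M"
      unfolding L2_set_def using sm[OF Fe] by measurable
    moreover have "(\<lambda>\<omega>. inner_prod d (X e \<omega>) (tail_sum (?x \<omega>) (F - {e}))) \<in> borel_measurable M"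
      unfolding inner_prod_def using e measurable_tail_sum[OF Fe] by (intro borel_measurable_sum borel_measurable_times measurable_X) auto
    ultimately show ?thesis by measurable
  qed
  have eq: "{\<omega>\<in>space M. bad_tails n d l R F (?x \<omega>)} = ((\<Union>e\<in>F. ?E1 e) \<union> (\<Union>e\<in>F. ?E2 e)) \<union> (?E3 \<union> (\<Union>e\<in>pairs n. ?E4 e))"
    unfolding bad_tails_def by blast
  have "prob {\<omega>\<in>space M. bad_tails n d l R F (?x \<omega>)} \<le> prob ((\<Union>e\<in>F. ?E1 e) \<union> (\<Union>e\<in>F. ?E2 e)) + prob (?E3 \<union> (\<Union>e\<in>pairs n. ?E4 e))"
    unfolding eq using E12 E3 E4 by (intro measure_Un_le sets.Un sets.finite_UN fF finite_pairs)
  also have "prob ((\<Union>e\<in>F. ?E1 e) \<union> (\<Union>e\<in>F. ?E2 e)) \<le> prob (\<Union>e\<in>F. ?E1 e) + prob (\<Union>e\<in>F. ?E2 e)"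
    using E12 by (intro measure_Un_le sets.finite_UN fF)
  also have "prob (\<Union>e\<in>F. ?E1 e) \<le> (\<Sum>e\<in>F. prob (?E1 e))"
    using E12 by (intro finite_measure_subadditive_finite fF) auto
  also have "\<dots> \<le> (\<Sum>e\<in>F. exp (- real (d - 1) / 12))"
    using F by (intro sum_mono prob_row_norm) auto
  also have "\<dots> \<le> m * exp (- real (d - 1) / 12)" using F(3) by (simp add: mult_right_mono)
  also have "prob (\<Union>e\<in>F. ?E2 e) \<le> (\<Sum>e\<in>F. prob (?E2 e))"
    using E12 by (intro finite_measure_subadditive_finite fF) auto
  also have "\<dots> \<le> (\<Sum>e\<in>F. exp (- real (d - 1) / 12))"
    using F by (intro sum_mono prob_row_norm) auto
  also have "\<dots> \<le> m * exp (- real (d - 1) / 12)" using F(3) by (simp add: mult_right_mono)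
  also have "prob (?E3 \<union> (\<Union>e\<in>pairs n. ?E4 e)) \<le> prob ?E3 + prob (\<Union>e\<in>pairs n. ?E4 e)"
    using E3 E4 by (intro measure_Un_le sets.finite_UN finite_pairs)
  also have "prob ?E3 \<le> real (card F) * real (d - 1) / R\<^sup>2"
    using m0 d1 \<Lambda> by (intro prob_tail_norm_gt F) (simp add: R)
  also have "\<dots> \<le> m * real (d - 1) / R\<^sup>2" using F(3) by (intro divide_right_mono mult_right_mono) auto
  also have "\<dots> = 1 / \<Lambda>" unfolding R using m0 d1 by simp
  also have "prob (\<Union>e\<in>pairs n. ?E4 e) \<le> (\<Sum>e\<in>pairs n. prob (?E4 e))"
    using E4 by (intro finite_measure_subadditive_finite) auto
  also have "\<dots> \<le> (\<Sum>e\<in>pairs n. 2 * exp (- l\<^sup>2 / 2))"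
    using F by (intro sum_mono prob_inner_tail_sum_gt l) auto
  also have "\<dots> \<le> (real n)\<^sup>2 * (2 * exp (- l\<^sup>2 / 2))"
    using card_pairs_le[of n] by (simp add: mult_right_mono)
  finally show ?thesis by simp
qed

text \<open>The event is split according to the graph \<open>G\<close> of the first coordinates,
  which determines the star. Within each piece the star is fixed and the tails are independent of
  the piece, so the same bound applies; the pieces are disjoint and their probabilities add up to at
  most \<open>1\<close>.\<close>

lemma prob_no_connected_direction_le:
  assumes h: "2 \<le> h" "h \<le> n" and d: "d \<ge> 2" and l: "0 \<le> l" and \<Lambda>: "\<Lambda> > 0" and \<theta>: "1 \<le> \<theta>"
    and R: "0 < R" "R\<^sup>2 = 2 * real h * real (d - 1) * \<Lambda>"
    and b: "0 \<le> b" "b \<le> 1" and \<tau>: "0 \<le> \<tau>"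
    and A: "t \<le> sqrt (1 - b\<^sup>2) * \<tau> - b * l"
    and Q: "0 < Q" "Q \<le> real (d - 1) / 2 - l * (R + 2 * sqrt (real (d - 1)))" and B: "t + l \<le> b * Q / R"
  shows "prob {\<omega>\<in>space M. \<not> (\<exists>s\<in>unit_sphere d. graph_connected (Gam n d (\<lambda>e. X e \<omega>) s t))} \<le>
    exp (real n * (exp (- (gtail \<tau> * real n / 2)) * \<theta>) - real h * ln \<theta>) +
    4 * (real n)\<^sup>2 * exp (- l\<^sup>2 / 2) + 4 * real h * exp (- real (d - 1) / 12) + 1 / \<Lambda>"
proof -
  have d1: "d \<ge> 1" using d by simp
  let ?x = "\<lambda>\<omega> e. X e \<omega>"
  let ?G = "{G\<in>Pow (pairs n). no_sparse_cut n h G}"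
  let ?H = "\<lambda>G. {\<omega>\<in>space M. head_edges \<tau> \<omega> = G}"
  let ?Bd = "\<lambda>G. {\<omega>\<in>space M. bad_tails n d l R (repair_star n h G) (?x \<omega>)}"
  let ?S = "{\<omega>\<in>space M. \<not> no_sparse_cut n h (head_edges \<tau> \<omega>)}"
  let ?Z = "\<lambda>e. {\<omega>\<in>space M. \<bar>X e \<omega> 0\<bar> \<ge> l}"
  let ?\<beta> = "4 * real h * exp (- real (d - 1) / 12) + 1 / \<Lambda> + 2 * (real n)\<^sup>2 * exp (- l\<^sup>2 / 2)"
  have fG: "finite ?G" by simp
  have S: "?S \<in> events" "prob ?S \<le> exp (real n * (exp (- (gtail \<tau> * real n / 2)) * \<theta>) - real h * ln \<theta>)"
    using random_graph.prob_sparse_cut[OF random_graph_head(1)[OF d1], of \<tau> \<theta> h] \<theta>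
    unfolding random_graph_head(2)[OF d1] by simp_all
  have Zm: "?Z e \<in> events" if "e \<in> pairs n" for e
  proof -
    have [measurable]: "(\<lambda>\<omega>. X e \<omega> 0) \<in> borel_measurable M" using that d by (intro measurable_X) auto
    show ?thesis by measurable
  qed
  have H: "?H G \<in> events" if "G \<in> ?G" for G using that by (intro measurable_head_edges[OF d1]) auto
  have Bm: "?Bd G \<in> events" for G
  proof -
    have "Measurable.pred M (\<lambda>\<omega>. bad_tails n d l R (repair_star n h G) (?x \<omega>))"
      by (rule measurable_bad_tails[OF repair_star_subset]) (auto intro: measurable_X)
    thus ?thesis by (simp add: pred_def)
  qed
  have sub: "{\<omega>\<in>space M. \<not> (\<exists>s\<in>unit_sphere d. graph_connected (Gam n d (?x \<omega>) s t))} \<subseteq>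
    ?S \<union> ((\<Union>e\<in>pairs n. ?Z e) \<union> (\<Union>G\<in>?G. ?H G \<inter> ?Bd G))"
  proof (rule subsetI, rule ccontr)
    fix \<omega> assume w: "\<omega> \<in> {\<omega>\<in>space M. \<not> (\<exists>s\<in>unit_sphere d. graph_connected (Gam n d (?x \<omega>) s t))}"
      and nw: "\<omega> \<notin> ?S \<union> ((\<Union>e\<in>pairs n. ?Z e) \<union> (\<Union>G\<in>?G. ?H G \<inter> ?Bd G))"
    let ?E = "head_edges \<tau> \<omega>"
    let ?F = "repair_star n h ?E"
    have ws: "\<omega> \<in> space M" using w by simp
    have nosp: "no_sparse_cut n h ?E" using nw ws by auto
    have Ep: "?E \<subseteq> pairs n" by (auto simp: head_edges_def)
    have good: "\<not> bad_tails n d l R ?F (?x \<omega>)" using nw ws nosp Ep by blast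
    have Z: "\<bar>X e \<omega> 0\<bar> \<le> l" if "e \<in> pairs n" for e using nw ws that by force
    \<comment> \<open>\<open>h \<ge> 2\<close> guarantees this edge, so the sum of the tails has at
      least one summand.\<close>
    have "(1, 2) \<in> ?F" using h by (auto simp: repair_star_def)
    hence Fne: "?F \<noteq> {}" by blast
    have "\<exists>s\<in>unit_sphere d. \<forall>e\<in>?E \<union> ?F. inner_prod d (?x \<omega> e) s \<ge> t"
      by (rule exists_direction[OF d repair_star_subset Fne good Z _ b l R(1) \<tau> A Q B]) (auto simp: head_edges_def)
    then obtain s where s: "s \<in> unit_sphere d" "\<forall>e\<in>?E \<union> ?F. inner_prod d (?x \<omega> e) s \<ge> t" by blast
    have "?E \<union> ?F \<subseteq> edge_set n d (?x \<omega>) s t" using s(2) Ep repair_star_subset[of n h ?E] unfolding edge_set_def by blast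
    moreover have "cut_connected n (?E \<union> ?F)" using h by (intro repair_star_connected) auto
    ultimately have "cut_connected n (edge_set n d (?x \<omega>) s t)" using cut_connected_mono by blast
    hence "graph_connected (Gam n d (?x \<omega>) s t)" using h by (simp add: graph_connected_Gam)
    thus False using w s(1) by blast
  qed
  have "prob {\<omega>\<in>space M. \<not> (\<exists>s\<in>unit_sphere d. graph_connected (Gam n d (?x \<omega>) s t))} \<le>
    prob (?S \<union> ((\<Union>e\<in>pairs n. ?Z e) \<union> (\<Union>G\<in>?G. ?H G \<inter> ?Bd G)))"
    using S(1) Zm H Bm by (intro finite_measure_mono[OF sub] sets.Un sets.finite_UN sets.Int fG finite_pairs)
  also have "\<dots> \<le> prob ?S + prob ((\<Union>e\<in>pairs n. ?Z e) \<union> (\<Union>G\<in>?G. ?H G \<inter> ?Bd G))"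
    using S(1) Zm H Bm by (intro measure_Un_le sets.Un sets.finite_UN sets.Int fG finite_pairs)
  also have "prob ((\<Union>e\<in>pairs n. ?Z e) \<union> (\<Union>G\<in>?G. ?H G \<inter> ?Bd G)) \<le> prob (\<Union>e\<in>pairs n. ?Z e) + prob (\<Union>G\<in>?G. ?H G \<inter> ?Bd G)"
    using Zm H Bm by (intro measure_Un_le sets.finite_UN sets.Int fG finite_pairs)
  also have "prob (\<Union>e\<in>pairs n. ?Z e) \<le> (\<Sum>e\<in>pairs n. prob (?Z e))"
    using Zm by (intro finite_measure_subadditive_finite) auto
  also have "\<dots> \<le> (\<Sum>e\<in>pairs n. 2 * exp (- l\<^sup>2 / 2))"
    using d by (intro sum_mono prob_std_normal_abs_ge normal l) auto
  also have "\<dots> \<le> (real n)\<^sup>2 * (2 * exp (- l\<^sup>2 / 2))"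
    using card_pairs_le[of n] by (simp add: mult_right_mono)
  also have "prob (\<Union>G\<in>?G. ?H G \<inter> ?Bd G) \<le> (\<Sum>G\<in>?G. prob (?H G \<inter> ?Bd G))"
    using H Bm by (intro finite_measure_subadditive_finite fG) auto
  also have "\<dots> \<le> (\<Sum>G\<in>?G. prob (?H G) * ?\<beta>)"
  proof (rule sum_mono)
    fix G assume G: "G \<in> ?G"
    have "(1, 2) \<in> repair_star n h G" using h by (auto simp: repair_star_def)
    hence ne: "repair_star n h G \<noteq> {}" by blast
    have "card (repair_star n h G) \<le> 2 * h" using G h by (intro card_repair_star) auto
    hence cd: "real (card (repair_star n h G)) \<le> 2 * real h" by linarith
    have "prob (?Bd G) \<le> ?\<beta>"
      using prob_bad_tails[OF repair_star_subset ne cd d l \<Lambda> R(2)] by simp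
    hence "prob (?H G) * prob (?Bd G) \<le> prob (?H G) * ?\<beta>" by (intro mult_left_mono) auto
    thus "prob (?H G \<inter> ?Bd G) \<le> prob (?H G) * ?\<beta>" using G by (subst head_bad_indep[OF repair_star_subset d1]) auto
  qed
  also have "\<dots> = (\<Sum>G\<in>?G. prob (?H G)) * ?\<beta>" by (rule sum_distrib_right[symmetric])
  also have "(\<Sum>G\<in>?G. prob (?H G)) = prob (\<Union>G\<in>?G. ?H G)"
    using H by (intro finite_measure_finite_Union[symmetric] fG) (auto simp: disjoint_family_on_def)
  also have "prob (\<Union>G\<in>?G. ?H G) * ?\<beta> \<le> 1 * ?\<beta>" using \<Lambda> by (intro mult_right_mono prob_le_1 add_nonneg_nonneg) auto
  finally show ?thesis using S(2) by simp
qed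

end

text \<open>The signal is of order \<open>d\<close> and the norm of the sum of tails of order
  \<open>sqrt (h * d * \<Lambda>)\<close>. With \<open>h\<close> about
  \<open>n powr (1 - \<gamma>)\<close> and \<open>d\<close> at least \<open>n\<close>, their ratio
  is a positive power of \<open>n\<close>, so a tilt that is itself a negative power of
  \<open>n\<close> suffices. The slack that it requires in the first coordinate costs at most half
  of the edge probability.\<close>

lemma exists_connected_whp:
  assumes c: "c > 0" and g: "gaussian_model c d M X"
    and D: "\<forall>\<^sub>F n in sequentially. real (d n) \<ge> real n * sqrt (ln (real n))"
  shows "whp M (\<lambda>n \<omega>. \<exists>s\<in>unit_sphere (d n). graph_connected (rand_graph c d X n \<omega> s))"
proof -
  \<comment> \<open>At half the edge probability a vertex set of size \<open>k\<close> has an empty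
    cut with probability at most \<open>n powr (- c / 4 * k)\<close>. The bound
    \<open>4 * \<gamma> \<le> c / 4\<close> makes this \<open>n powr (- 4 * \<gamma> * k)\<close>,
    so that with \<open>\<theta> = n powr \<gamma>\<close> the term
    \<open>n powr (1 - 3 * \<gamma>)\<close> stays below \<open>h * ln \<theta>\<close>.\<close>
  define \<gamma> where "\<gamma> = min c 1 / 16"
  have \<gamma>: "0 < \<gamma>" "\<gamma> \<le> 1 / 16" "4 * \<gamma> \<le> c / 4" using c by (auto simp: \<gamma>_def)
  define h where "h n = nat \<lceil>real n powr (1 - \<gamma>)\<rceil>" for n :: nat
  define f where "f n = exp (real n powr (1 - 3 * \<gamma>) - real n powr (1 - \<gamma>) * (\<gamma> * ln (real n))) +
    4 * (real n)\<^sup>2 * exp (- (9 * ln (real n) / 2)) + 4 * (real n powr (1 - \<gamma>) + 1) * exp (- (real n - 1) / 12) +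
    1 / real n powr (\<gamma> / 4)" for n :: nat
  have f0: "f \<longlonglongrightarrow> 0"
  proof -
    have "(\<lambda>n::nat. exp (real n powr (1 - 3 * \<gamma>) - real n powr (1 - \<gamma>) * (\<gamma> * ln (real n)))) \<longlonglongrightarrow> 0" using \<gamma> by real_asymp
    moreover have "(\<lambda>n::nat. 4 * (real n)\<^sup>2 * exp (- (9 * ln (real n) / 2))) \<longlonglongrightarrow> 0" by real_asymp
    moreover have "(\<lambda>n::nat. 4 * (real n powr (1 - \<gamma>) + 1) * exp (- (real n - 1) / 12)) \<longlonglongrightarrow> 0" using \<gamma> by real_asymp
    moreover have "(\<lambda>n::nat. 1 / real n powr (\<gamma> / 4)) \<longlonglongrightarrow> 0" using \<gamma> by real_asymp
    ultimately have "f \<longlonglongrightarrow> 0 + 0 + 0 + 0" unfolding f_def by (intro tendsto_add)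
    thus ?thesis by simp
  qed
  have a1: "\<forall>\<^sub>F n::nat in sequentially. 2 \<le> real n powr (1 - \<gamma>)" using \<gamma> by real_asymp
  have a2: "\<forall>\<^sub>F n::nat in sequentially. real n powr (1 - \<gamma>) + 1 \<le> real n" using \<gamma> by real_asymp
  have a3: "\<forall>\<^sub>F n::nat in sequentially. 3 * sqrt (ln (real n)) * (sqrt (2 * (real n powr (1 - \<gamma>) + 1) * real n powr (\<gamma> / 4)) + 2) \<le> sqrt (real n - 1) / 4"
    using \<gamma> by real_asymp
  have a4: "\<forall>\<^sub>F n::nat in sequentially. sqrt (2 * ln (real n)) + 3 * sqrt (ln (real n)) \<le>
     real n powr (- \<gamma> / 4) * sqrt (real n - 1) / (4 * sqrt (2 * (real n powr (1 - \<gamma>) + 1) * real n powr (\<gamma> / 4)))"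
    using \<gamma> by real_asymp
  have a5: "\<forall>\<^sub>F n::nat in sequentially. (real n powr (- \<gamma> / 4))\<^sup>2 * (sqrt (2 * ln (real n)) + real n powr (- \<gamma> / 8)) + real n powr (- \<gamma> / 4) * (3 * sqrt (ln (real n)))
     \<le> real n powr (- \<gamma> / 8)"
    using \<gamma> by real_asymp
  have a6: "\<forall>\<^sub>F n::nat in sequentially. real n powr (- \<gamma> / 8) * (exp (3/2) * sqrt (2 * ln (real n))) \<le> 1/2"
    using \<gamma> by real_asymp
  have a7: "\<forall>\<^sub>F n::nat in sequentially. 1 \<le> sqrt (ln (real n))" by real_asymp
  show ?thesis
  proof (rule whpI[OF _ f0])
    show "\<forall>\<^sub>F n in sequentially. prob_space (M n) \<and>
      {\<omega>\<in>space (M n). \<exists>s\<in>unit_sphere (d n). graph_connected (rand_graph c d X n \<omega> s)} \<in> sets (M n) \<and>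
      measure (M n) {\<omega>\<in>space (M n). \<not> (\<exists>s\<in>unit_sphere (d n). graph_connected (rand_graph c d X n \<omega> s))} \<le> f n"
      using eventually_model[OF c g] eventually_threshold[OF c] a1 a2 a3 a4 a5 a6 a7 D
    proof eventually_elim
      case (elim n)
      then interpret gauss_array "M n" n "d n" "X n" by simp
      let ?t = "threshold c n" and ?h = "h n" and ?L = "ln (real n)" and ?d = "real (d n - 1)"
      \<comment> \<open>The exponents are balanced: the star gains \<open>?b * ?Q / ?R\<close>, at
        least of order \<open>n powr (\<gamma> / 8)\<close>, against \<open>?t + ?l\<close> of order
        \<open>sqrt (ln n)\<close>. The other edges lose about \<open>?b * ?l\<close>, which is
        below \<open>?\<delta>\<close>, and \<open>?\<delta> * ?t\<close> still tends to
        \<open>0\<close>.\<close>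
      let ?x = "real n powr (1 - \<gamma>)" and ?\<Lambda> = "real n powr (\<gamma> / 4)" and ?l = "3 * sqrt (ln (real n))"
      let ?b = "real n powr (- \<gamma> / 4)" and ?\<delta> = "real n powr (- \<gamma> / 8)" and ?\<theta> = "real n powr \<gamma>"
      let ?\<tau> = "?t + ?\<delta>"
      let ?W = "2 * real ?h * ?\<Lambda>" and ?W' = "2 * (?x + 1) * ?\<Lambda>"
      let ?R = "sqrt (?W * ?d)" and ?Q = "?d / 4"
      have n: "n \<ge> 3" "real n \<ge> 3" using elim by auto
      have L0: "?L > 0" using n by simp
      have t: "1 \<le> ?t" "?t \<le> sqrt (2 * ?L)" using elim(2) by auto
      have dn: "real n - 1 \<le> ?d" "d n \<ge> 2"
      proof -
        have "real n * 1 \<le> real n * sqrt ?L" using elim(9) n by (intro mult_left_mono) auto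
        hence "real n \<le> real (d n)" using elim(10) by simp
        thus "real n - 1 \<le> ?d" "d n \<ge> 2" using n by auto
      qed
      have d0: "?d > 0" using dn n by simp
      have hx: "?x \<le> real ?h" "real ?h \<le> ?x + 1" using elim(3) unfolding h_def by linarith+
      have h2: "2 \<le> ?h" "?h \<le> n" using hx elim(3,4) by linarith+
      have \<Lambda>: "?\<Lambda> > 0" using n by simp
      have W: "0 < ?W" "?W \<le> ?W'" using h2 \<Lambda> hx by (auto intro!: mult_right_mono)
      have Wd: "0 < ?W * ?d" using W(1) d0 by (rule mult_pos_pos)
      hence "?R\<^sup>2 = ?W * ?d" by (intro real_sqrt_pow2) (rule less_imp_le)
      with Wd have R: "0 < ?R" "?R\<^sup>2 = 2 * real ?h * ?d * ?\<Lambda>" by (simp_all only: real_sqrt_gt_zero mult_ac)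
      have Rs: "?R = sqrt ?W * sqrt ?d" by (rule real_sqrt_mult)
      have sW: "sqrt ?W \<le> sqrt ?W'" "0 < sqrt ?W" using W by auto
      have sd: "sqrt (real n - 1) \<le> sqrt ?d" "0 < sqrt ?d" using dn d0 by auto
      have b: "0 \<le> ?b" "?b \<le> 1" using n \<gamma> powr_mono[of "- \<gamma> / 4" 0 "real n"] by auto
      have \<delta>: "0 \<le> ?\<delta>" by simp
      have A: "?t \<le> sqrt (1 - ?b\<^sup>2) * ?\<tau> - ?b * ?l"
      proof -
        have b2: "?b\<^sup>2 \<le> 1" using b by (simp add: power_le_one)
        \<comment> \<open>Bounding the root below by \<open>1 - ?b\<^sup>2\<close> makes the loss in
          the first coordinate linear in \<open>?b\<^sup>2\<close>.\<close>
        have "(1 - ?b\<^sup>2)\<^sup>2 \<le> 1 - ?b\<^sup>2"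
          using b2 mult_left_mono[of "1 - ?b\<^sup>2" 1 "1 - ?b\<^sup>2"] by (simp add: power2_eq_square)
        hence "1 - ?b\<^sup>2 \<le> sqrt (1 - ?b\<^sup>2)" by (rule real_le_rsqrt)
        hence "(1 - ?b\<^sup>2) * ?\<tau> \<le> sqrt (1 - ?b\<^sup>2) * ?\<tau>" using t \<delta> by (intro mult_right_mono) auto
        moreover have "?b\<^sup>2 * ?\<tau> \<le> ?b\<^sup>2 * (sqrt (2 * ?L) + ?\<delta>)" using t by (intro mult_left_mono) auto
        ultimately show ?thesis using elim(7) by (simp add: algebra_simps)
      qed
      have Q: "0 < ?Q" "?Q \<le> ?d / 2 - ?l * (?R + 2 * sqrt ?d)"
      proof -
        show "0 < ?Q" using d0 by simp
        have "?l * (sqrt ?W + 2) \<le> ?l * (sqrt ?W' + 2)" using sW L0 by (intro mult_left_mono) auto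
        also have "\<dots> \<le> sqrt (real n - 1) / 4" by (rule elim(5))
        also have "\<dots> \<le> sqrt ?d / 4" using sd by simp
        finally have "?l * (sqrt ?W + 2) * sqrt ?d \<le> sqrt ?d / 4 * sqrt ?d" using sd by (intro mult_right_mono) auto
        hence "?l * (?R + 2 * sqrt ?d) \<le> ?d / 4" unfolding Rs by (simp add: algebra_simps)
        thus "?Q \<le> ?d / 2 - ?l * (?R + 2 * sqrt ?d)" by simp
      qed
      have B: "?t + ?l \<le> ?b * ?Q / ?R"
      proof -
        have "?t + ?l \<le> ?b * sqrt (real n - 1) / (4 * sqrt ?W')" using elim(6) t by linarith
        also have "\<dots> \<le> ?b * sqrt ?d / (4 * sqrt ?W)"
          using b sd sW n by (intro frac_le mult_left_mono mult_nonneg_nonneg) auto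
        also have "\<dots> = ?b * (sqrt ?d * sqrt ?d / 4) / (sqrt ?W * sqrt ?d)"
        proof -
          have "x * v / (4 * w) = x * (v * v / 4) / (w * v)" if "v > 0" "w > 0" for x v w :: real
            using that by (simp add: field_simps)
          thus ?thesis using sd(2) sW(2) by blast
        qed
        also have "\<dots> = ?b * ?Q / ?R" unfolding Rs using d0 by simp
        finally show ?thesis .
      qed
      have p: "gtail ?t = c * ?L / real n" using elim by (simp add: edge_prob_def)
      have q: "c * ?L / real n / 2 \<le> gtail ?\<tau>"
      proof -
        have "gtail ?t - gtail ?\<tau> \<le> (?\<tau> - ?t) * std_normal_density ?t"
          using t \<delta> by (intro gtail_diff_le_density) auto
        also have "\<dots> \<le> ?\<delta> * (exp (3/2) * ?t * gtail ?t)"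
          using std_normal_density_le_gtail[OF t(1)] \<delta> by (simp add: mult_left_mono)
        also have "\<dots> \<le> ?\<delta> * (exp (3/2) * sqrt (2 * ?L) * gtail ?t)"
          using t \<delta> by (intro mult_left_mono mult_right_mono) auto
        also have "\<dots> = ?\<delta> * (exp (3/2) * sqrt (2 * ?L)) * gtail ?t" by simp
        also have "\<dots> \<le> 1/2 * gtail ?t" using elim(8) by (intro mult_right_mono) auto
        finally show ?thesis using p by simp
      qed
      have \<theta>: "1 \<le> ?\<theta>" using n \<gamma> by (intro ge_one_powr_ge_zero) auto
      have "prob {\<omega>\<in>space (M n). \<not> (\<exists>s\<in>unit_sphere (d n). graph_connected (Gam n (d n) (\<lambda>e. X n e \<omega>) s ?t))} \<le>
        exp (real n * (exp (- (gtail ?\<tau> * real n / 2)) * ?\<theta>) - real ?h * ln ?\<theta>) +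
        4 * (real n)\<^sup>2 * exp (- ?l\<^sup>2 / 2) + 4 * real ?h * exp (- ?d / 12) + 1 / ?\<Lambda>"
        using t \<delta> L0 by (intro prob_no_connected_direction_le[OF h2 dn(2) _ \<Lambda> \<theta> R b _ A Q B]) auto
      also have "\<dots> \<le> f n" unfolding f_def
      proof (intro add_mono order_refl)
        have "exp (- (gtail ?\<tau> * real n / 2)) \<le> exp (- (4 * \<gamma>) * ?L)"
        proof -
          have "4 * \<gamma> * ?L \<le> c / 4 * ?L" using \<gamma> L0 by (intro mult_right_mono) auto
          also have "\<dots> = c * ?L / real n / 2 * real n / 2" using n by simp
          also have "\<dots> \<le> gtail ?\<tau> * real n / 2" using q by (intro divide_right_mono mult_right_mono) auto
          finally show ?thesis by simp
        qed
        hence "real n * (exp (- (gtail ?\<tau> * real n / 2)) * ?\<theta>) \<le> real n * (exp (- (4 * \<gamma>) * ?L) * ?\<theta>)"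
          by (intro mult_left_mono mult_right_mono) auto
        also have "\<dots> = real n powr 1 * (real n powr (- (4 * \<gamma>)) * real n powr \<gamma>)" using n by (simp add: powr_def)
        also have "\<dots> = real n powr (1 - 3 * \<gamma>)" unfolding powr_add[symmetric] by simp
        finally have 1: "real n * (exp (- (gtail ?\<tau> * real n / 2)) * ?\<theta>) \<le> real n powr (1 - 3 * \<gamma>)" .
        have "ln ?\<theta> = \<gamma> * ?L" using n by (simp add: ln_powr)
        hence "?x * (\<gamma> * ?L) \<le> real ?h * ln ?\<theta>" using hx \<gamma> L0 by (simp add: mult_right_mono)
        with 1 show "exp (real n * (exp (- (gtail ?\<tau> * real n / 2)) * ?\<theta>) - real ?h * ln ?\<theta>)
          \<le> exp (real n powr (1 - 3 * \<gamma>) - ?x * (\<gamma> * ?L))" by simp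
        show "4 * (real n)\<^sup>2 * exp (- ?l\<^sup>2 / 2) \<le> 4 * (real n)\<^sup>2 * exp (- (9 * ?L / 2))" using L0 by (simp add: power_mult_distrib)
        show "4 * real ?h * exp (- ?d / 12) \<le> 4 * (?x + 1) * exp (- (real n - 1) / 12)"
          using hx dn by (intro mult_mono) auto
      qed
      finally have "prob {\<omega>\<in>space (M n). \<not> (\<exists>s\<in>unit_sphere (d n). graph_connected (Gam n (d n) (\<lambda>e. X n e \<omega>) s ?t))} \<le> f n" .
      moreover have "{\<omega>\<in>space (M n). \<exists>s\<in>unit_sphere (d n). graph_connected (Gam n (d n) (\<lambda>e. X n e \<omega>) s ?t)} \<in> sets (M n)"
        using n measurable_X by (intro measurable_exists_connected) auto
      ultimately show ?case using prob_space_axioms unfolding rand_graph_def by simp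
    qed
  qed
qed

theorem theorem4p1:
  shows "\<exists>C>0. \<forall>(c::real) (d :: nat \<Rightarrow> nat) (M :: nat \<Rightarrow> 'w measure) X.
    c > 0 \<longrightarrow> gaussian_model c d M X \<longrightarrow>
      (c < 1 \<longrightarrow> (\<forall>\<epsilon>. 0 < \<epsilon> \<and> \<epsilon> < c \<longrightarrow>
         (\<lambda>n. real (d n)) \<in> O(\<lambda>n. real n powr (1 - c - \<epsilon>)) \<longrightarrow>
         whp M (\<lambda>n \<omega>. \<forall>s\<in>unit_sphere (d n). \<not> graph_connected (rand_graph c d X n \<omega> s))))
    \<and> ((\<forall>\<^sub>F n in sequentially. real (d n) \<ge> C * real n * sqrt (ln (real n))) \<longrightarrow>
         whp M (\<lambda>n \<omega>. \<exists>s\<in>unit_sphere (d n). graph_connected (rand_graph c d X n \<omega> s)))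
    \<and> (c > 1 \<longrightarrow> (\<forall>\<epsilon>>0.
         (\<forall>\<^sub>F n in sequentially.
            real (d n) \<le> (1 - \<epsilon>) * (c - 1) * ln (real n) / ln (ln (real n))) \<longrightarrow>
         whp M (\<lambda>n \<omega>. \<forall>s\<in>unit_sphere (d n). graph_connected (rand_graph c d X n \<omega> s))))
    \<and> (c > 1 \<longrightarrow> (\<forall>\<epsilon>>0.
         (\<forall>\<^sub>F n in sequentially.
            real (d n) \<ge> (2 + \<epsilon>) * (c - 1) * ln (real n) / ln (ln (real n))) \<longrightarrow>
         whp M (\<lambda>n \<omega>. \<exists>s\<in>unit_sphere (d n). \<not> graph_connected (rand_graph c d X n \<omega> s))))"
\<comment> \<open>The estimates for a connected direction leave a power of \<open>n\<close> to
  spare, so the constant can be \<open>1\<close>.\<close>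
proof (intro exI[of _ 1] conjI allI impI)
  fix c :: real and d :: "nat \<Rightarrow> nat" and M :: "nat \<Rightarrow> 'w measure" and X
  assume c: "c > 0" and g: "gaussian_model c d M X"
  show "whp M (\<lambda>n \<omega>. \<forall>s\<in>unit_sphere (d n). \<not> graph_connected (rand_graph c d X n \<omega> s))"
    if "c < 1" "0 < \<epsilon> \<and> \<epsilon> < c" "(\<lambda>n. real (d n)) \<in> O(\<lambda>n. real n powr (1 - c - \<epsilon>))" for \<epsilon>
    using that by (intro disconnected_whp[OF c _ g, of \<epsilon>]) auto
  show "whp M (\<lambda>n \<omega>. \<exists>s\<in>unit_sphere (d n). graph_connected (rand_graph c d X n \<omega> s))"
    if "\<forall>\<^sub>F n in sequentially. 1 * real n * sqrt (ln (real n)) \<le> real (d n)"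
    using that by (intro exists_connected_whp[OF c g]) simp
  show "whp M (\<lambda>n \<omega>. \<forall>s\<in>unit_sphere (d n). graph_connected (rand_graph c d X n \<omega> s))"
    if "1 < c" "0 < \<epsilon>"
      "\<forall>\<^sub>F n in sequentially. real (d n) \<le> (1 - \<epsilon>) * (c - 1) * ln (real n) / ln (ln (real n))" for \<epsilon>
    using that by (intro connected_whp[OF _ g])
  show "whp M (\<lambda>n \<omega>. \<exists>s\<in>unit_sphere (d n). \<not> graph_connected (rand_graph c d X n \<omega> s))"
    if "1 < c" "0 < \<epsilon>"
      "\<forall>\<^sub>F n in sequentially. real (d n) \<ge> (2 + \<epsilon>) * (c - 1) * ln (real n) / ln (ln (real n))" for \<epsilon>
    using that by (intro exists_disconnected_whp[OF _ g])
qed simp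

end
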